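(* For any dimension $d$ and any $0<\epsilon<1$, there is a deep ReLU network with $d$ inputs $x_1,\ldots,x_d$ that is capable of expressing, with accuracy $\epsilon$, any function $f$ in $X^{2,p}([0,1]^d)$ (where $2\le p\le\infty$) that satisfies $|f|_{\boldsymbol{2},\infty}\le 1$, and that has depth $\mathcal{O}(|\log_2\epsilon|\log_2 d)$ and size $\mathcal{O}\big(\epsilon^{-\frac12}|\log_2\epsilon|^{\frac32(d-1)+1}\log_2 d\big)$. Here "capable of expressing any such $f$ with accuracy $\epsilon$" means that the network architecture does not depend on $f$ and that, for every such $f$, there is a choice of the weights of the network (possibly depending on $f$) for which the function $f_N$ computed by the network satisfies $\Vert f-f_N\Vert_{L^\infty([0,1]^d)}\le\epsilon$.
   Context: ReLU networks. Let $\sigma(x)=\max(0,x)$ for $x\in\mathbb{R}$. A deep ReLU network with $d$ inputs consists of one or more layers of units. Each unit of a layer computes $\sigma(\boldsymbol{w}\cdot\boldsymbol{z}+\theta)$, where $\boldsymbol{z}$ is the vector of inputs to that layer (the network input $\boldsymbol{x}=(x_1,\ldots,x_d)$ for the first layer, the outputs of the previous layer otherwise), $\boldsymbol{w}$ is a real vector and $\theta\in\mathbb{R}$. The output of the network is a real linear combination of the outputs of the units of the last layer. The depth of the network is the number of layers, and its size is the total number of units. The architecture is the collection of layers, units and connections; the weights are all the real parameters. Asymptotic notation. A quantity is $\mathcal{O}(g(\epsilon))$ if there is a constant $C>0$ such that it is at most $C\,g(\epsilon)$ for all sufficiently small $\epsilon$; the constant $C=C(d)$ is allowed to depend on the dimension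 $d$. Korobov spaces. Let $\Omega=[0,1]^d$. For $2\le p\le\infty$, $$X^{2,p}(\Omega)=\{f\in L^p(\Omega): f|_{\partial\Omega}=0,\ D^{\boldsymbol{k}}f\in L^p(\Omega)\text{ for all }\boldsymbol{k}\in\mathbb{N}^d\text{ with }|\boldsymbol{k}|_\infty\le 2\},$$ where $\mathbb{N}$ includes $0$, $|\boldsymbol{k}|_\infty=\max_{1\le j\le d}k_j$, and $D^{\boldsymbol{k}}f=\partial^{k_1+\cdots+k_d}f/\partial x_1^{k_1}\cdots\partial x_d^{k_d}$ denotes weak partial derivatives. Further, $$|f|_{\boldsymbol{2},\infty}=\bigg\Vert\frac{\partial^{2d}f}{\partial x_1^2\cdots\partial x_d^2}\bigg\Vert_{L^\infty(\Omega)} .$$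
   Formalization: For d = 1 the factor log_2 d is 0, so the stated bounds would force depth and size 0, which no network has; the factor log_2 d is therefore replaced by max(1, log_2 d), which changes nothing for d ≥ 2. *)

theory Defs
  imports
    "HOL-Analysis.Analysis"
    "HOL-Library.Landau_Symbols"
    "HOL-Probability.Essential_Supremum"
begin

section \<open>Lebesgue spaces\<close>

definition Linf_norm :: "'a::euclidean_space set \<Rightarrow> ('a \<Rightarrow> real) \<Rightarrow> ereal" where
  "Linf_norm S f = esssup (lebesgue_on S) (\<lambda>x. ereal \<bar>f x\<bar>)"

definition Lp_space :: "ennreal \<Rightarrow> 'a::euclidean_space set \<Rightarrow> ('a \<Rightarrow> real) set" where
  "Lp_space p S = {f \<in> borel_measurable (lebesgue_on S).
     if p = \<infinity> then Linf_norm S f < \<infinity>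
     else integrable (lebesgue_on S) (\<lambda>x. \<bar>f x\<bar> powr enn2real p)}"


section \<open>Weak derivatives\<close>

definition partial_deriv :: "'d::finite \<Rightarrow> (real^'d \<Rightarrow> real) \<Rightarrow> real^'d \<Rightarrow> real" where
  "partial_deriv i \<phi> x = frechet_derivative \<phi> (at x) (axis i 1)"

definition iterated_partial :: "'d::finite list \<Rightarrow> (real^'d \<Rightarrow> real) \<Rightarrow> real^'d \<Rightarrow> real" where
  "iterated_partial is \<phi> = foldr partial_deriv is \<phi>"

text \<open>\<open>C\<^sup>\<infinity>\<close>: if every iterated partial derivative is differentiable, then all of them are continuous.\<close>

definition smooth :: "(real^'d::finite \<Rightarrow> real) \<Rightarrow> bool" where
  "smooth \<phi> \<longleftrightarrow> (\<forall>is x. iterated_partial is \<phi> differentiable (at x))"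

definition test_function :: "(real^'d::finite) set \<Rightarrow> (real^'d \<Rightarrow> real) \<Rightarrow> bool" where
  "test_function U \<phi> \<longleftrightarrow> smooth \<phi> \<and>
     compact (closure {x. \<phi> x \<noteq> 0}) \<and> closure {x. \<phi> x \<noteq> 0} \<subseteq> U"

definition locally_integrable :: "'a::euclidean_space set \<Rightarrow> ('a \<Rightarrow> real) \<Rightarrow> bool" where
  "locally_integrable U f \<longleftrightarrow> (\<forall>K. compact K \<and> K \<subseteq> U \<longrightarrow> f absolutely_integrable_on K)"

text \<open>
  \<open>has_weak_deriv U k f g\<close> says that \<open>g\<close> is a weak derivative \<open>D\<^sup>k f\<close> on the open set \<open>U\<close>, for a
  multi-index \<open>k\<close>. The classical derivative \<open>D\<^sup>k \<phi>\<close> is taken along a list of directions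
  in which each \<open>i\<close> occurs exactly \<open>k i\<close> times; since \<open>\<phi>\<close> is smooth, all such lists give the same
  function, so quantifying over all of them only avoids choosing an order on the coordinates.
\<close>

definition has_weak_deriv ::
  "(real^'d::finite) set \<Rightarrow> ('d \<Rightarrow> nat) \<Rightarrow> (real^'d \<Rightarrow> real) \<Rightarrow> (real^'d \<Rightarrow> real) \<Rightarrow> bool" where
  "has_weak_deriv U k f g \<longleftrightarrow>
     locally_integrable U f \<and> locally_integrable U g \<and>
     (\<forall>\<phi> is. test_function U \<phi> \<and> (\<forall>i. count_list is i = k i) \<longrightarrow>
        (LINT x:U|lebesgue. f x * iterated_partial is \<phi> x) =
        (-1) ^ (\<Sum>i\<in>UNIV. k i) * (LINT x:U|lebesgue. g x * \<phi> x))"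

text \<open>Determined only up to a null set, and meaningful only if a weak derivative exists.\<close>

definition weak_deriv ::
  "(real^'d::finite) set \<Rightarrow> ('d \<Rightarrow> nat) \<Rightarrow> (real^'d \<Rightarrow> real) \<Rightarrow> (real^'d \<Rightarrow> real)" where
  "weak_deriv U k f = (SOME g. has_weak_deriv U k f g)"


section \<open>Korobov spaces\<close>

abbreviation unit_cube :: "(real^'d::finite) set" where
  "unit_cube \<equiv> cbox 0 1"

text \<open>
  Elements of the Lebesgue spaces are understood up to null sets, and the boundary of the cube is a
  null set; a pointwise condition on the boundary would be void. A function with the mixed weak
  derivatives below always has a continuous representative on the closed cube (unique,
  by density), and boundary values are those of this representative.
\<close>

definition zero_on_boundary :: "(real^'d::finite \<Rightarrow> real) \<Rightarrow> bool" where
  "zero_on_boundary f \<longleftrightarrow>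
     (\<exists>g. continuous_on unit_cube g \<and> (AE x in lebesgue_on unit_cube. f x = g x) \<and>
          (\<forall>x\<in>frontier unit_cube. g x = 0))"

definition korobov_space :: "ennreal \<Rightarrow> (real^'d::finite \<Rightarrow> real) set" where
  "korobov_space p = {f \<in> Lp_space p unit_cube. zero_on_boundary f \<and>
     (\<forall>k. (\<forall>i. k i \<le> 2) \<longrightarrow>
        (\<exists>g. has_weak_deriv (interior unit_cube) k f g \<and> g \<in> Lp_space p unit_cube))}"

definition korobov_seminorm :: "(real^'d::finite \<Rightarrow> real) \<Rightarrow> ereal" where
  "korobov_seminorm f = Linf_norm unit_cube (weak_deriv (interior unit_cube) (\<lambda>i. 2) f)"


section \<open>Deep ReLU networks\<close>

definition relu :: "real \<Rightarrow> real" where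
  "relu x = max 0 x"

text \<open>
  Layers are numbered \<open>0, \<dots>, depth A - 1\<close>, and the units of layer \<open>l\<close> are numbered
  \<open>0, \<dots>, width A l - 1\<close>. Unit \<open>j\<close> of layer \<open>0\<close> is connected to the network inputs \<open>in_conn A j\<close>, and
  unit \<open>j\<close> of layer \<open>l + 1\<close> is connected to the units \<open>conn A l j\<close> of layer \<open>l\<close>.
\<close>

record 'd architecture =
  depth :: nat
  width :: "nat \<Rightarrow> nat"
  in_conn :: "nat \<Rightarrow> 'd set"
  conn :: "nat \<Rightarrow> nat \<Rightarrow> nat set"

definition valid_architecture :: "'d architecture \<Rightarrow> bool" where
  "valid_architecture A \<longleftrightarrow>
     depth A \<ge> 1 \<and>
     (\<forall>l<depth A. width A l \<ge> 1) \<and>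
     (\<forall>l j. Suc l < depth A \<and> j < width A (Suc l) \<longrightarrow> conn A l j \<subseteq> {..<width A l})"

definition network_size :: "'d architecture \<Rightarrow> nat" where
  "network_size A = (\<Sum>l<depth A. width A l)"

text \<open>\<open>in_weight W j i\<close> belongs to the connection from input \<open>i\<close> to unit \<open>j\<close> of layer \<open>0\<close>, and
  \<open>weight W l j i\<close> to the connection from unit \<open>i\<close> of layer \<open>l\<close> to unit \<open>j\<close> of layer \<open>l + 1\<close>.\<close>

record 'd weights =
  in_weight :: "nat \<Rightarrow> 'd \<Rightarrow> real"
  weight :: "nat \<Rightarrow> nat \<Rightarrow> nat \<Rightarrow> real"
  bias :: "nat \<Rightarrow> nat \<Rightarrow> real"
  out_weight :: "nat \<Rightarrow> real"

primrec unit_output ::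
  "'d::finite architecture \<Rightarrow> 'd weights \<Rightarrow> real^'d \<Rightarrow> nat \<Rightarrow> nat \<Rightarrow> real" where
  "unit_output A W x 0 = (\<lambda>j. relu ((\<Sum>i\<in>in_conn A j. in_weight W j i * x $ i) + bias W 0 j))"
| "unit_output A W x (Suc l) =
     (\<lambda>j. relu ((\<Sum>i\<in>conn A l j. weight W l j i * unit_output A W x l i) + bias W (Suc l) j))"

definition network_output ::
  "'d::finite architecture \<Rightarrow> 'd weights \<Rightarrow> real^'d \<Rightarrow> real" where
  "network_output A W x =
     (\<Sum>j<width A (depth A - 1). out_weight W j * unit_output A W x (depth A - 1) j)"

text \<open>The architecture is fixed before the function; only the weights may depend on it.\<close>

definition expresses ::
  "'d::finite architecture \<Rightarrow> (real^'d \<Rightarrow> real) \<Rightarrow> real \<Rightarrow> bool" where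
  "expresses A f \<epsilon> \<longleftrightarrow>
     (\<exists>W. Linf_norm unit_cube (\<lambda>x. f x - network_output A W x) \<le> ereal \<epsilon>)"

end

theory Submission
  imports Defs "HOL-Real_Asymp.Real_Asymp"
begin

text \<open>
  The continuous representative \<open>g\<close> of \<open>f\<close> is expanded in the hierarchical basis of tensor products of
  hat functions. The coefficient at a node is a surplus, a tensor product of second differences of \<open>g\<close>.
  As the mixed derivative of order two in each variable is bounded by one, the surplus on level \<open>l\<close> is at
  most \<open>4\<^bsup>-|l|\<^esup>\<close> with \<open>|l| = l\<^sub>1 + \<cdots> + l\<^sub>d\<close> (\<open>surplus_bound\<close>). The derivative is only a weak one, so the bound
  is obtained by testing with products of one-dimensional functions whose second derivatives are
  mollified stencils (\<open>second_difference_kernel\<close>).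

  This decay makes sparse grids efficient. Keeping the levels with \<open>|l| \<le> m\<close> leaves about \<open>m\<^bsup>d-1\<^esup> 2\<^sup>m\<close> basis
  functions and an error of about \<open>m\<^bsup>d-1\<^esup> 4\<^bsup>-m\<^esup>\<close> (\<open>sparse_grid_error\<close>). The coefficients are moreover absolutely
  summable, so it suffices to compute every basis function to an accuracy of the order of \<open>\<epsilon>\<close>.

  A basis function is a product of \<open>d\<close> hats. On the unit interval, \<open>t (1 - t)\<close> is the sum of the iterates
  of the tent map weighted by powers of \<open>1/4\<close>, and polarization reduces products to such terms; hence a
  bounded number of units per layer and \<open>O(|log \<epsilon>|)\<close> layers suffice for one product (\<open>relu_net_hat_product\<close>).
  The products of all basis functions are computed side by side in one fully connected network, and
  only its output weights depend on \<open>f\<close>.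

  Let \<open>m\<close> be the least level at which the sparse grid error is below \<open>\<epsilon> / 2\<close>. By minimality, \<open>4\<^sup>m\<close> is at most
  of the order of \<open>m\<^bsup>d-1\<^esup> / \<epsilon>\<close>, so \<open>m = O(|log \<epsilon>|)\<close> and the number of basis functions is
  \<open>O(\<epsilon>\<^bsup>-1/2\<^esup> |log \<epsilon>|\<^bsup>3/2 (d-1)\<^esup>)\<close> (\<open>grid_size_le\<close>). Multiplication by the depth gives the size. As the constants
  may depend on the dimension, the products are formed one factor at a time, at \<open>d\<close> times the depth of a
  single multiplication.
\<close>

section \<open>Hierarchical interpolation on dyadic grids\<close>

definition hat :: "real \<Rightarrow> real" where
  "hat s = max 0 (1 - \<bar>s\<bar>)"

lemma hat_bounds: "hat s \<in> {0..1}"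
  by (auto simp: hat_def)

lemma hat_nonneg: "0 \<le> hat s" and hat_le_1: "hat s \<le> 1"
  using hat_bounds[of s] by auto

lemma hat_refinement: "hat s = hat (2 * s) + hat (2 * s - 1) / 2 + hat (2 * s + 1) / 2"
  unfolding hat_def by (auto simp: max_def abs_if field_simps)

lemma hat_partition_of_unity:
  assumes "0 \<le> s" "s \<le> real N"
  shows "(\<Sum>i\<le>N. hat (s - real i)) = 1"
  using assms
proof (induction N)
  case 0
  then show ?case by (simp add: hat_def)
next
  case (Suc N)
  show ?case
  proof (cases "s \<le> real N")
    case True
    then have "hat (s - real (Suc N)) = 0" by (simp add: hat_def)
    then show ?thesis using Suc True by simp
  next
    case False
    have "(\<Sum>i<N. hat (s - real i)) = 0"
    proof (rule sum.neutral, rule ballI)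
      fix i assume "i \<in> {..<N}"
      then have "real i + 1 \<le> real N" by auto
      then show "hat (s - real i) = 0" using False by (simp add: hat_def)
    qed
    moreover have "hat (s - real N) + hat (s - real (Suc N)) = 1"
      using False Suc.prems by (simp add: hat_def)
    ultimately show ?thesis by (simp add: lessThan_Suc_atMost[symmetric] lessThan_Suc)
  qed
qed

lemma sum_odd_hats_le_1: "(\<Sum>k<N. hat (s - (2 * real k + 1))) \<le> 1"
proof (induction N)
  case (Suc N)
  show ?case
  proof (cases "s \<le> 2 * real N")
    case True
    then have "hat (s - (2 * real N + 1)) = 0" by (simp add: hat_def)
    then show ?thesis using Suc by simp
  next
    case False
    have "(\<Sum>k<N. hat (s - (2 * real k + 1))) = 0"
    proof (rule sum.neutral, rule ballI)
      fix k assume "k \<in> {..<N}"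
      then have "real k + 1 \<le> real N" by auto
      then show "hat (s - (2 * real k + 1)) = 0" using False by (simp add: hat_def)
    qed
    then show ?thesis using hat_le_1 by simp
  qed
qed simp

text \<open>
  The stencil \<open>u(y) - (u(y - h) + u(y + h)) / 2\<close>: minus one half of a second difference, and the
  amount by which \<open>u(y)\<close> exceeds the linear interpolant through the two neighbours.
\<close>

definition stencil_weight :: "real \<Rightarrow> real" where
  "stencil_weight e = (if e = 0 then 1 else -1/2)"

text \<open>
  The one-dimensional stencils applied in every coordinate. Expanding the product gives a sum over the
  \<open>3\<^sup>d\<close> choices of an offset in each coordinate; this form needs no order on the coordinates.
\<close>

definition surplus :: "(real^'d::finite \<Rightarrow> real) \<Rightarrow> ('d \<Rightarrow> real) \<Rightarrow> ('d \<Rightarrow> real) \<Rightarrow> real" where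
  "surplus g y h = (\<Sum>e\<in>PiE UNIV (\<lambda>_. {-1, 0, 1}).
     (\<Prod>j\<in>UNIV. stencil_weight (e j)) * g (\<chi> j. y j + e j * h j))"

text \<open>
  The one-dimensional surplus at the node \<open>(2 k + 1) / 2\<^bsup>l + 1\<^esup>\<close>, written as a weight on the point values of the
  function. Levels start at zero, so that level \<open>l\<close> has exactly the \<open>2\<^sup>l\<close> nodes with \<open>k < 2\<^sup>l\<close>.
\<close>

definition surplus_kernel :: "nat \<Rightarrow> nat \<Rightarrow> real \<Rightarrow> real" where
  "surplus_kernel l k y =
     (\<Sum>e\<in>{-1, 0, 1}. stencil_weight e * of_bool (y = (2 * real k + 1 + e) / 2 ^ Suc l))"

lemma surplus_kernel_same_level:
  "surplus_kernel n k (real i / 2 ^ Suc n) =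
     (if i = 2 * k + 1 then 1 else if i = 2 * k \<or> i = 2 * k + 2 then -1/2 else 0)"
proof -
  have *: "real i / 2 ^ Suc n = (2 * real k + 1 + e) / 2 ^ Suc n \<longleftrightarrow> real i = 2 * real k + 1 + e" for e
    by (simp add: divide_cancel_right)
  have "real i = 2 * real k + 1 + -1 \<longleftrightarrow> i = 2 * k" "real i = 2 * real k + 1 + 0 \<longleftrightarrow> i = 2 * k + 1"
    "real i = 2 * real k + 1 + 1 \<longleftrightarrow> i = 2 * k + 2"
    by linarith+
  then show ?thesis
    unfolding surplus_kernel_def * by (auto simp: stencil_weight_def)
qed

lemma surplus_kernel_coarser_level:
  assumes "odd i" "l < n"
  shows "surplus_kernel l k (real i / 2 ^ Suc n) = 0"
proof -
  have "real i / 2 ^ Suc n \<noteq> (2 * real k + 1 + e) / 2 ^ Suc l" if "e \<in> {-1, 0, 1}" for e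
  proof
    assume eq: "real i / 2 ^ Suc n = (2 * real k + 1 + e) / 2 ^ Suc l"
    obtain c where n: "n = Suc (l + c)" using assms(2) less_iff_Suc_add by auto
    have "2 * real k + 1 + e \<in> real ` {2 * k, 2 * k + 1, 2 * k + 2}" using that by auto
    then obtain q where q: "2 * real k + 1 + e = real q" by blast
    have "real i = real q * 2 ^ Suc c"
      using eq unfolding q n by (simp add: field_simps power_add)
    then have "real i = real (q * 2 ^ Suc c)" by simp
    then have "i = q * 2 ^ Suc c" using of_nat_eq_iff by blast
    then show False using assms(1) by simp
  qed
  then show ?thesis unfolding surplus_kernel_def by (intro sum.neutral) simp
qed

text \<open>
  The one-dimensional identity behind the hierarchical basis, tested on a single grid value. A point
  with even index belongs to the coarser grid, and the refinement equation corrects its hat by the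
  two new neighbours; a point with odd index is seen by no stencil of a coarser level. The end points
  are left out: they are no nodes of the hierarchy, and the functions of interest vanish there.
\<close>

lemma hat_hierarchical_decomposition:
  assumes "0 < i" "i < 2 ^ n"
  shows "hat (2 ^ n * t - real i) =
    (\<Sum>l<n. \<Sum>k<2 ^ l. hat (2 ^ Suc l * t - (2 * real k + 1)) * surplus_kernel l k (real i / 2 ^ n))"
  using assms
proof (induction n arbitrary: i)
  case 0
  then show ?case by simp
next
  case (Suc n)
  let ?\<phi> = "\<lambda>k. hat (2 ^ Suc n * t - (2 * real k + 1))"
  show ?case
  proof (cases "even i")
    case True
    then obtain r where r: "i = 2 * r" by blast
    then have r_bounds: "0 < r" "r < 2 ^ n" using Suc.prems by auto
    have "(\<Sum>k<2 ^ n. ?\<phi> k * surplus_kernel n k (real i / 2 ^ Suc n)) =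
      (\<Sum>k\<in>{r - 1, r}. ?\<phi> k * (- 1 / 2))"
      unfolding surplus_kernel_same_level r
      using r_bounds
      by (intro sum.mono_neutral_cong_right ballI) (simp_all, presburger, auto)
    also have "\<dots> = - (?\<phi> (r - 1) + ?\<phi> r) / 2" using r_bounds by (simp add: field_simps)
    also have "?\<phi> (r - 1) = hat (2 * (2 ^ n * t - real r) + 1)"
      using r_bounds by (simp add: of_nat_diff algebra_simps)
    also have "?\<phi> r = hat (2 * (2 ^ n * t - real r) - 1)" by (simp add: algebra_simps)
    finally have last: "(\<Sum>k<2 ^ n. ?\<phi> k * surplus_kernel n k (real i / 2 ^ Suc n)) =
      hat (2 * (2 ^ n * t - real r)) - hat (2 ^ n * t - real r)"
      using hat_refinement[of "2 ^ n * t - real r"] by (simp add: field_simps)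
    have "real i / 2 ^ Suc n = real r / 2 ^ n" using r by simp
    then have "(\<Sum>l<n. \<Sum>k<2 ^ l. hat (2 ^ Suc l * t - (2 * real k + 1)) * surplus_kernel l k (real i / 2 ^ Suc n))
      = hat (2 ^ n * t - real r)"
      using Suc.IH[OF r_bounds] by simp
    then show ?thesis using last r by (simp add: algebra_simps)
  next
    case False
    then obtain r where r: "i = 2 * r + 1" using oddE by blast
    have "(\<Sum>k<2 ^ n. ?\<phi> k * surplus_kernel n k (real i / 2 ^ Suc n)) = (\<Sum>k\<in>{r}. ?\<phi> k * 1)"
      unfolding surplus_kernel_same_level r
      using r Suc.prems
      by (intro sum.mono_neutral_cong_right ballI; simp; presburger?)
    then show ?thesis
      using surplus_kernel_coarser_level[OF False] r by (simp add: algebra_simps)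
  qed
qed

definition full_grid_interpolant :: "nat \<Rightarrow> (real^'d::finite \<Rightarrow> real) \<Rightarrow> real^'d \<Rightarrow> real" where
  "full_grid_interpolant n g x =
     (\<Sum>s\<in>PiE UNIV (\<lambda>_. {..2 ^ n}). (\<Prod>j\<in>UNIV. hat (2 ^ n * x $ j - real (s j))) * g (\<chi> j. real (s j) / 2 ^ n))"

definition grid_basis :: "('d::finite \<Rightarrow> nat) \<Rightarrow> ('d \<Rightarrow> nat) \<Rightarrow> real^'d \<Rightarrow> real" where
  "grid_basis l k x = (\<Prod>j\<in>UNIV. hat (2 ^ Suc (l j) * x $ j - (2 * real (k j) + 1)))"

definition grid_surplus :: "(real^'d::finite \<Rightarrow> real) \<Rightarrow> ('d \<Rightarrow> nat) \<Rightarrow> ('d \<Rightarrow> nat) \<Rightarrow> real" where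
  "grid_surplus g l k = surplus g (\<lambda>j. (2 * real (k j) + 1) / 2 ^ Suc (l j)) (\<lambda>j. 1 / 2 ^ Suc (l j))"

definition level_nodes :: "('d::finite \<Rightarrow> nat) \<Rightarrow> ('d \<Rightarrow> nat) set" where
  "level_nodes l = PiE UNIV (\<lambda>j. {..<2 ^ l j})"

lemma finite_level_nodes: "finite (level_nodes l)"
  unfolding level_nodes_def by (intro finite_PiE) auto

text \<open>
  The stencils of all levels below \<open>n\<close> only use points of the grid of mesh \<open>2\<^bsup>-n\<^esup>\<close>, so summing the
  product of kernels over that grid recovers the surplus.
\<close>

lemma surplus_as_grid_sum:
  fixes g :: "real^'d::finite \<Rightarrow> real"
  assumes l: "\<And>j. l j < n" and k: "\<And>j. k j < 2 ^ l j"
  shows "(\<Sum>s\<in>PiE UNIV (\<lambda>_. {..2 ^ n}). (\<Prod>j\<in>UNIV. surplus_kernel (l j) (k j) (real (s j) / 2 ^ n)) *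
            g (\<chi> j. real (s j) / 2 ^ n)) = grid_surplus g l k"
proof -
  let ?S = "PiE UNIV (\<lambda>_::'d. {..2 ^ n :: nat})" and ?E = "PiE UNIV (\<lambda>_::'d. {-1, 0, 1 :: real})"
  let ?z = "\<lambda>e j. (2 * real (k j) + 1 + e j) / 2 ^ Suc (l j)"
  have "(\<Sum>s\<in>?S. (\<Prod>j\<in>UNIV. surplus_kernel (l j) (k j) (real (s j) / 2 ^ n)) * g (\<chi> j. real (s j) / 2 ^ n)) =
    (\<Sum>s\<in>?S. \<Sum>e\<in>?E. (\<Prod>j\<in>UNIV. stencil_weight (e j) * of_bool (real (s j) / 2 ^ n = ?z e j)) *
       g (\<chi> j. real (s j) / 2 ^ n))"
    unfolding surplus_kernel_def by (subst prod_sum_PiE) (simp_all add: sum_distrib_right)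
  also have "\<dots> = (\<Sum>e\<in>?E. \<Sum>s\<in>?S. (\<Prod>j\<in>UNIV. stencil_weight (e j) * of_bool (real (s j) / 2 ^ n = ?z e j)) *
       g (\<chi> j. real (s j) / 2 ^ n))"
    by (rule sum.swap)
  also have "\<dots> = (\<Sum>e\<in>?E. (\<Prod>j\<in>UNIV. stencil_weight (e j)) * g (\<chi> j. ?z e j))"
  proof (rule sum.cong[OF refl])
    fix e assume e: "e \<in> ?E"
    have "\<exists>q. q \<le> 2 ^ n \<and> real q / 2 ^ n = ?z e j" for j
    proof -
      obtain c where n: "n = Suc (l j + c)" using l[of j] less_iff_Suc_add by auto
      have "e j \<in> {-1, 0, 1}" using e by auto
      then have "2 * real (k j) + 1 + e j \<in> real ` {2 * k j, 2 * k j + 1, 2 * k j + 2}" by auto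
      then obtain p where p: "2 * real (k j) + 1 + e j = real p" "p \<in> {2 * k j, 2 * k j + 1, 2 * k j + 2}" by blast
      have "Suc (k j) \<le> 2 ^ l j" using k[of j] by simp
      then have "p \<le> 2 ^ Suc (l j)" using p(2) by auto
      then have "p * 2 ^ c \<le> 2 ^ Suc (l j) * 2 ^ c" by (rule mult_right_mono) simp
      also have "\<dots> = 2 ^ n" unfolding n by (simp add: power_add)
      finally have "p * 2 ^ c \<le> 2 ^ n" .
      moreover have "real (p * 2 ^ c) / 2 ^ n = ?z e j"
        unfolding p(1) n by (simp add: power_add)
      ultimately show ?thesis by blast
    qed
    \<comment> \<open>Exactly one grid point coincides with the stencil point \<open>?z e\<close>.\<close>
    then obtain s0 where s0: "\<And>j. s0 j \<le> 2 ^ n" "\<And>j. real (s0 j) / 2 ^ n = ?z e j" by metis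
    have "(\<Prod>j\<in>UNIV. stencil_weight (e j) * of_bool (real (s j) / 2 ^ n = ?z e j)) * g (\<chi> j. real (s j) / 2 ^ n)
      = (if s = s0 then (\<Prod>j\<in>UNIV. stencil_weight (e j)) * g (\<chi> j. ?z e j) else 0)" for s
    proof (cases "s = s0")
      case True
      then show ?thesis using s0(2) by simp
    next
      case False
      then obtain j where "s j \<noteq> s0 j" by blast
      then have "real (s j) / 2 ^ n \<noteq> ?z e j" unfolding s0(2)[symmetric] by simp
      then have "(\<Prod>j\<in>UNIV. stencil_weight (e j) * of_bool (real (s j) / 2 ^ n = ?z e j)) = 0"
        by (intro prod_zero) auto
      then show ?thesis using False by simp
    qed
    moreover have "s0 \<in> ?S" using s0(1) by auto
    moreover have "finite ?S" by (intro finite_PiE) auto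
    ultimately show "(\<Sum>s\<in>?S. (\<Prod>j\<in>UNIV. stencil_weight (e j) * of_bool (real (s j) / 2 ^ n = ?z e j)) *
       g (\<chi> j. real (s j) / 2 ^ n)) = (\<Prod>j\<in>UNIV. stencil_weight (e j)) * g (\<chi> j. ?z e j)"
      by simp
  qed
  also have "\<dots> = grid_surplus g l k"
    unfolding grid_surplus_def surplus_def by (simp add: add_divide_distrib)
  finally show ?thesis .
qed

text \<open>
  Multiplying the one-dimensional decompositions over the coordinates turns interpolation on the full
  grid into the sum over all hierarchical basis functions. Grid points on the boundary do not obey
  the decomposition, but there \<open>g\<close> vanishes.
\<close>

lemma full_grid_hierarchical:
  fixes g :: "real^'d::finite \<Rightarrow> real"
  assumes boundary: "\<And>x. \<exists>j. x $ j \<in> {0, 1} \<Longrightarrow> x \<in> unit_cube \<Longrightarrow> g x = 0"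
  shows "full_grid_interpolant n g x =
    (\<Sum>l\<in>PiE UNIV (\<lambda>_. {..<n}). \<Sum>k\<in>level_nodes l. grid_surplus g l k * grid_basis l k x)"
proof -
  let ?S = "PiE UNIV (\<lambda>_::'d. {..2 ^ n :: nat})" and ?L = "PiE UNIV (\<lambda>_::'d. {..<n})"
  let ?a = "\<lambda>l k j. hat (2 ^ Suc (l j) * x $ j - (2 * real (k j) + 1))"
  let ?b = "\<lambda>l k s j. surplus_kernel (l j) (k j) (real (s j) / 2 ^ n)"
  let ?g = "\<lambda>s. g (\<chi> j. real (s j) / 2 ^ n)"
  have "full_grid_interpolant n g x = (\<Sum>s\<in>?S. (\<Prod>j\<in>UNIV. \<Sum>l<n. \<Sum>k<2 ^ l.
      hat (2 ^ Suc l * x $ j - (2 * real k + 1)) * surplus_kernel l k (real (s j) / 2 ^ n)) * ?g s)"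
    unfolding full_grid_interpolant_def
  proof (rule sum.cong[OF refl])
    fix s assume s: "s \<in> ?S"
    show "(\<Prod>j\<in>UNIV. hat (2 ^ n * x $ j - real (s j))) * ?g s = (\<Prod>j\<in>UNIV. \<Sum>l<n. \<Sum>k<2 ^ l.
      hat (2 ^ Suc l * x $ j - (2 * real k + 1)) * surplus_kernel l k (real (s j) / 2 ^ n)) * ?g s"
    proof (cases "\<forall>j. 0 < s j \<and> s j < 2 ^ n")
      case True
      then have "(\<Prod>j\<in>UNIV. hat (2 ^ n * x $ j - real (s j))) = (\<Prod>j\<in>UNIV. \<Sum>l<n. \<Sum>k<2 ^ l.
        hat (2 ^ Suc l * x $ j - (2 * real k + 1)) * surplus_kernel l k (real (s j) / 2 ^ n))"
        by (intro prod.cong refl hat_hierarchical_decomposition) auto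
      then show ?thesis by simp
    next
      case False
      then obtain j where j: "s j = 0 \<or> s j = 2 ^ n" using s by (metis PiE_mem UNIV_I atMost_iff bot_nat_0.not_eq_extremum le_neq_implies_less)
      have "real (s j) \<le> 2 ^ n" for j
      proof -
        have "s j \<le> 2 ^ n" using s by auto
        then show ?thesis by (metis of_nat_le_iff of_nat_numeral of_nat_power)
      qed
      then have "?g s = 0"
        using j by (intro boundary exI[of _ j]) (auto simp: mem_box_cart)
      then show ?thesis by simp
    qed
  qed
  also have "\<dots> = (\<Sum>s\<in>?S. (\<Sum>l\<in>?L. \<Sum>k\<in>level_nodes l. (\<Prod>j\<in>UNIV. ?a l k j * ?b l k s j)) * ?g s)"
    by (simp add: prod_sum_PiE level_nodes_def)
  also have "\<dots> = (\<Sum>s\<in>?S. \<Sum>l\<in>?L. \<Sum>k\<in>level_nodes l. grid_basis l k x * ((\<Prod>j\<in>UNIV. ?b l k s j) * ?g s))"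
    by (simp only: sum_distrib_right prod.distrib grid_basis_def mult.assoc)
  also have "\<dots> = (\<Sum>l\<in>?L. \<Sum>s\<in>?S. \<Sum>k\<in>level_nodes l. grid_basis l k x * ((\<Prod>j\<in>UNIV. ?b l k s j) * ?g s))"
    by (rule sum.swap)
  also have "\<dots> = (\<Sum>l\<in>?L. \<Sum>k\<in>level_nodes l. \<Sum>s\<in>?S. grid_basis l k x * ((\<Prod>j\<in>UNIV. ?b l k s j) * ?g s))"
    by (intro sum.cong refl sum.swap)
  also have "\<dots> = (\<Sum>l\<in>?L. \<Sum>k\<in>level_nodes l. grid_surplus g l k * grid_basis l k x)"
  proof (intro sum.cong refl)
    fix l k assume "l \<in> ?L" "k \<in> level_nodes l"
    then have "\<And>j. l j < n" "\<And>j. k j < 2 ^ l j" by (auto simp: level_nodes_def PiE_iff)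
    from surplus_as_grid_sum[where g = g, OF this]
    show "(\<Sum>s\<in>?S. grid_basis l k x * ((\<Prod>j\<in>UNIV. ?b l k s j) * ?g s)) = grid_surplus g l k * grid_basis l k x"
      unfolding sum_distrib_left[symmetric] by (simp only: mult.commute)
  qed
  finally show ?thesis .
qed

text \<open>
  The interpolation weights are non-negative, add up to one, and vanish at grid points that are
  \<open>2\<^bsup>-n\<^esup>\<close> or more away in some coordinate; hence the interpolant is an average of nearby values.
\<close>

lemma full_grid_interpolant_converges:
  fixes g :: "real^'d::finite \<Rightarrow> real"
  assumes g: "continuous_on unit_cube g" and x: "x \<in> unit_cube"
  shows "(\<lambda>n. full_grid_interpolant n g x) \<longlonglongrightarrow> g x"
proof (rule LIMSEQ_I)
  fix r :: real assume "0 < r"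
  have "continuous (at x within unit_cube) g" using g x continuous_on_eq_continuous_within by blast
  then obtain \<delta> where \<delta>: "0 < \<delta>" "\<And>y. y \<in> unit_cube \<Longrightarrow> dist y x < \<delta> \<Longrightarrow> dist (g y) (g x) < r / 2"
    using \<open>0 < r\<close> unfolding continuous_within_eps_delta by (metis half_gt_zero)
  obtain N where N: "(1/2) ^ N < \<delta> / CARD('d)"
    using real_arch_pow_inv[of "\<delta> / CARD('d)" "1/2"] \<delta>(1) by auto
  have "norm (full_grid_interpolant n g x - g x) < r" if "N \<le> n" for n
  proof -
    let ?S = "PiE UNIV (\<lambda>_::'d. {..2 ^ n :: nat})"
    let ?w = "\<lambda>s. \<Prod>j\<in>UNIV. hat (2 ^ n * x $ j - real (s j))"
    let ?y = "\<lambda>s. \<chi> j. real (s j) / 2 ^ n"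
    have w_nonneg: "0 \<le> ?w s" for s by (intro prod_nonneg ballI hat_nonneg)
    have xj: "0 \<le> x $ j" "x $ j \<le> 1" for j using x by (auto simp: mem_box_cart)
    have "(\<Sum>s\<in>?S. ?w s) = (\<Prod>j\<in>UNIV. \<Sum>i\<le>2 ^ n. hat (2 ^ n * x $ j - real i))"
      by (subst prod_sum_PiE) auto
    also have "\<dots> = 1" using xj by (intro prod.neutral ballI hat_partition_of_unity) auto
    finally have w_sum: "(\<Sum>s\<in>?S. ?w s) = 1" .
    have term_bound: "\<bar>?w s * (g (?y s) - g x)\<bar> \<le> ?w s * (r / 2)" if s: "s \<in> ?S" for s
    proof (cases "?w s = 0")
      case False
      have "\<bar>?y s $ j - x $ j\<bar> < (1/2) ^ n" for j
      proof -
        have "hat (2 ^ n * x $ j - real (s j)) \<noteq> 0" using False by (metis UNIV_I finite prod_zero_iff)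
        then have "\<bar>2 ^ n * x $ j - real (s j)\<bar> < 1" by (auto simp: hat_def max_def split: if_splits)
        moreover have "2 ^ n * (real (s j) / 2 ^ n - x $ j) = real (s j) - 2 ^ n * x $ j" by (simp add: field_simps)
        then have "2 ^ n * \<bar>real (s j) / 2 ^ n - x $ j\<bar> = \<bar>2 ^ n * x $ j - real (s j)\<bar>"
          by (metis abs_minus_commute abs_mult abs_numeral power_abs)
        ultimately show ?thesis by (simp add: field_simps)
      qed
      moreover have "(1/2::real) ^ n \<le> (1/2) ^ N" by (intro power_decreasing) (use \<open>N \<le> n\<close> in auto)
      moreover have "norm (?y s - x) < \<delta>"
      proof -
        have "norm (?y s - x) \<le> (\<Sum>j\<in>UNIV. \<bar>(?y s - x) $ j\<bar>)" by (rule norm_le_l1_cart)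
        also have "\<dots> < (\<Sum>j\<in>(UNIV::'d set). \<delta> / CARD('d))"
        proof (rule sum_strict_mono)
          show "\<bar>(?y s - x) $ j\<bar> < \<delta> / CARD('d)" for j
            using \<open>\<bar>?y s $ j - x $ j\<bar> < (1/2) ^ n\<close> N \<open>(1/2::real) ^ n \<le> (1/2) ^ N\<close>
            unfolding vector_minus_component vec_lambda_beta by linarith
        qed auto
        finally show ?thesis by simp
      qed
      moreover have "?y s \<in> unit_cube"
      proof -
        have "real (s j) \<le> 2 ^ n" for j
        proof -
          have "s j \<le> 2 ^ n" using s by auto
          then show ?thesis by (metis of_nat_le_iff of_nat_numeral of_nat_power)
        qed
        then show ?thesis by (auto simp: mem_box_cart)
      qed
      ultimately have "\<bar>g (?y s) - g x\<bar> \<le> r / 2" using \<delta>(2) by (simp add: dist_norm less_imp_le)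
      then show ?thesis using mult_left_mono[OF _ w_nonneg[of s]]
        by (simp only: abs_mult abs_of_nonneg[OF w_nonneg])
    next
      case True
      then show ?thesis by (simp only: mult_zero_left abs_zero order_refl)
    qed
    have "full_grid_interpolant n g x - g x = (\<Sum>s\<in>?S. ?w s * g (?y s)) - (\<Sum>s\<in>?S. ?w s) * g x"
      unfolding w_sum unfolding full_grid_interpolant_def by simp
    also have "\<dots> = (\<Sum>s\<in>?S. ?w s * (g (?y s) - g x))"
      by (simp add: sum_distrib_right sum_subtractf right_diff_distrib)
    finally have "\<bar>full_grid_interpolant n g x - g x\<bar> \<le> (\<Sum>s\<in>?S. \<bar>?w s * (g (?y s) - g x)\<bar>)"
      by (simp add: sum_abs)
    also have "\<dots> \<le> (\<Sum>s\<in>?S. ?w s * (r / 2))" by (rule sum_mono) (rule term_bound)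
    also have "\<dots> = r / 2" unfolding sum_distrib_right[symmetric] w_sum by simp
    finally show ?thesis using \<open>0 < r\<close> by simp
  qed
  then show "\<exists>no. \<forall>n\<ge>no. norm (full_grid_interpolant n g x - g x) < r" by blast
qed

section \<open>Sparse grids\<close>

definition sparse_levels :: "nat \<Rightarrow> ('d::finite \<Rightarrow> nat) set" where
  "sparse_levels m = {l. sum l UNIV \<le> m}"

lemma sparse_levels_subset:
  assumes "m < n"
  shows "sparse_levels m \<subseteq> PiE UNIV (\<lambda>_::'d::finite. {..<n})"
proof
  fix l :: "'d \<Rightarrow> nat" assume "l \<in> sparse_levels m"
  have "l j \<le> sum l UNIV" for j by (rule member_le_sum) auto
  then have "l j < n" for j using assms \<open>l \<in> sparse_levels m\<close> unfolding sparse_levels_def by (metis le_less_trans mem_Collect_eq)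
  then show "l \<in> PiE UNIV (\<lambda>_. {..<n})" by auto
qed

lemma finite_sparse_levels: "finite (sparse_levels m :: ('d::finite \<Rightarrow> nat) set)"
  by (rule finite_subset[OF sparse_levels_subset[of m "Suc m"] finite_PiE]) simp_all

text \<open>
  Once the sum is known, the entries at all coordinates but one determine the remaining one.
\<close>

lemma card_levels_of_sum:
  "card {l :: 'd::finite \<Rightarrow> nat. sum l UNIV = q} \<le> (q + 1) ^ (CARD('d) - 1)"
proof -
  define j0 :: 'd where "j0 = undefined"
  let ?R = "\<lambda>l :: 'd \<Rightarrow> nat. restrict l (UNIV - {j0})"
  have "inj_on ?R {l. sum l UNIV = q}"
  proof (rule inj_onI)
    fix l l' assume l: "l \<in> {l. sum l UNIV = q}" "l' \<in> {l. sum l UNIV = q}" and eq: "?R l = ?R l'"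
    have same: "l j = l' j" if "j \<noteq> j0" for j
      using fun_cong[OF eq, of j] that by simp
    have "l j0 + sum l (UNIV - {j0}) = q" "l' j0 + sum l' (UNIV - {j0}) = q"
      using l by (simp_all add: sum.remove[of UNIV j0, symmetric])
    moreover have "sum l (UNIV - {j0}) = sum l' (UNIV - {j0})" using same by (intro sum.cong) auto
    ultimately have "l j0 = l' j0" by simp
    then show "l = l'" using same by (metis ext)
  qed
  moreover have "?R ` {l. sum l UNIV = q} \<subseteq> PiE (UNIV - {j0}) (\<lambda>_. {..q})"
  proof (rule image_subsetI)
    fix l :: "'d \<Rightarrow> nat" assume "l \<in> {l. sum l UNIV = q}"
    then have "l j \<le> q" for j using member_le_sum[of j UNIV l] by simp
    then show "?R l \<in> PiE (UNIV - {j0}) (\<lambda>_. {..q})" by auto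
  qed
  ultimately have "card {l :: 'd \<Rightarrow> nat. sum l UNIV = q} \<le> card (PiE (UNIV - {j0}) (\<lambda>_. {..q}))"
    by (intro card_inj_on_le) (auto intro: finite_PiE)
  also have "\<dots> = (q + 1) ^ (CARD('d) - 1)" by (subst card_PiE) (simp_all add: card_Diff_singleton)
  finally show ?thesis .
qed

text \<open>
  Grouping the levels by \<open>q = |l|\<^sub>1\<close> replaces a sum over \<open>d\<close>-tuples by a one-dimensional sum with the
  weight \<open>(q + 1)\<^bsup>d - 1\<^esup>\<close>.
\<close>

lemma sum_over_levels_le:
  fixes c :: "nat \<Rightarrow> real"
  assumes "finite L" "\<And>l. l \<in> L \<Longrightarrow> sum l UNIV \<in> Q" "finite Q" "\<And>q. 0 \<le> c q"
  shows "(\<Sum>l\<in>L. c (sum l (UNIV::'d::finite set))) \<le> (\<Sum>q\<in>Q. real (q + 1) ^ (CARD('d) - 1) * c q)"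
proof -
  have fin: "finite {l :: 'd \<Rightarrow> nat. sum l UNIV = q}" for q
    by (rule finite_subset[OF _ finite_sparse_levels[of q]]) (auto simp: sparse_levels_def)
  have "(\<Sum>l\<in>L. c (sum l UNIV)) = (\<Sum>q\<in>Q. \<Sum>l\<in>{l\<in>L. sum l UNIV = q}. c (sum l UNIV))"
    using assms by (intro sum.group[symmetric]) auto
  also have "\<dots> = (\<Sum>q\<in>Q. real (card {l\<in>L. sum l UNIV = q}) * c q)" by simp
  also have "\<dots> \<le> (\<Sum>q\<in>Q. real (q + 1) ^ (CARD('d) - 1) * c q)"
  proof (intro sum_mono mult_right_mono assms(4))
    fix q
    have "card {l\<in>L. sum l UNIV = q} \<le> card {l :: 'd \<Rightarrow> nat. sum l UNIV = q}"
      by (rule card_mono[OF fin]) auto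
    also have "\<dots> \<le> (q + 1) ^ (CARD('d) - 1)" by (rule card_levels_of_sum)
    finally show "real (card {l\<in>L. sum l UNIV = q}) \<le> real (q + 1) ^ (CARD('d) - 1)"
      unfolding of_nat_power[symmetric] of_nat_le_iff .
  qed
  finally show ?thesis .
qed

definition grid_indices :: "nat \<Rightarrow> (('d::finite \<Rightarrow> nat) \<times> ('d \<Rightarrow> nat)) set" where
  "grid_indices m = Sigma (sparse_levels m) level_nodes"

lemma finite_grid_indices: "finite (grid_indices m)"
  unfolding grid_indices_def by (intro finite_SigmaI finite_sparse_levels finite_level_nodes)

text \<open>
  Level \<open>l\<close> has \<open>2\<^sup>q\<close> nodes with \<open>q = |l|\<^sub>1\<close>; the geometric growth in \<open>q\<close> is dominated by its last term.
\<close>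

lemma card_grid_indices_le:
  "real (card (grid_indices m :: (('d::finite \<Rightarrow> nat) \<times> _) set)) \<le> real (m + 1) ^ (CARD('d) - 1) * 2 ^ Suc m"
proof -
  have fin: "finite (sparse_levels m :: ('d \<Rightarrow> nat) set)" by (rule finite_sparse_levels)
  have "card (level_nodes l) = 2 ^ sum l UNIV" for l :: "'d \<Rightarrow> nat"
    unfolding level_nodes_def by (subst card_PiE) (simp_all add: power_sum)
  then have "real (card (grid_indices m :: (('d \<Rightarrow> nat) \<times> _) set)) =
    (\<Sum>l\<in>(sparse_levels m :: ('d \<Rightarrow> nat) set). 2 ^ sum l UNIV)"
    unfolding grid_indices_def by (subst card_SigmaI) (simp_all add: finite_sparse_levels finite_level_nodes)
  also have "\<dots> \<le> (\<Sum>q\<le>m. real (q + 1) ^ (CARD('d) - 1) * 2 ^ q)"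
    by (rule sum_over_levels_le[OF fin]) (auto simp: sparse_levels_def)
  also have "\<dots> \<le> (\<Sum>q\<le>m. real (m + 1) ^ (CARD('d) - 1) * 2 ^ q)"
    by (intro sum_mono mult_right_mono power_mono) auto
  also have "\<dots> = real (m + 1) ^ (CARD('d) - 1) * (2 ^ Suc m - 1)"
    unfolding sum_distrib_left[symmetric] lessThan_Suc_atMost[symmetric]
    by (subst geometric_sum) simp_all
  also have "\<dots> \<le> real (m + 1) ^ (CARD('d) - 1) * 2 ^ Suc m" by (intro mult_left_mono) auto
  finally show ?thesis .
qed

definition sparse_constant :: "nat \<Rightarrow> real" where
  "sparse_constant D = (\<Sum>r. real (r + 1) ^ D * (1/4) ^ r)"

lemma summable_sparse_constant: "summable (\<lambda>r. real (r + 1) ^ D * (1/4) ^ r)"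
proof -
  have "(\<lambda>r. (real (r + 2) / real (r + 1)) ^ D) \<longlonglongrightarrow> 1 ^ D"
    by (intro tendsto_power) real_asymp
  then have "\<forall>\<^sub>F r in sequentially. (real (r + 2) / real (r + 1)) ^ D < 2"
    by (rule order_tendstoD) simp
  then obtain N where N: "\<And>r. N \<le> r \<Longrightarrow> (real (r + 2) / real (r + 1)) ^ D < 2"
    unfolding eventually_sequentially by blast
  show ?thesis
  proof (rule summable_ratio_test[of "1/2" N])
    fix r assume "N \<le> r"
    have "real (Suc r + 1) ^ D = (real (r + 2) / real (r + 1)) ^ D * real (r + 1) ^ D"
      by (simp add: power_divide)
    also have "\<dots> \<le> 2 * real (r + 1) ^ D"
      using N[OF \<open>N \<le> r\<close>] by (intro mult_right_mono) auto
    finally show "norm (real (Suc r + 1) ^ D * (1/4) ^ Suc r) \<le> 1/2 * norm (real (r + 1) ^ D * (1/4) ^ r)"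
      by (simp add: field_simps)
  qed simp
qed

text \<open>
  The tail is comparable to its first term because \<open>r + m + 1 \<le> (r + 1) (m + 1)\<close> separates the
  polynomial factor.
\<close>

lemma sparse_tail_le:
  "(\<Sum>q\<in>{Suc m..N}. real (q + 1) ^ D * (1/4) ^ q) \<le> sparse_constant D * (real (m + 1) ^ D * (1/4) ^ m)"
proof -
  have "(\<Sum>q\<in>{Suc m..N}. real (q + 1) ^ D * (1/4) ^ q) \<le> (\<Sum>q\<in>{0 + m..N + m}. real (q + 1) ^ D * (1/4) ^ q)"
    by (intro sum_mono2) auto
  also have "\<dots> = (\<Sum>r\<in>{0..N}. real (r + m + 1) ^ D * (1/4) ^ (r + m))"
    by (rule sum.shift_bounds_cl_nat_ivl)
  also have "\<dots> \<le> (\<Sum>r\<in>{0..N}. (real (r + 1) ^ D * (1/4) ^ r) * (real (m + 1) ^ D * (1/4) ^ m))"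
  proof (rule sum_mono)
    fix r
    have "real (r + m + 1) \<le> real (r + 1) * real (m + 1)" by (simp add: algebra_simps)
    then have "real (r + m + 1) ^ D \<le> real (r + 1) ^ D * real (m + 1) ^ D"
      unfolding power_mult_distrib[symmetric] by (intro power_mono) auto
    then have "real (r + m + 1) ^ D * (1/4) ^ (r + m) \<le> (real (r + 1) ^ D * real (m + 1) ^ D) * (1/4) ^ (r + m)"
      by (intro mult_right_mono) auto
    then show "real (r + m + 1) ^ D * (1/4) ^ (r + m) \<le> (real (r + 1) ^ D * (1/4) ^ r) * (real (m + 1) ^ D * (1/4) ^ m)"
      by (simp only: power_add mult_ac)
  qed
  also have "\<dots> = (\<Sum>r\<in>{0..N}. real (r + 1) ^ D * (1/4) ^ r) * (real (m + 1) ^ D * (1/4) ^ m)"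
    by (simp add: sum_distrib_right)
  also have "\<dots> \<le> sparse_constant D * (real (m + 1) ^ D * (1/4) ^ m)"
    unfolding sparse_constant_def
    by (intro mult_right_mono sum_le_suminf summable_sparse_constant) auto
  finally show ?thesis .
qed

text \<open>
  Basis functions of the same level have disjoint interiors of their supports.
\<close>

lemma sum_grid_basis_le_1: "(\<Sum>k\<in>level_nodes l. grid_basis l k x) \<le> 1"
proof -
  have "(\<Sum>k\<in>level_nodes l. grid_basis l k x) =
    (\<Prod>j\<in>UNIV. \<Sum>k<2 ^ l j. hat (2 ^ Suc (l j) * x $ j - (2 * real k + 1)))"
    unfolding level_nodes_def grid_basis_def by (subst prod_sum_PiE) auto
  also have "\<dots> \<le> (\<Prod>j\<in>(UNIV::'a set). 1)"
    by (intro prod_mono conjI sum_nonneg hat_nonneg sum_odd_hats_le_1)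
  finally show ?thesis by simp
qed

text \<open>
  On each level the contribution at \<open>x\<close> is at most the largest surplus, because the basis functions of
  that level add up to at most one. The omitted levels of the interpolant on a full grid therefore
  sum to at most the tail, uniformly in the full grid, and the full grid may be refined to the limit.
\<close>

lemma sparse_grid_error:
  fixes g :: "real^'d::finite \<Rightarrow> real"
  assumes g: "continuous_on unit_cube g" and x: "x \<in> unit_cube"
    and boundary: "\<And>x. \<exists>j. x $ j \<in> {0, 1} \<Longrightarrow> x \<in> unit_cube \<Longrightarrow> g x = 0"
    and surplus: "\<And>l k. k \<in> level_nodes l \<Longrightarrow> \<bar>grid_surplus g l k\<bar> \<le> (1/4) ^ sum l UNIV"
  shows "\<bar>g x - (\<Sum>(l, k)\<in>grid_indices m. grid_surplus g l k * grid_basis l k x)\<bar>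
    \<le> sparse_constant (CARD('d) - 1) * (real (m + 1) ^ (CARD('d) - 1) * (1/4) ^ m)"
proof -
  let ?C = "sparse_constant (CARD('d) - 1) * (real (m + 1) ^ (CARD('d) - 1) * (1/4) ^ m)"
  define F where "F l = (\<Sum>k\<in>level_nodes l. grid_surplus g l k * grid_basis l k x)" for l
  have sparse: "(\<Sum>(l, k)\<in>grid_indices m. grid_surplus g l k * grid_basis l k x) = sum F (sparse_levels m)"
    unfolding F_def grid_indices_def
    by (subst sum.Sigma[symmetric]) (simp_all add: finite_sparse_levels finite_level_nodes)
  have "0 \<le> grid_basis l k x" for l k
    unfolding grid_basis_def by (intro prod_nonneg ballI hat_nonneg)
  then have F_bound: "\<bar>F l\<bar> \<le> (1/4) ^ sum l UNIV" for l
  proof -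
    have "\<bar>F l\<bar> \<le> (\<Sum>k\<in>level_nodes l. \<bar>grid_surplus g l k * grid_basis l k x\<bar>)"
      unfolding F_def by (rule sum_abs)
    also have "\<dots> \<le> (\<Sum>k\<in>level_nodes l. (1/4) ^ sum l UNIV * grid_basis l k x)"
      using surplus \<open>\<And>l k. 0 \<le> grid_basis l k x\<close>
      by (intro sum_mono) (simp add: abs_mult mult_right_mono)
    also have "\<dots> = (1/4) ^ sum l UNIV * (\<Sum>k\<in>level_nodes l. grid_basis l k x)"
      by (simp add: sum_distrib_left)
    also have "\<dots> \<le> (1/4) ^ sum l UNIV * 1"
      by (intro mult_left_mono sum_grid_basis_le_1) auto
    finally show ?thesis by simp
  qed
  have "\<bar>full_grid_interpolant n g x - sum F (sparse_levels m)\<bar> \<le> ?C" if "m < n" for n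
  proof -
    let ?L = "PiE UNIV (\<lambda>_::'d. {..<n})"
    have fin: "finite ?L" by (intro finite_PiE) auto
    have "full_grid_interpolant n g x - sum F (sparse_levels m) = sum F (?L - sparse_levels m)"
      using sum.subset_diff[OF sparse_levels_subset[OF that] fin, of F]
        full_grid_hierarchical[where g = g and n = n and x = x, OF boundary, folded F_def] by simp
    also have "\<bar>\<dots>\<bar> \<le> (\<Sum>l\<in>?L - sparse_levels m. (1/4) ^ sum l UNIV)"
      using F_bound by (intro order_trans[OF sum_abs] sum_mono)
    also have "\<dots> \<le> (\<Sum>q\<in>{Suc m..CARD('d) * n}. real (q + 1) ^ (CARD('d) - 1) * (1/4) ^ q)"
    proof (rule sum_over_levels_le)
      fix l assume l: "l \<in> ?L - sparse_levels m"
      then have "l j \<le> n" for j using less_imp_le[of "l j" n] by (simp add: PiE_iff)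
      then have "sum l UNIV \<le> CARD('d) * n" using sum_bounded_above[of UNIV l n] by simp
      then show "sum l UNIV \<in> {Suc m..CARD('d) * n}" using l by (auto simp: sparse_levels_def)
    qed (use fin in auto)
    also have "\<dots> \<le> ?C" by (rule sparse_tail_le)
    finally show ?thesis .
  qed
  then have "\<forall>\<^sub>F n in sequentially. \<bar>full_grid_interpolant n g x - sum F (sparse_levels m)\<bar> \<le> ?C"
    by (rule eventually_mono[OF eventually_gt_at_top[of m]])
  moreover have "(\<lambda>n. \<bar>full_grid_interpolant n g x - sum F (sparse_levels m)\<bar>)
      \<longlonglongrightarrow> \<bar>g x - sum F (sparse_levels m)\<bar>"
    by (intro tendsto_intros full_grid_interpolant_converges[OF g x])
  ultimately show ?thesis
    unfolding sparse by (intro tendsto_upperbound[OF _ _ sequentially_bot])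
qed

text \<open>
  Each level has \<open>2\<^sup>q\<close> nodes with coefficients of size \<open>4\<^bsup>-q\<^esup>\<close>, so the coefficients are absolutely
  summable with a bound independent of \<open>m\<close>. This is why all basis functions may be approximated to the
  same accuracy, of the order of \<open>\<epsilon>\<close>.
\<close>

lemma sum_surplus_bound_le:
  "(\<Sum>(l, k)\<in>(grid_indices m :: (('d::finite \<Rightarrow> nat) \<times> _) set). (1/4::real) ^ sum l UNIV) \<le> 2 ^ CARD('d)"
proof -
  have card: "real (card (level_nodes l)) = 2 ^ sum l UNIV" for l :: "'d \<Rightarrow> nat"
    unfolding level_nodes_def by (subst card_PiE) (simp_all add: power_sum)
  have "(\<Sum>(l, k)\<in>(grid_indices m :: (('d \<Rightarrow> nat) \<times> _) set). (1/4::real) ^ sum l UNIV) =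
    (\<Sum>l\<in>(sparse_levels m :: ('d \<Rightarrow> nat) set). \<Prod>j\<in>UNIV. (1/2) ^ l j)"
    unfolding grid_indices_def
    by (subst sum.Sigma[symmetric])
       (simp_all add: finite_sparse_levels finite_level_nodes card power_sum[symmetric] power_mult_distrib[symmetric])
  also have "\<dots> \<le> (\<Sum>l\<in>PiE UNIV (\<lambda>_::'d. {..<Suc m}). \<Prod>j\<in>UNIV. (1/2) ^ l j)"
    by (intro sum_mono2 sparse_levels_subset) (auto intro: finite_PiE prod_nonneg)
  also have "\<dots> = (\<Prod>j\<in>(UNIV::'d set). \<Sum>l<Suc m. (1/2) ^ l)"
    by (subst prod_sum_PiE) auto
  also have "\<dots> \<le> (\<Prod>j\<in>(UNIV::'d set). 2)"
  proof (intro prod_mono conjI sum_nonneg)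
    show "(\<Sum>l<Suc m. (1/2) ^ l) \<le> (2::real)" by (subst geometric_sum) (auto simp: field_simps)
  qed auto
  finally show ?thesis by simp
qed

section \<open>Smooth functions of one variable\<close>

text \<open>
  Counting derivatives makes closure under products a plain induction with the product rule, without
  the Leibniz formula.
\<close>

primrec times_differentiable :: "nat \<Rightarrow> (real \<Rightarrow> real) \<Rightarrow> bool" where
  "times_differentiable 0 f \<longleftrightarrow> True"
| "times_differentiable (Suc n) f \<longleftrightarrow>
     (\<exists>f'. (\<forall>x. (f has_real_derivative f' x) (at x)) \<and> times_differentiable n f')"

definition smooth_real :: "(real \<Rightarrow> real) \<Rightarrow> bool" where
  "smooth_real f \<longleftrightarrow> (\<forall>n. times_differentiable n f)"

lemma times_differentiable_mono:
  "times_differentiable (Suc n) f \<Longrightarrow> times_differentiable n f"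
proof (induction n arbitrary: f)
  case (Suc n)
  then obtain f' where "\<forall>x. (f has_real_derivative f' x) (at x)" "times_differentiable (Suc n) f'"
    by auto
  then show ?case using Suc.IH[of f'] by auto
qed simp

lemma times_differentiable_const: "times_differentiable n (\<lambda>_. c)"
proof (induction n arbitrary: c)
  case (Suc n)
  have "\<forall>x. ((\<lambda>_. c) has_real_derivative 0) (at x)" by (simp add: DERIV_const)
  then show ?case using Suc[of 0] by (auto intro!: exI[of _ "\<lambda>_. 0"])
qed simp

lemma times_differentiable_add:
  "\<lbrakk>times_differentiable n f; times_differentiable n g\<rbrakk> \<Longrightarrow> times_differentiable n (\<lambda>x. f x + g x)"
proof (induction n arbitrary: f g)
  case (Suc n)
  then obtain f' g' where "\<forall>x. (f has_real_derivative f' x) (at x)" "times_differentiable n f'"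
    "\<forall>x. (g has_real_derivative g' x) (at x)" "times_differentiable n g'" by auto
  then show ?case using Suc.IH[of f' g'] by (auto intro!: exI[of _ "\<lambda>x. f' x + g' x"] DERIV_add)
qed simp

lemma times_differentiable_mult:
  "\<lbrakk>times_differentiable n f; times_differentiable n g\<rbrakk> \<Longrightarrow> times_differentiable n (\<lambda>x. f x * g x)"
proof (induction n arbitrary: f g)
  case (Suc n)
  then obtain f' g' where fg: "\<forall>x. (f has_real_derivative f' x) (at x)" "times_differentiable n f'"
    "\<forall>x. (g has_real_derivative g' x) (at x)" "times_differentiable n g'" by auto
  have "\<forall>x. ((\<lambda>x. f x * g x) has_real_derivative (f' x * g x + g' x * f x)) (at x)"
    using fg by (auto intro: DERIV_mult)
  moreover have "times_differentiable n (\<lambda>x. f' x * g x + g' x * f x)"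
    using fg Suc.prems[THEN times_differentiable_mono] Suc.IH times_differentiable_add by simp
  ultimately show ?case by (auto intro!: exI[of _ "\<lambda>x. f' x * g x + g' x * f x"])
qed simp

lemma times_differentiable_affine:
  "times_differentiable n f \<Longrightarrow> times_differentiable n (\<lambda>x. f (a * x + b))"
proof (induction n arbitrary: f)
  case (Suc n)
  then obtain f' where f': "\<forall>x. (f has_real_derivative f' x) (at x)" "times_differentiable n f'" by auto
  have "((\<lambda>x. f (a * x + b)) has_real_derivative f' (a * x + b) * a) (at x)" for x
    by (rule DERIV_chain'[where g = f]) (auto intro!: derivative_eq_intros f'(1)[rule_format])
  moreover have "times_differentiable n (\<lambda>x. f' (a * x + b) * a)"
    using times_differentiable_mult[OF Suc.IH[OF f'(2)] times_differentiable_const] .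
  ultimately show ?case by (auto intro!: exI[of _ "\<lambda>x. f' (a * x + b) * a"])
qed simp

lemma smooth_real_add: "\<lbrakk>smooth_real f; smooth_real g\<rbrakk> \<Longrightarrow> smooth_real (\<lambda>x. f x + g x)"
  and smooth_real_mult: "\<lbrakk>smooth_real f; smooth_real g\<rbrakk> \<Longrightarrow> smooth_real (\<lambda>x. f x * g x)"
  and smooth_real_const: "smooth_real (\<lambda>_. c)"
  and smooth_real_affine: "smooth_real f \<Longrightarrow> smooth_real (\<lambda>x. f (a * x + b))"
  unfolding smooth_real_def
  using times_differentiable_add times_differentiable_mult times_differentiable_const
    times_differentiable_affine by blast+

lemma smooth_real_sum:
  "(\<And>i. i \<in> I \<Longrightarrow> smooth_real (f i)) \<Longrightarrow> smooth_real (\<lambda>x. \<Sum>i\<in>I. f i x)"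
  by (induction I rule: infinite_finite_induct) (auto intro: smooth_real_add smooth_real_const)

lemma smooth_real_DERIV:
  assumes "smooth_real f"
  shows "(f has_real_derivative deriv f x) (at x)" "smooth_real (deriv f)"
proof -
  have *: "(f has_real_derivative deriv f x) (at x) \<and> times_differentiable n (deriv f)" for n x
  proof -
    have "times_differentiable (Suc n) f" using assms unfolding smooth_real_def by blast
    then obtain f' where f': "\<forall>x. (f has_real_derivative f' x) (at x)" "times_differentiable n f'"
      by auto
    then have "deriv f = f'" using DERIV_imp_deriv by blast
    then show ?thesis using f' by simp
  qed
  then show "(f has_real_derivative deriv f x) (at x)" "smooth_real (deriv f)"
    unfolding smooth_real_def by blast+
qed

lemma smooth_real_antiderivative:
  assumes "\<And>x. (F has_real_derivative f x) (at x)" "smooth_real f"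
  shows "smooth_real F"
  unfolding smooth_real_def
proof
  fix n show "times_differentiable n F"
    using assms by (cases n) (auto simp: smooth_real_def intro!: exI[of _ f])
qed

lemma poly_times_exp_minus_tendsto_0:
  "((\<lambda>y. poly p y * exp (- y)) \<longlongrightarrow> (0::real)) at_top"
proof -
  have "((\<lambda>y. \<Sum>i\<le>degree p. coeff p i * (y ^ i / exp y)) \<longlongrightarrow> (\<Sum>i\<le>degree p. coeff p i * 0)) at_top"
    by (intro tendsto_sum tendsto_mult tendsto_const tendsto_power_div_exp_0)
  moreover have "(\<lambda>y. \<Sum>i\<le>degree p. coeff p i * (y ^ i / exp y)) = (\<lambda>y. poly p y * exp (- y))"
    by (simp add: poly_altdef sum_distrib_right exp_minus divide_inverse mult.assoc)
  ultimately show ?thesis by simp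
qed

text \<open>
  The case \<open>p = 1\<close> is the classical function \<open>exp (-1/x)\<close> that is flat at zero. Polynomial factors in
  \<open>1/x\<close> make the family closed under differentiation, so that smoothness follows by induction.
\<close>

definition flat_exp :: "real poly \<Rightarrow> real \<Rightarrow> real" where
  "flat_exp p x = (if 0 < x then poly p (1 / x) * exp (- (1 / x)) else 0)"

lemma flat_exp_DERIV:
  "(flat_exp p has_real_derivative flat_exp ([:0, 0, 1:] * (p - pderiv p)) x) (at x)"
proof -
  let ?q = "[:0, 0, 1:] * (p - pderiv p)"
  consider "0 < x" | "x < 0" | "x = 0" by linarith
  then show ?thesis
  proof cases
    case 1
    have "((\<lambda>x. poly p (1 / x) * exp (- (1 / x))) has_real_derivative
        (poly (pderiv p) (1 / x) * (- 1 / x\<^sup>2)) * exp (- (1 / x)) + (exp (- (1 / x)) * (1 / x\<^sup>2)) * poly p (1 / x)) (at x)"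
      by (rule derivative_eq_intros DERIV_chain'[OF _ poly_DERIV] refl | use 1 in \<open>simp add: power2_eq_square\<close>)+
    also have "(poly (pderiv p) (1 / x) * (- 1 / x\<^sup>2)) * exp (- (1 / x)) + (exp (- (1 / x)) * (1 / x\<^sup>2)) * poly p (1 / x)
      = flat_exp ?q x"
      using 1 by (simp add: flat_exp_def power2_eq_square field_simps)
    finally show ?thesis
      by (rule has_field_derivative_transform_within_open[of _ _ _ "{0<..}"]) (use 1 in \<open>auto simp: flat_exp_def\<close>)
  next
    case 2
    have "((\<lambda>_. 0) has_real_derivative flat_exp ?q x) (at x)"
      using 2 by (simp add: flat_exp_def)
    then show ?thesis
      by (rule has_field_derivative_transform_within_open[of _ _ _ "{..<0}"]) (use 2 in \<open>auto simp: flat_exp_def\<close>)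
  next
    case 3
    \<comment> \<open>The difference quotient at zero, in the variable \<open>y = 1/h\<close>.\<close>
    have "((\<lambda>y. poly (pCons 0 p) y * exp (- y)) \<longlongrightarrow> 0) at_top" by (rule poly_times_exp_minus_tendsto_0)
    from filterlim_compose[OF this filterlim_inverse_at_top_right]
    have "((\<lambda>h. poly (pCons 0 p) (inverse h) * exp (- inverse h)) \<longlongrightarrow> 0) (at_right 0)" .
    moreover have "\<forall>\<^sub>F h in at_right 0. poly (pCons 0 p) (inverse h) * exp (- inverse h) = (flat_exp p (0 + h) - flat_exp p 0) / h"
      unfolding eventually_at_right_field by (intro exI[of _ 1]) (auto simp: flat_exp_def field_simps)
    ultimately have right: "((\<lambda>h. (flat_exp p (0 + h) - flat_exp p 0) / h) \<longlongrightarrow> 0) (at_right 0)"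
      using tendsto_cong by fastforce
    have "\<forall>\<^sub>F h in at_left 0. 0 = (flat_exp p (0 + h) - flat_exp p 0) / h"
      unfolding eventually_at_left_field by (intro exI[of _ "-1"]) (auto simp: flat_exp_def)
    then have left: "((\<lambda>h. (flat_exp p (0 + h) - flat_exp p 0) / h) \<longlongrightarrow> 0) (at_left 0)"
      using tendsto_cong tendsto_const by fast
    have "(flat_exp p has_real_derivative 0) (at 0)"
      unfolding DERIV_def using left right by (rule filterlim_split_at)
    then show ?thesis using 3 by (simp add: flat_exp_def)
  qed
qed

lemma smooth_real_flat_exp: "smooth_real (flat_exp p)"
proof -
  have "times_differentiable n (flat_exp p)" for n
    by (induction n arbitrary: p) (use flat_exp_DERIV in \<open>auto\<close>)
  then show ?thesis unfolding smooth_real_def by blast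
qed

section \<open>Mollified second differences\<close>

lemma continuous_imp_antiderivative:
  fixes f :: "real \<Rightarrow> real"
  assumes "continuous_on UNIV f"
  shows "\<exists>F. (\<forall>x. (F has_real_derivative f x) (at x)) \<and> F 0 = 0"
proof -
  have "\<exists>F. \<forall>x::real. - \<infinity> < ereal x \<longrightarrow> ereal x < \<infinity> \<longrightarrow> (F has_vector_derivative f x) (at x)"
    using assms by (intro einterval_antiderivative) (auto simp: continuous_on_eq_continuous_at)
  then obtain F where F: "\<And>x. (F has_real_derivative f x) (at x)"
    by (auto simp: has_real_derivative_iff_has_vector_derivative)
  have "((\<lambda>x. F x - F 0) has_real_derivative f x) (at x)" for x
    using DERIV_diff[OF F DERIV_const[of "F 0"]] by simp
  then show ?thesis by (intro exI[of _ "\<lambda>x. F x - F 0"]) simp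
qed

lemma DERIV_continuous_UNIV:
  "(\<And>x. (F has_real_derivative f x) (at x)) \<Longrightarrow> continuous_on UNIV F"
  by (meson DERIV_isCont continuous_at_imp_continuous_on)

lemma DERIV_zero_left:
  fixes F :: "real \<Rightarrow> real"
  assumes "\<And>x. (F has_real_derivative f x) (at x)" "\<And>x. x \<le> a \<Longrightarrow> f x = 0" "t \<le> a"
  shows "F t = F a"
proof (cases "t = a")
  case False
  then obtain z where "t < z" "z < a" "F a - F t = (a - t) * f z"
    using MVT2[of t a F f] assms by fastforce
  then show ?thesis using assms(2)[of z] by simp
qed simp

lemma DERIV_zero_right:
  fixes F :: "real \<Rightarrow> real"
  assumes "\<And>x. (F has_real_derivative f x) (at x)" "\<And>x. a \<le> x \<Longrightarrow> f x = 0" "a \<le> t"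
  shows "F t = F a"
proof (cases "t = a")
  case False
  then obtain z where "a < z" "z < t" "F t - F a = (t - a) * f z"
    using MVT2[of a t F f] assms by fastforce
  then show ?thesis using assms(2)[of z] by simp
qed simp

text \<open>
  A normalised bump supported in \<open>[0, \<delta>]\<close>, together with three antiderivatives that vanish on the left:
  the second one yields test functions, the third one their integrals.
\<close>

lemma mollifier_with_antiderivatives:
  assumes "0 < \<delta>"
  shows "\<exists>\<rho> E1 E2 E3. smooth_real \<rho> \<and> (\<forall>t. 0 \<le> \<rho> t) \<and> (\<forall>t. t \<notin> {0..\<delta>} \<longrightarrow> \<rho> t = 0) \<and>
    (\<forall>t. (E1 has_real_derivative \<rho> t) (at t)) \<and> (\<forall>t. (E2 has_real_derivative E1 t) (at t)) \<and>
    (\<forall>t. (E3 has_real_derivative E2 t) (at t)) \<and>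
    (\<forall>t\<le>0. E1 t = 0 \<and> E2 t = 0 \<and> E3 t = 0) \<and> (\<forall>t\<ge>\<delta>. E1 t = 1)"
proof -
  define b where "b t = flat_exp 1 t * flat_exp 1 (\<delta> - t)" for t
  have "smooth_real b"
    using smooth_real_mult[OF smooth_real_flat_exp[of 1] smooth_real_affine[OF smooth_real_flat_exp[of 1], of "-1" \<delta>]]
    unfolding b_def[abs_def] by simp
  have b0: "b t = 0" if "t \<le> 0 \<or> \<delta> \<le> t" for t using that by (auto simp: b_def flat_exp_def)
  have b_pos: "0 < b t" if "0 < t" "t < \<delta>" for t using that by (auto simp: b_def flat_exp_def)
  have b_nonneg: "0 \<le> b t" for t by (auto simp: b_def flat_exp_def)
  have "continuous_on UNIV b"
    using smooth_real_DERIV(1)[OF \<open>smooth_real b\<close>] by (rule DERIV_continuous_UNIV)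
  then obtain B where B: "\<And>x. (B has_real_derivative b x) (at x)" "B 0 = 0"
    using continuous_imp_antiderivative by blast
  obtain z where "0 < z" "z < \<delta>" "B \<delta> - B 0 = (\<delta> - 0) * b z"
    using MVT2[of 0 \<delta> B b] B(1) assms by blast
  then have "0 < B \<delta>" using B(2) b_pos assms by simp
  define \<rho> where "\<rho> t = b t * (1 / B \<delta>)" for t
  define E1 where "E1 t = B t * (1 / B \<delta>)" for t
  have \<rho>: "smooth_real \<rho>"
    unfolding \<rho>_def[abs_def] by (intro smooth_real_mult smooth_real_const \<open>smooth_real b\<close>)
  have E1: "(E1 has_real_derivative \<rho> t) (at t)" for t
    unfolding E1_def[abs_def] \<rho>_def by (intro DERIV_cmult_right B(1))
  obtain E2 where E2: "\<And>x. (E2 has_real_derivative E1 x) (at x)" "E2 0 = 0"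
    using continuous_imp_antiderivative[OF DERIV_continuous_UNIV[OF E1]] by blast
  obtain E3 where E3: "\<And>x. (E3 has_real_derivative E2 x) (at x)" "E3 0 = 0"
    using continuous_imp_antiderivative[OF DERIV_continuous_UNIV[OF E2(1)]] by blast
  have "E1 t = 0" if "t \<le> 0" for t
    using DERIV_zero_left[OF E1 _ that] b0 B(2) by (simp add: \<rho>_def E1_def)
  moreover from this have "E2 t = 0" if "t \<le> 0" for t
    using DERIV_zero_left[OF E2(1) _ that] E2(2) by simp
  moreover from this have "E3 t = 0" if "t \<le> 0" for t
    using DERIV_zero_left[OF E3(1) _ that] E3(2) by simp
  moreover have "E1 t = 1" if "\<delta> \<le> t" for t
    using DERIV_zero_right[OF E1 _ that] b0 \<open>0 < B \<delta>\<close> by (simp add: \<rho>_def E1_def)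
  moreover have "0 \<le> \<rho> t" "t \<notin> {0..\<delta>} \<longrightarrow> \<rho> t = 0" for t
    using b_nonneg[of t] b0[of t] \<open>0 < B \<delta>\<close> by (auto simp: \<rho>_def)
  ultimately show ?thesis
    using \<rho> E1 E2(1) E3(1)
    by (intro exI[of _ \<rho>] exI[of _ E1] exI[of _ E2] exI[of _ E3] conjI allI impI) auto
qed

lemma has_bochner_integral_compact_support:
  fixes F f :: "real \<Rightarrow> real"
  assumes F: "\<And>x. (F has_real_derivative f x) (at x)" and f: "\<And>x. isCont f x"
    and support: "\<And>x. x \<notin> {a..b} \<Longrightarrow> f x = 0" and "a \<le> b"
  shows "has_bochner_integral lborel f (F b - F a)"
proof -
  have "has_bochner_integral lborel (\<lambda>x. f x * indicator {a..b} x) (F b - F a)"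
    using assms by (intro has_bochner_integral_FTC_Icc_real) auto
  moreover have "(\<lambda>x. f x * indicator {a..b} x) = f"
    using support by (auto split: split_indicator)
  ultimately show ?thesis by simp
qed

text \<open>
  The stencil with mesh \<open>h\<close> at \<open>y\<close>, mollified by \<open>\<rho>\<close>, is the second derivative of the test function \<open>\<phi>\<close>
  that arises by applying the stencil to a second antiderivative \<open>E2\<close> of \<open>\<rho>\<close>. The sign of \<open>\<phi>\<close> comes from the
  convexity of \<open>E2\<close>; its support is bounded because \<open>E2\<close> is zero on the left and affine on the right; its
  integral comes from the next antiderivative \<open>E3\<close>, which is quadratic on the right and hence has the
  second difference \<open>h\<^sup>2\<close>.
\<close>

lemma second_difference_kernel:
  assumes "0 < \<delta>"
  shows "\<exists>\<rho>. smooth_real \<rho> \<and> (\<forall>t. 0 \<le> \<rho> t) \<and> (\<forall>t. t \<notin> {0..\<delta>} \<longrightarrow> \<rho> t = 0) \<and>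
    has_bochner_integral lborel \<rho> 1 \<and>
    (\<forall>y h. 0 < h \<longrightarrow> (\<exists>\<phi>. smooth_real \<phi> \<and> (\<forall>t. \<phi> t \<le> 0) \<and> (\<forall>t. t \<notin> {y - h..y + h + \<delta>} \<longrightarrow> \<phi> t = 0) \<and>
      has_bochner_integral lborel \<phi> (- (h\<^sup>2 / 2)) \<and>
      deriv (deriv \<phi>) = (\<lambda>t. \<Sum>e\<in>{-1, 0, 1}. stencil_weight e * \<rho> (t - (y + e * h)))))"
proof -
  obtain \<rho> E1 E2 E3 where \<rho>: "smooth_real \<rho>" "\<And>t. 0 \<le> \<rho> t" "\<And>t. t \<notin> {0..\<delta>} \<Longrightarrow> \<rho> t = 0"
    and E1: "\<And>t. (E1 has_real_derivative \<rho> t) (at t)"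
    and E2: "\<And>t. (E2 has_real_derivative E1 t) (at t)"
    and E3: "\<And>t. (E3 has_real_derivative E2 t) (at t)"
    and left: "\<And>t. t \<le> 0 \<Longrightarrow> E1 t = 0 \<and> E2 t = 0 \<and> E3 t = 0" and right: "\<And>t. \<delta> \<le> t \<Longrightarrow> E1 t = 1"
    using mollifier_with_antiderivatives[OF assms] by blast
  have isCont_\<rho>: "isCont \<rho> t" for t
    using smooth_real_DERIV(1)[OF \<rho>(1)] by (rule DERIV_isCont)
  have "has_bochner_integral lborel \<rho> (E1 \<delta> - E1 0)"
    using \<rho>(3) assms by (intro has_bochner_integral_compact_support E1 isCont_\<rho>) auto
  then have int_\<rho>: "has_bochner_integral lborel \<rho> 1" using left[of 0] right[of \<delta>] by simp
  \<comment> \<open>Right of the mollifier \<open>E2\<close> is affine with slope one, and \<open>E3\<close> is the corresponding parabola.\<close>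
  define a where "a = E2 \<delta> - \<delta>"
  have E2_right: "E2 t = t + a" if "\<delta> \<le> t" for t
  proof -
    have "((\<lambda>t. E2 t - t) has_real_derivative E1 t - 1) (at t)" for t
      by (intro DERIV_diff E2 DERIV_ident)
    from DERIV_zero_right[OF this _ that] right show ?thesis by (simp add: a_def)
  qed
  define b where "b = E3 \<delta> - (\<delta>\<^sup>2 / 2 + a * \<delta>)"
  have E3_right: "E3 t = t\<^sup>2 / 2 + a * t + b" if "\<delta> \<le> t" for t
  proof -
    have "((\<lambda>t. E3 t - (t\<^sup>2 / 2 + a * t)) has_real_derivative E2 t - (t + a)) (at t)" for t
      by (rule DERIV_diff[OF E3]) (auto intro!: derivative_eq_intros)
    from DERIV_zero_right[OF this _ that] E2_right show ?thesis by (simp add: b_def)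
  qed
  have smooth_E2: "smooth_real E2"
    using smooth_real_antiderivative[OF E2 smooth_real_antiderivative[OF E1 \<rho>(1)]] .
  have convex_E2: "convex_on UNIV E2"
    using f''_ge0_imp_convex[of UNIV E2 E1 \<rho>] E1 E2 \<rho>(2) by simp
  have "\<exists>\<phi>. smooth_real \<phi> \<and> (\<forall>t. \<phi> t \<le> 0) \<and> (\<forall>t. t \<notin> {y - h..y + h + \<delta>} \<longrightarrow> \<phi> t = 0) \<and>
      has_bochner_integral lborel \<phi> (- (h\<^sup>2 / 2)) \<and>
      deriv (deriv \<phi>) = (\<lambda>t. \<Sum>e\<in>{-1, 0, 1}. stencil_weight e * \<rho> (t - (y + e * h)))" if "0 < h" for y h
  proof -
    define D where "D E t = (\<Sum>e\<in>{-1, 0, 1}. stencil_weight e * E (t - (y + e * h)))" for E :: "real \<Rightarrow> real" and t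
    have D: "D E t = E (t - y) - E (t - y + h) / 2 - E (t - y - h) / 2" for E t
      by (simp add: D_def stencil_weight_def algebra_simps)
    have D_DERIV: "(D E has_real_derivative D E' t) (at t)"
      if "\<And>t. (E has_real_derivative E' t) (at t)" for E E' t
      unfolding D_def[abs_def]
    proof (intro DERIV_sum DERIV_cmult)
      fix e show "((\<lambda>t. E (t - (y + e * h))) has_real_derivative E' (t - (y + e * h))) (at t)"
        using DERIV_shift[of E "E' (t - (y + e * h))" t "- (y + e * h)"] that
        by (simp add: algebra_simps)
    qed
    have smooth: "smooth_real (D E2)"
      unfolding D_def[abs_def]
    proof (intro smooth_real_sum smooth_real_mult smooth_real_const)
      fix e show "smooth_real (\<lambda>t. E2 (t - (y + e * h)))"
        using smooth_real_affine[OF smooth_E2, of 1 "- (y + e * h)"] by (simp add: algebra_simps)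
    qed
    have nonpos: "D E2 t \<le> 0" for t
    proof -
      have "(1 - 1/2) *\<^sub>R (t - y + h) + (1/2) *\<^sub>R (t - y - h) = t - y" by (simp add: field_simps)
      then have "E2 (t - y) \<le> (1 - 1/2) * E2 (t - y + h) + (1/2) * E2 (t - y - h)"
        using convex_onD[OF convex_E2, of "1/2" "t - y + h" "t - y - h"] by simp
      then show ?thesis unfolding D by simp
    qed
    have support: "D E2 t = 0" if "t \<notin> {y - h..y + h + \<delta>}" for t
    proof (cases "t < y - h")
      case True
      then show ?thesis using left \<open>0 < h\<close> unfolding D by simp
    next
      case False
      then have "y + h + \<delta> < t" using that by auto
      then have "E2 (t - y) = t - y + a" "E2 (t - y + h) = t - y + h + a" "E2 (t - y - h) = t - y - h + a"
        using \<open>0 < h\<close> by (auto intro: E2_right)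
      then show ?thesis unfolding D by linarith
    qed
    have "has_bochner_integral lborel (D E2) (D E3 (y + h + \<delta>) - D E3 (y - h))"
      using support \<open>0 < h\<close> assms smooth_real_DERIV(1)[OF smooth]
      by (intro has_bochner_integral_compact_support D_DERIV E3) (auto intro: DERIV_isCont)
    moreover have "D E3 (y - h) = 0" using left \<open>0 < h\<close> unfolding D by simp
    moreover have "D E3 (y + h + \<delta>) = - (h\<^sup>2 / 2)"
      using \<open>0 < h\<close> assms unfolding D by (simp add: E3_right power2_eq_square field_simps)
    ultimately have "has_bochner_integral lborel (D E2) (- (h\<^sup>2 / 2))" by simp
    moreover have "deriv (D E2) = D E1" "deriv (D E1) = D \<rho>"
      using D_DERIV[OF E2] D_DERIV[OF E1] DERIV_imp_deriv by blast+
    ultimately show ?thesis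
      using smooth nonpos support by (intro exI[of _ "D E2"]) (auto simp: D_def)
  qed
  then show ?thesis using \<rho> int_\<rho> by (intro exI[of _ \<rho>]) blast
qed

section \<open>Tensor products\<close>

definition tensor :: "('d::finite \<Rightarrow> real \<Rightarrow> real) \<Rightarrow> real^'d \<Rightarrow> real" where
  "tensor \<psi> x = (\<Prod>j\<in>UNIV. \<psi> j (x $ j))"

lemma tensor_has_derivative:
  fixes \<psi> :: "'d::finite \<Rightarrow> real \<Rightarrow> real"
  assumes "\<And>j t. (\<psi> j has_real_derivative \<psi>' j t) (at t)"
  shows "(tensor \<psi> has_derivative
    (\<lambda>v. \<Sum>i\<in>UNIV. (\<psi>' i (x $ i) * v $ i) * (\<Prod>j\<in>UNIV - {i}. \<psi> j (x $ j)))) (at x)"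
  unfolding tensor_def[abs_def]
proof (rule has_derivative_prod)
  fix i :: 'd
  have "((\<lambda>x. x $ i) has_derivative (\<lambda>v. v $ i)) (at x)"
    by (rule bounded_linear.has_derivative[OF bounded_linear_vec_nth has_derivative_ident])
  from has_derivative_compose[OF this assms[of i "x $ i", unfolded has_field_derivative_def]]
  show "((\<lambda>x. \<psi> i (x $ i)) has_derivative (\<lambda>v. \<psi>' i (x $ i) * v $ i)) (at x)" .
qed

lemma partial_deriv_tensor:
  fixes \<psi> :: "'d::finite \<Rightarrow> real \<Rightarrow> real"
  assumes "\<And>j. smooth_real (\<psi> j)"
  shows "partial_deriv i (tensor \<psi>) = tensor (\<psi>(i := deriv (\<psi> i)))"
proof
  fix x :: "real^'d"
  have "partial_deriv i (tensor \<psi>) x =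
    (\<Sum>k\<in>UNIV. (deriv (\<psi> k) (x $ k) * axis i 1 $ k) * (\<Prod>j\<in>UNIV - {k}. \<psi> j (x $ j)))"
    unfolding partial_deriv_def
      frechet_derivative_at[OF tensor_has_derivative[where \<psi> = \<psi> and x = x, OF smooth_real_DERIV(1)[OF assms]], symmetric]
    ..
  also have "\<dots> = (\<Sum>k\<in>UNIV. if k = i then deriv (\<psi> k) (x $ k) * (\<Prod>j\<in>UNIV - {k}. \<psi> j (x $ j)) else 0)"
  proof (rule sum.cong[OF refl])
    fix k
    have "axis i 1 $ k = (if k = i then 1 else (0::real))" by (simp add: axis_def)
    then show "(deriv (\<psi> k) (x $ k) * axis i 1 $ k) * (\<Prod>j\<in>UNIV - {k}. \<psi> j (x $ j)) =
      (if k = i then deriv (\<psi> k) (x $ k) * (\<Prod>j\<in>UNIV - {k}. \<psi> j (x $ j)) else 0)"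
      by (cases "k = i") (simp_all only: if_True if_False mult_1_right mult_zero_right mult_zero_left simp_thms)
  qed
  also have "\<dots> = deriv (\<psi> i) (x $ i) * (\<Prod>j\<in>UNIV - {i}. \<psi> j (x $ j))"
    unfolding sum.delta[OF finite] by (simp only: UNIV_I if_True)
  also have "(\<Prod>j\<in>UNIV - {i}. \<psi> j (x $ j)) = (\<Prod>j\<in>UNIV - {i}. (\<psi>(i := deriv (\<psi> i))) j (x $ j))"
    by (intro prod.cong) auto
  also have "deriv (\<psi> i) (x $ i) * \<dots> = tensor (\<psi>(i := deriv (\<psi> i))) x"
    unfolding tensor_def by (subst prod.remove[of UNIV i]) simp_all
  finally show "partial_deriv i (tensor \<psi>) x = tensor (\<psi>(i := deriv (\<psi> i))) x" .
qed

lemma smooth_real_funpow_deriv: "smooth_real f \<Longrightarrow> smooth_real ((deriv ^^ n) f)"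
  by (induction n) (auto intro: smooth_real_DERIV)

text \<open>
  Partial derivatives act on the factors separately, so tensor products of smooth functions are closed
  under them.
\<close>

lemma iterated_partial_tensor:
  fixes \<psi> :: "'d::finite \<Rightarrow> real \<Rightarrow> real"
  assumes "\<And>j. smooth_real (\<psi> j)"
  shows "iterated_partial is (tensor \<psi>) = tensor (\<lambda>j. (deriv ^^ count_list is j) (\<psi> j))"
proof (induction "is")
  case Nil
  then show ?case by (simp add: iterated_partial_def)
next
  case (Cons i "is")
  have "iterated_partial (i # is) (tensor \<psi>) = partial_deriv i (tensor (\<lambda>j. (deriv ^^ count_list is j) (\<psi> j)))"
    using Cons by (simp add: iterated_partial_def)
  also have "\<dots> = tensor ((\<lambda>j. (deriv ^^ count_list is j) (\<psi> j))(i := deriv ((deriv ^^ count_list is i) (\<psi> i))))"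
    using assms by (intro partial_deriv_tensor smooth_real_funpow_deriv)
  also have "(\<lambda>j. (deriv ^^ count_list is j) (\<psi> j))(i := deriv ((deriv ^^ count_list is i) (\<psi> i))) =
    (\<lambda>j. (deriv ^^ count_list (i # is) j) (\<psi> j))" by auto
  finally show ?case .
qed

lemma smooth_tensor:
  fixes \<psi> :: "'d::finite \<Rightarrow> real \<Rightarrow> real"
  assumes "\<And>j. smooth_real (\<psi> j)"
  shows "smooth (tensor \<psi>)"
  unfolding smooth_def
proof (intro allI)
  fix "is" x
  show "iterated_partial is (tensor \<psi>) differentiable at x"
    unfolding iterated_partial_tensor[OF assms] differentiable_def
    by (rule exI, rule tensor_has_derivative[where \<psi>' = "\<lambda>j. deriv ((deriv ^^ count_list is j) (\<psi> j))"])
       (intro smooth_real_DERIV(1) smooth_real_funpow_deriv assms)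
qed

lemma tensor_eq_0:
  assumes "\<And>j t. t \<notin> {a $ j..b $ j} \<Longrightarrow> \<psi> j t = 0" "x \<notin> cbox a b"
  shows "tensor \<psi> x = 0"
proof -
  obtain j where "x $ j \<notin> {a $ j..b $ j}" using assms(2) by (auto simp: mem_box_cart)
  then show ?thesis unfolding tensor_def using assms(1) by (intro prod_zero) auto
qed

lemma test_function_tensor:
  fixes \<psi> :: "'d::finite \<Rightarrow> real \<Rightarrow> real"
  assumes "\<And>j. smooth_real (\<psi> j)" "\<And>j t. t \<notin> {a $ j..b $ j} \<Longrightarrow> \<psi> j t = 0" "cbox a b \<subseteq> U"
  shows "test_function U (tensor \<psi>)"
proof -
  have support: "{x. tensor \<psi> x \<noteq> 0} \<subseteq> cbox a b"
    using tensor_eq_0[of a b \<psi>] assms(2) by blast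
  have "closure {x. tensor \<psi> x \<noteq> 0} \<subseteq> U"
    using closure_minimal[OF support closed_cbox] assms(3) by (rule subset_trans)
  moreover have "compact (closure {x. tensor \<psi> x \<noteq> 0})"
    unfolding compact_closure by (rule bounded_subset[OF bounded_cbox support])
  ultimately show ?thesis
    unfolding test_function_def using smooth_tensor[where \<psi> = \<psi>, OF assms(1)] by (intro conjI)
qed

text \<open>
  Fubini: Lebesgue measure is the image of the product measure indexed by the standard basis.
\<close>

lemma has_bochner_integral_tensor:
  fixes \<psi> :: "'d::finite \<Rightarrow> real \<Rightarrow> real"
  assumes "\<And>j. has_bochner_integral lborel (\<psi> j) (c j)"
  shows "has_bochner_integral lborel (tensor \<psi>) (\<Prod>j\<in>UNIV. c j)"
proof -
  interpret product_sigma_finite "\<lambda>_::real^'d. lborel :: real measure" ..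
  let ?ax = "\<lambda>j::'d. axis j (1::real)"
  let ?i = "inv ?ax"
  have inj: "inj ?ax" by (auto simp: inj_def axis_eq_axis)
  have Basis: "(Basis :: (real^'d) set) = range ?ax" by (auto simp: Basis_vec_def)
  have i: "?i (?ax j) = j" for j using inj by (rule inv_f_f)
  have int: "integrable lborel (\<psi> j)" "integral\<^sup>L lborel (\<psi> j) = c j" for j
    using assms[of j] by (auto simp: has_bochner_integral_iff)
  have meas: "tensor \<psi> \<in> borel_measurable borel"
    unfolding tensor_def[abs_def]
  proof (rule borel_measurable_prod)
    fix j
    have "\<psi> j \<in> borel_measurable borel" using int(1)[of j] by (auto dest: borel_measurable_integrable)
    then show "(\<lambda>x::real^'d. \<psi> j (x $ j)) \<in> borel_measurable borel"
      by (rule measurable_compose[rotated]) (intro borel_measurable_continuous_onI continuous_intros)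
  qed
  have eq: "tensor \<psi> (\<Sum>b\<in>Basis. f b *\<^sub>R b) = (\<Prod>b\<in>Basis. \<psi> (?i b) (f b))" for f :: "real^'d \<Rightarrow> real"
  proof -
    have "(\<Sum>b\<in>Basis. f b *\<^sub>R b) $ j = f (?ax j)" for j
    proof -
      have "(\<Sum>b\<in>Basis. f b *\<^sub>R b) $ j = (\<Sum>b\<in>Basis. f b *\<^sub>R b) \<bullet> ?ax j"
        by (rule cart_eq_inner_axis)
      also have "\<dots> = f (?ax j)" by (rule inner_sum_left_Basis) (simp add: Basis)
      finally show ?thesis .
    qed
    then show ?thesis
      unfolding tensor_def Basis by (subst prod.reindex[OF inj]) (simp add: i)
  qed
  have T: "(\<lambda>f. \<Sum>b\<in>Basis. f b *\<^sub>R b) \<in> (\<Pi>\<^sub>M b\<in>(Basis::(real^'d) set). lborel) \<rightarrow>\<^sub>M borel"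
    by (intro borel_measurable_sum borel_measurable_scaleR measurable_component_singleton[where M = "\<lambda>_. lborel", unfolded measurable_lborel1] borel_measurable_const) 
  have "integrable (\<Pi>\<^sub>M b\<in>(Basis::(real^'d) set). lborel) (\<lambda>f. \<Prod>b\<in>Basis. \<psi> (?i b) (f b))"
    by (intro product_integrable_prod int) simp
  then have "integrable lborel (tensor \<psi>)"
    unfolding lborel_eq[where 'a = "real^'d"] integrable_distr_eq[OF T meas] eq .
  moreover have "integral\<^sup>L lborel (tensor \<psi>) = (\<Prod>b\<in>(Basis::(real^'d) set). c (?i b))"
    unfolding lborel_eq[where 'a = "real^'d"] integral_distr[OF T meas] eq
    unfolding product_integral_prod[OF finite_Basis int(1)] int(2) ..
  moreover have "(\<Prod>b\<in>(Basis::(real^'d) set). c (?i b)) = (\<Prod>j\<in>UNIV. c j)"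
    unfolding Basis by (subst prod.reindex[OF inj]) (simp add: i)
  ultimately show ?thesis by (simp add: has_bochner_integral_iff)
qed

section \<open>Surpluses are bounded by the mixed weak derivative\<close>

lemma count_list_distinct: "distinct xs \<Longrightarrow> count_list xs i = (if i \<in> set xs then 1 else 0)"
  by (induction xs) auto

lemma tensor_borel_measurable:
  fixes \<psi> :: "'d::finite \<Rightarrow> real \<Rightarrow> real"
  assumes "\<And>j. smooth_real (\<psi> j)"
  shows "tensor \<psi> \<in> borel_measurable borel"
proof (rule borel_measurable_continuous_onI)
  have "continuous (at x) (tensor \<psi>)" for x
    by (rule has_derivative_continuous, rule tensor_has_derivative[where \<psi>' = "\<lambda>j. deriv (\<psi> j)"])
       (rule smooth_real_DERIV(1)[OF assms])
  then show "continuous_on UNIV (tensor \<psi>)" by (simp add: continuous_at_imp_continuous_on)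
qed

text \<open>
  The definition of the weak derivative moves all \<open>2 d\<close> derivatives from the test function to \<open>f\<close>, where
  they are bounded by one; what remains is the integral of \<open>|\<phi>\<^sub>1| \<cdots> |\<phi>\<^sub>d|\<close>, a product of integrals.
\<close>

lemma weak_derivative_test_bound:
  fixes f g w :: "real^'d::finite \<Rightarrow> real"
  assumes weak: "has_weak_deriv (box 0 1) (\<lambda>_. 2) f w"
    and w: "AE x in lebesgue. x \<in> unit_cube \<longrightarrow> \<bar>w x\<bar> \<le> 1"
    and f: "AE x in lebesgue. x \<in> unit_cube \<longrightarrow> f x = g x" "f \<in> borel_measurable (lebesgue_on unit_cube)"
    and g: "continuous_on unit_cube g"
    and \<phi>: "\<And>j. smooth_real (\<phi> j)" "\<And>j t. \<phi> j t \<le> 0" "\<And>j t. t \<notin> {a $ j..b $ j} \<Longrightarrow> \<phi> j t = 0"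
      "\<And>j. has_bochner_integral lborel (\<phi> j) (- c j)"
    and ab: "cbox a b \<subseteq> box 0 1"
  shows "\<bar>LINT x|lborel. indicator (box 0 1) x * g x * tensor (\<lambda>j. deriv (deriv (\<phi> j))) x\<bar> \<le> (\<Prod>j\<in>UNIV. c j)"
proof -
  let ?U = "box 0 1 :: (real^'d) set"
  let ?D = "tensor (\<lambda>j. deriv (deriv (\<phi> j)))"
  obtain js :: "'d list" where js: "set js = UNIV" "distinct js" using finite_distinct_list[OF finite] by metis
  \<comment> \<open>Listing every coordinate twice gives the multi-index \<open>(2, ..., 2)\<close>.\<close>
  have count: "count_list (js @ js) i = 2" for i using js by (simp add: count_list_distinct)
  have "iterated_partial (js @ js) (tensor \<phi>) = ?D"
    unfolding iterated_partial_tensor[of \<phi>, OF \<phi>(1)] count by (simp add: numeral_2_eq_2)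
  have "test_function ?U (tensor \<phi>)"
    using \<phi>(1,3) ab by (rule test_function_tensor)
  have eq: "(LINT x:?U|lebesgue. f x * ?D x) = (LINT x:?U|lebesgue. w x * tensor \<phi> x)"
  proof -
    have "(LINT x:?U|lebesgue. f x * iterated_partial (js @ js) (tensor \<phi>) x) =
      (-1) ^ (\<Sum>i\<in>(UNIV::'d set). 2) * (LINT x:?U|lebesgue. w x * tensor \<phi> x)"
      using weak count \<open>test_function ?U (tensor \<phi>)\<close> unfolding has_weak_deriv_def by blast
    then show ?thesis unfolding \<open>iterated_partial (js @ js) (tensor \<phi>) = ?D\<close> by (simp add: mult.commute[of _ 2])
  qed
  have D_meas: "?D \<in> borel_measurable borel"
    using smooth_real_DERIV(2)[OF smooth_real_DERIV(2)[OF \<phi>(1)]] by (rule tensor_borel_measurable)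
  have D_leb: "?D \<in> borel_measurable lebesgue"
    using measurable_completion[of ?D lborel borel] D_meas by simp
  have sub: "x \<in> unit_cube" if "x \<in> ?U" for x using that box_subset_cbox by blast
  have g_meas: "(\<lambda>x. indicator ?U x * g x) \<in> borel_measurable borel"
    using borel_measurable_continuous_on_indicator[of ?U g] continuous_on_subset[OF g box_subset_cbox] by simp
  have "(\<lambda>x. indicator unit_cube x * f x) \<in> borel_measurable lebesgue"
    using f(2) by (subst (asm) borel_measurable_restrict_space_iff) simp_all
  then have "(\<lambda>x. indicator ?U x * ((indicator unit_cube x * f x) * ?D x)) \<in> borel_measurable lebesgue"
    using borel_measurable_times[OF _ D_leb]
    by (intro borel_measurable_times[of "indicator ?U"] borel_measurable_indicator) simp_all
  also have "(\<lambda>x. indicator ?U x * ((indicator unit_cube x * f x) * ?D x)) = (\<lambda>x. indicator ?U x * (f x * ?D x))"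
    using sub by (auto split: split_indicator)
  finally have f_meas: "(\<lambda>x. indicator ?U x * (f x * ?D x)) \<in> borel_measurable lebesgue" .
  have gD_meas: "(\<lambda>x. indicator ?U x * g x * ?D x) \<in> borel_measurable borel"
    using borel_measurable_times[OF g_meas D_meas] .
  have "(LINT x|lborel. indicator ?U x * g x * ?D x) = (LINT x|lebesgue. indicator ?U x * g x * ?D x)"
    using gD_meas by (intro integral_completion[symmetric]) simp
  also have "\<dots> = (LINT x|lebesgue. indicator ?U x * (f x * ?D x))"
  proof (rule integral_cong_AE[OF _ f_meas])
    show "(\<lambda>x. indicator ?U x * g x * ?D x) \<in> borel_measurable lebesgue"
      using measurable_completion[of _ lborel borel] gD_meas by simp
    show "AE x in lebesgue. indicator ?U x * g x * ?D x = indicator ?U x * (f x * ?D x)"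
      using f(1) by (rule eventually_mono) (use sub in \<open>auto split: split_indicator\<close>)
  qed
  also have "\<dots> = (LINT x|lebesgue. indicator ?U x * (w x * tensor \<phi> x))"
    using eq by (simp add: set_lebesgue_integral_def)
  finally have lhs: "(LINT x|lborel. indicator ?U x * g x * ?D x) = (LINT x|lebesgue. indicator ?U x * (w x * tensor \<phi> x))" .
  define T where "T = tensor (\<lambda>j t. - \<phi> j t)"
  have T_abs: "T x = \<bar>tensor \<phi> x\<bar>" for x
    unfolding T_def tensor_def abs_prod using \<phi>(2) by (intro prod.cong refl) simp
  have "has_bochner_integral lborel (\<lambda>t. - \<phi> j t) (c j)" for j
    using has_bochner_integral_minus[OF \<phi>(4)[of j]] by simp
  then have "has_bochner_integral lborel T (\<Prod>j\<in>UNIV. c j)"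
    unfolding T_def by (rule has_bochner_integral_tensor)
  then have T: "integrable lebesgue T" "(LINT x|lebesgue. T x) = (\<Prod>j\<in>UNIV. c j)"
    by (auto simp: has_bochner_integral_iff integrable_completion integral_completion)
  have "\<bar>LINT x|lebesgue. indicator ?U x * (w x * tensor \<phi> x)\<bar> \<le> (LINT x|lebesgue. \<bar>indicator ?U x * (w x * tensor \<phi> x)\<bar>)"
    using integral_norm_bound[of lebesgue "\<lambda>x. indicator ?U x * (w x * tensor \<phi> x)"] by simp
  also have "\<dots> \<le> (LINT x|lebesgue. T x)"
  proof (rule integral_mono_AE'[OF T(1)])
    show "AE x in lebesgue. \<bar>indicator ?U x * (w x * tensor \<phi> x)\<bar> \<le> T x"
      using w
    proof (rule eventually_mono)
      fix x assume "x \<in> unit_cube \<longrightarrow> \<bar>w x\<bar> \<le> 1"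
      then show "\<bar>indicator ?U x * (w x * tensor \<phi> x)\<bar> \<le> T x"
        using sub[of x] mult_right_mono[of "\<bar>w x\<bar>" 1 "\<bar>tensor \<phi> x\<bar>"]
        by (cases "x \<in> ?U") (simp_all add: T_abs abs_mult)
    qed
    show "AE x in lebesgue. 0 \<le> T x" by (simp add: T_abs)
  qed
  finally show ?thesis using lhs T(2) by simp
qed

text \<open>
  The tensor power of the mollifier is a probability density on a small cube next to \<open>p\<close>, so integrating
  against it averages values of \<open>g\<close> that are close to \<open>g(p)\<close>.
\<close>

lemma mollified_value:
  fixes g :: "real^'d::finite \<Rightarrow> real" and p :: "real^'d"
  assumes g: "continuous_on unit_cube g"
    and \<rho>: "\<And>t. 0 \<le> \<rho> t" "\<And>t. t \<notin> {0..\<delta>} \<Longrightarrow> \<rho> t = 0" "has_bochner_integral lborel \<rho> 1"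
    and near: "\<And>x. x \<in> cbox p (p + (\<chi> _. \<delta>)) \<Longrightarrow> x \<in> box 0 1 \<and> \<bar>g x - g p\<bar> \<le> \<eta>"
  defines "R \<equiv> tensor (\<lambda>j t. \<rho> (t - p $ j))"
  shows "integrable lborel (\<lambda>x. indicator (box 0 1) x * g x * R x)"
    "\<bar>(LINT x|lborel. indicator (box 0 1) x * g x * R x) - g p\<bar> \<le> \<eta>"
proof -
  let ?U = "box 0 1 :: (real^'d) set"
  have "has_bochner_integral lborel (\<lambda>t. \<rho> (t - p $ j)) 1" for j
    using lborel_has_bochner_integral_real_affine_iff[of 1 \<rho> 1 "- (p $ j)"] \<rho>(3) by simp
  from has_bochner_integral_tensor[of "\<lambda>j t. \<rho> (t - p $ j)", OF this]
  have "has_bochner_integral lborel R 1" unfolding R_def by simp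
  then have R: "integrable lborel R" "(LINT x|lborel. R x) = 1" by (auto simp: has_bochner_integral_iff)
  have R_nonneg: "0 \<le> R x" for x unfolding R_def tensor_def using \<rho>(1) by (intro prod_nonneg) simp
  have R_support: "R x = 0" if "x \<notin> cbox p (p + (\<chi> _. \<delta>))" for x
    unfolding R_def using that \<rho>(2) by (intro tensor_eq_0[of p "p + (\<chi> _. \<delta>)"]) auto
  have "bounded (g ` unit_cube)" using g compact_cbox compact_continuous_image compact_imp_bounded by blast
  then obtain B where B: "\<And>x. x \<in> unit_cube \<Longrightarrow> \<bar>g x\<bar> \<le> B" by (auto simp: bounded_iff)
  have g_meas: "(\<lambda>x. indicator ?U x * g x) \<in> borel_measurable borel"
    using borel_measurable_continuous_on_indicator[of ?U g] continuous_on_subset[OF g box_subset_cbox] by simp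
  have bound: "\<bar>indicator ?U x * g x\<bar> \<le> \<bar>B\<bar>" for x
    using B[of x] box_subset_cbox[of 0 "1 :: real^'d"] by (cases "x \<in> ?U") (auto intro: order_trans)
  show int: "integrable lborel (\<lambda>x. indicator ?U x * g x * R x)"
  proof (rule Bochner_Integration.integrable_bound[OF integrable_mult_right[OF R(1), of B]])
    show "(\<lambda>x. indicator ?U x * g x * R x) \<in> borel_measurable lborel"
      using borel_measurable_times[OF g_meas, of R] borel_measurable_integrable[OF R(1)] by simp
    show "AE x in lborel. norm (indicator ?U x * g x * R x) \<le> norm (B * R x)"
      using mult_right_mono[OF bound abs_ge_zero] by (intro AE_I2) (simp add: abs_mult)
  qed
  have "(LINT x|lborel. indicator ?U x * g x * R x) - g p = (LINT x|lborel. indicator ?U x * g x * R x - g p * R x)"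
    using int R by simp
  also have "\<bar>\<dots>\<bar> \<le> (LINT x|lborel. \<bar>indicator ?U x * g x * R x - g p * R x\<bar>)"
    using integral_norm_bound[of lborel "\<lambda>x. indicator ?U x * g x * R x - g p * R x"] by simp
  also have "\<dots> \<le> (LINT x|lborel. \<eta> * R x)"
  proof (rule integral_mono')
    show *: "\<bar>indicator ?U x * g x * R x - g p * R x\<bar> \<le> \<eta> * R x" for x
    proof (cases "x \<in> cbox p (p + (\<chi> _. \<delta>))")
      case True
      then have "\<bar>indicator ?U x * g x * R x - g p * R x\<bar> = \<bar>g x - g p\<bar> * R x"
        using near[OF True] R_nonneg[of x] by (simp add: left_diff_distrib[symmetric] abs_mult)
      then show ?thesis using near[OF True] R_nonneg[of x] by (simp add: mult_right_mono)
    qed (simp add: R_support)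
    show "0 \<le> \<eta> * R x" for x using * by (rule order_trans[OF abs_ge_zero])
  qed (use R in simp)
  also have "\<dots> = \<eta>" using R by simp
  finally show "\<bar>(LINT x|lborel. indicator ?U x * g x * R x) - g p\<bar> \<le> \<eta>" .
qed

text \<open>
  The surplus is the limit of integrals of \<open>g\<close> against tensor products of mollified stencils, and these
  are test functions differentiated twice in each coordinate. For a fixed error the mollifier is
  chosen so narrow that its translates stay in the open cube and see little oscillation of \<open>g\<close>.
\<close>

lemma surplus_bound_interior:
  fixes f g w :: "real^'d::finite \<Rightarrow> real"
  assumes weak: "has_weak_deriv (box 0 1) (\<lambda>_. 2) f w"
    and w: "AE x in lebesgue. x \<in> unit_cube \<longrightarrow> \<bar>w x\<bar> \<le> 1"
    and f: "AE x in lebesgue. x \<in> unit_cube \<longrightarrow> f x = g x" "f \<in> borel_measurable (lebesgue_on unit_cube)"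
    and g: "continuous_on unit_cube g"
    and stencil: "\<And>j. 0 < h j" "\<And>j. 0 < y j - h j" "\<And>j. y j + h j < 1"
  shows "\<bar>surplus g y h\<bar> \<le> (\<Prod>j\<in>UNIV. (h j)\<^sup>2 / 2)"
proof (rule field_le_epsilon)
  fix \<epsilon> :: real assume "0 < \<epsilon>"
  let ?U = "box 0 1 :: (real^'d) set"
  let ?E = "PiE UNIV (\<lambda>_::'d. {-1, 0, 1 :: real})"
  define W where "W e = (\<Prod>j\<in>UNIV. stencil_weight (e j))" for e :: "'d \<Rightarrow> real"
  define p :: "('d \<Rightarrow> real) \<Rightarrow> real^'d" where "p e = (\<chi> j. y j + e j * h j)" for e
  \<comment> \<open>Adding one avoids a division by zero; only an upper bound on the total weight matters.\<close>
  define S where "S = (\<Sum>e\<in>?E. \<bar>W e\<bar>) + 1"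
  have "0 < S" unfolding S_def by (intro add_nonneg_pos sum_nonneg) auto
  define \<eta> where "\<eta> = \<epsilon> / S"
  have "0 < \<eta>" using \<open>0 < \<epsilon>\<close> \<open>0 < S\<close> by (simp add: \<eta>_def)
  have "uniformly_continuous_on unit_cube g" using g compact_cbox by (rule compact_uniformly_continuous)
  then obtain d0 where d0: "0 < d0" "\<And>x x'. x \<in> unit_cube \<Longrightarrow> x' \<in> unit_cube \<Longrightarrow> dist x' x < d0 \<Longrightarrow> dist (g x') (g x) < \<eta>"
    using \<open>0 < \<eta>\<close> unfolding uniformly_continuous_on_def by metis
  \<comment> \<open>Half of the distance between the stencil and the upper faces leaves room for the support of the mollifier.\<close>
  define M where "M = insert (d0 / (2 * CARD('d))) (range (\<lambda>j. (1 - (y j + h j)) / 2))"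
  define \<delta> where "\<delta> = Min M"
  have M: "finite M" "M \<noteq> {}" by (auto simp: M_def)
  have "0 < \<delta>" unfolding \<delta>_def Min_gr_iff[OF M] using d0(1) stencil(3) by (auto simp: M_def)
  have "\<delta> \<le> d0 / (2 * CARD('d))" unfolding \<delta>_def using M by (intro Min_le) (auto simp: M_def)
  then have \<delta>_d0: "CARD('d) * \<delta> < d0" using d0(1) by (simp add: field_simps)
  have "\<delta> \<le> (1 - (y j + h j)) / 2" for j unfolding \<delta>_def using M by (intro Min_le) (auto simp: M_def)
  then have "2 * \<delta> \<le> 1 - (y j + h j)" for j by (simp add: field_simps)
  then have \<delta>_top: "y j + h j + \<delta> < 1" for j
    using stencil(3)[of j] \<open>0 < \<delta>\<close> by (smt (verit))
  obtain \<rho> where \<rho>: "smooth_real \<rho>" "\<And>t. 0 \<le> \<rho> t" "\<And>t. t \<notin> {0..\<delta>} \<Longrightarrow> \<rho> t = 0"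
    "has_bochner_integral lborel \<rho> 1"
    and kernel: "\<And>y h. 0 < h \<Longrightarrow> (\<exists>\<phi>. smooth_real \<phi> \<and> (\<forall>t. \<phi> t \<le> 0) \<and> (\<forall>t. t \<notin> {y - h..y + h + \<delta>} \<longrightarrow> \<phi> t = 0) \<and>
      has_bochner_integral lborel \<phi> (- (h\<^sup>2 / 2)) \<and>
      deriv (deriv \<phi>) = (\<lambda>t. \<Sum>e\<in>{-1, 0, 1}. stencil_weight e * \<rho> (t - (y + e * h))))"
    using second_difference_kernel[OF \<open>0 < \<delta>\<close>] by auto
  have "\<exists>\<phi>. \<forall>j. smooth_real (\<phi> j) \<and> (\<forall>t. \<phi> j t \<le> 0) \<and> (\<forall>t. t \<notin> {y j - h j..y j + h j + \<delta>} \<longrightarrow> \<phi> j t = 0) \<and>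
      has_bochner_integral lborel (\<phi> j) (- ((h j)\<^sup>2 / 2)) \<and>
      deriv (deriv (\<phi> j)) = (\<lambda>t. \<Sum>e\<in>{-1, 0, 1}. stencil_weight e * \<rho> (t - (y j + e * h j)))"
    by (rule choice) (use kernel stencil(1) in blast)
  then obtain \<phi> where \<phi>: "\<And>j. smooth_real (\<phi> j)" "\<And>j t. \<phi> j t \<le> 0"
    "\<And>j t. t \<notin> {y j - h j..y j + h j + \<delta>} \<Longrightarrow> \<phi> j t = 0"
    "\<And>j. has_bochner_integral lborel (\<phi> j) (- ((h j)\<^sup>2 / 2))"
    "\<And>j. deriv (deriv (\<phi> j)) = (\<lambda>t. \<Sum>e\<in>{-1, 0, 1}. stencil_weight e * \<rho> (t - (y j + e * h j)))"
    by auto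
  let ?a = "(\<chi> j. y j - h j) :: real^'d" and ?b = "(\<chi> j. y j + h j + \<delta>) :: real^'d"
  have ab: "cbox ?a ?b \<subseteq> ?U"
  proof
    fix x assume x: "x \<in> cbox ?a ?b"
    have "0 < x $ j \<and> x $ j < 1" for j
    proof -
      have "y j - h j \<le> x $ j" "x $ j \<le> y j + h j + \<delta>" using x by (auto simp: mem_box_cart)
      then show ?thesis using stencil(2)[of j] \<delta>_top[of j] by linarith
    qed
    then show "x \<in> ?U" by (simp add: mem_box_cart)
  qed
  let ?D = "tensor (\<lambda>j. deriv (deriv (\<phi> j)))"
  have main: "\<bar>LINT x|lborel. indicator ?U x * g x * ?D x\<bar> \<le> (\<Prod>j\<in>UNIV. (h j)\<^sup>2 / 2)"
    by (rule weak_derivative_test_bound[OF weak w f g \<phi>(1,2) _ \<phi>(4) ab]) (use \<phi>(3) in simp)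
  define R where "R e = tensor (\<lambda>j t. \<rho> (t - p e $ j))" for e
  define J where "J e = (LINT x|lborel. indicator ?U x * g x * R e x)" for e
  have D: "?D x = (\<Sum>e\<in>?E. W e * R e x)" for x
    unfolding tensor_def \<phi>(5) R_def W_def p_def
    by (subst prod_sum_PiE) (simp_all add: prod.distrib)
  have R: "integrable lborel (\<lambda>x. indicator ?U x * g x * R e x)" "\<bar>J e - g (p e)\<bar> \<le> \<eta>" if e: "e \<in> ?E" for e
  proof -
    have near: "x \<in> ?U \<and> \<bar>g x - g (p e)\<bar> \<le> \<eta>" if x: "x \<in> cbox (p e) (p e + (\<chi> _. \<delta>))" for x
    proof -
      have pe: "y j - h j \<le> p e $ j \<and> p e $ j \<le> y j + h j" for j
      proof -
        have "e j \<in> {-1, 0, 1}" using e by auto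
        then show ?thesis using stencil(1)[of j] by (auto simp: p_def)
      qed
      have xj: "p e $ j \<le> x $ j \<and> x $ j \<le> p e $ j + \<delta>" for j using x by (auto simp: mem_box_cart)
      have "p e \<in> cbox ?a ?b" unfolding mem_box_cart
        using pe \<open>0 < \<delta>\<close> by (auto intro: order_trans[OF conjunct2[OF pe]])
      moreover have "x \<in> cbox ?a ?b" unfolding mem_box_cart
      proof (intro allI)
        fix j show "?a $ j \<le> x $ j \<and> x $ j \<le> ?b $ j" using pe[of j] xj[of j] by simp
      qed
      moreover have "dist x (p e) < d0"
      proof -
        have "norm (x - p e) \<le> (\<Sum>j\<in>UNIV. \<bar>(x - p e) $ j\<bar>)" by (rule norm_le_l1_cart)
        also have "\<dots> \<le> (\<Sum>j\<in>(UNIV::'d set). \<delta>)" using xj by (intro sum_mono) (simp add: abs_le_iff add.commute diff_le_eq)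
        finally show ?thesis using \<delta>_d0 by (simp add: dist_norm)
      qed
      ultimately have "x \<in> ?U" "p e \<in> ?U" "dist x (p e) < d0" using ab by blast+
      moreover have "?U \<subseteq> unit_cube" by (rule box_subset_cbox)
      ultimately have "dist (g x) (g (p e)) < \<eta>" by (intro d0(2)) blast+
      then show ?thesis using \<open>x \<in> ?U\<close> by (simp add: dist_real_def)
    qed
    show "integrable lborel (\<lambda>x. indicator ?U x * g x * R e x)" "\<bar>J e - g (p e)\<bar> \<le> \<eta>"
      unfolding J_def R_def by (rule mollified_value[OF g \<rho>(2,3,4) near]; assumption)+
  qed
  have "(LINT x|lborel. indicator ?U x * g x * ?D x) = (LINT x|lborel. (\<Sum>e\<in>?E. W e * (indicator ?U x * g x * R e x)))"
    unfolding D by (simp add: sum_distrib_left mult_ac)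
  also have "\<dots> = (\<Sum>e\<in>?E. W e * J e)"
    unfolding J_def using R(1) by (subst Bochner_Integration.integral_sum) simp_all
  finally have "\<bar>\<Sum>e\<in>?E. W e * J e\<bar> \<le> (\<Prod>j\<in>UNIV. (h j)\<^sup>2 / 2)" using main by simp
  moreover have "\<bar>surplus g y h - (\<Sum>e\<in>?E. W e * J e)\<bar> \<le> \<epsilon>"
  proof -
    have "surplus g y h - (\<Sum>e\<in>?E. W e * J e) = (\<Sum>e\<in>?E. W e * (g (p e) - J e))"
      unfolding surplus_def W_def[symmetric] p_def[symmetric] by (simp add: sum_subtractf right_diff_distrib)
    also have "\<bar>\<dots>\<bar> \<le> (\<Sum>e\<in>?E. \<bar>W e\<bar> * \<eta>)"
      using R(2) by (intro order_trans[OF sum_abs] sum_mono) (simp add: abs_mult mult_left_mono abs_minus_commute)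
    also have "\<dots> = (S - 1) * \<eta>" unfolding S_def by (simp add: sum_distrib_right)
    also have "\<dots> \<le> \<epsilon>" using \<open>0 < S\<close> \<open>0 < \<epsilon>\<close> unfolding \<eta>_def by (simp add: field_simps)
    finally show ?thesis .
  qed
  ultimately show "\<bar>surplus g y h\<bar> \<le> (\<Prod>j\<in>UNIV. (h j)\<^sup>2 / 2) + \<epsilon>" by linarith
qed

text \<open>
  Stencils next to the boundary touch it, where no test function reaches; they are limits of the
  shrunken stencils with meshes \<open>r h\<close>, \<open>r < 1\<close>, and \<open>g\<close> is continuous up to the boundary.
\<close>

lemma surplus_bound:
  fixes f g w :: "real^'d::finite \<Rightarrow> real"
  assumes weak: "has_weak_deriv (box 0 1) (\<lambda>_. 2) f w"
    and w: "AE x in lebesgue. x \<in> unit_cube \<longrightarrow> \<bar>w x\<bar> \<le> 1"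
    and f: "AE x in lebesgue. x \<in> unit_cube \<longrightarrow> f x = g x" "f \<in> borel_measurable (lebesgue_on unit_cube)"
    and g: "continuous_on unit_cube g"
    and stencil: "\<And>j. 0 < h j" "\<And>j. 0 \<le> y j - h j" "\<And>j. y j + h j \<le> 1"
  shows "\<bar>surplus g y h\<bar> \<le> (\<Prod>j\<in>UNIV. (h j)\<^sup>2 / 2)"
proof -
  define F where "F r = \<bar>surplus g y (\<lambda>j. r * h j)\<bar>" for r
  have "continuous_on {0..1} F"
    unfolding F_def surplus_def
  proof (intro continuous_intros continuous_on_compose2[OF g])
    fix e assume e: "e \<in> PiE UNIV (\<lambda>_::'d. {-1, 0, 1 :: real})"
    show "(\<lambda>r. \<chi> j. y j + e j * (r * h j)) ` {0..1} \<subseteq> unit_cube"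
    proof
      fix x assume "x \<in> (\<lambda>r. \<chi> j. y j + e j * (r * h j)) ` {0..1}"
      then obtain r where r: "0 \<le> r" "r \<le> 1" and x: "x = (\<chi> j. y j + e j * (r * h j))" by auto
      have "0 \<le> x $ j \<and> x $ j \<le> 1" for j
      proof -
        have "0 \<le> r * h j" "r * h j \<le> 1 * h j" using r stencil(1)[of j] by (auto intro: mult_right_mono mult_nonneg_nonneg less_imp_le)
        moreover have "e j \<in> {-1, 0, 1}" using e by auto
        ultimately show ?thesis using stencil(2,3)[of j] unfolding x by auto
      qed
      then show "x \<in> unit_cube" by (simp add: mem_box_cart)
    qed
  qed
  moreover have "F r \<le> (\<Prod>j\<in>UNIV. (h j)\<^sup>2 / 2)" if r: "r \<in> {0<..<1}" for r
  proof -
    have "0 < r * h j" "r * h j < h j" for j using r stencil(1)[of j] by auto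
    then have "F r \<le> (\<Prod>j\<in>UNIV. (r * h j)\<^sup>2 / 2)"
      unfolding F_def
    proof (intro surplus_bound_interior[OF weak w f g])
      fix j
      show "0 < y j - r * h j" "y j + r * h j < 1"
        using \<open>r * h j < h j\<close> stencil(2,3)[of j] by linarith+
    qed
    also have "\<dots> \<le> (\<Prod>j\<in>UNIV. (h j)\<^sup>2 / 2)"
      using \<open>\<And>j. 0 < r * h j\<close> \<open>\<And>j. r * h j < h j\<close>
      by (intro prod_mono conjI divide_right_mono power_mono) (auto intro: less_imp_le)
    finally show ?thesis .
  qed
  ultimately have "F 1 \<le> (\<Prod>j\<in>UNIV. (h j)\<^sup>2 / 2)"
    using continuous_le_on_closure[of "{0<..<1::real}" F 1] by (simp add: closure_greaterThanLessThan)
  then show ?thesis by (simp add: F_def)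
qed

section \<open>Functions computed by layers of ReLU units\<close>

text \<open>
  What a unit can receive before its activation if \<open>G\<close> is the set of functions computed by the units of
  the layer below; the constants are the biases.
\<close>

inductive_set affine_span :: "('a \<Rightarrow> real) set \<Rightarrow> ('a \<Rightarrow> real) set" for G where
  affine_span_const: "(\<lambda>_. c) \<in> affine_span G"
| affine_span_base: "g \<in> G \<Longrightarrow> g \<in> affine_span G"
| affine_span_add: "\<lbrakk>f \<in> affine_span G; g \<in> affine_span G\<rbrakk> \<Longrightarrow> (\<lambda>x. f x + g x) \<in> affine_span G"
| affine_span_scale: "f \<in> affine_span G \<Longrightarrow> (\<lambda>x. c * f x) \<in> affine_span G"

lemma affine_span_diff:
  assumes "f \<in> affine_span G" "g \<in> affine_span G"
  shows "(\<lambda>x. f x - g x) \<in> affine_span G"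
  using affine_span_add[OF assms(1) affine_span_scale[OF assms(2), of "-1"]] by simp

lemma affine_span_subset:
  assumes "G \<subseteq> affine_span H"
  shows "affine_span G \<subseteq> affine_span H"
proof
  fix f assume "f \<in> affine_span G"
  then show "f \<in> affine_span H"
  proof induction
    case (affine_span_base g)
    then show ?case using assms by blast
  qed (rule affine_span.intros; assumption?)+
qed

lemma affine_span_mono: "G \<subseteq> H \<Longrightarrow> affine_span G \<subseteq> affine_span H"
  by (intro affine_span_subset) (auto intro: affine_span_base)

lemma affine_span_image_expand:
  assumes "f \<in> affine_span (e ` I)" "finite I"
  shows "\<exists>a c. \<forall>x. f x = (\<Sum>i\<in>I. a i * e i x) + c"
  using assms(1)
proof induction
  case (affine_span_const c)
  then show ?case by (intro exI[of _ "\<lambda>_. 0"] exI[of _ c]) simp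
next
  case (affine_span_base g)
  then obtain k where k: "k \<in> I" "g = e k" by auto
  have "\<forall>x. g x = (\<Sum>i\<in>I. (if i = k then 1 else 0) * e i x) + 0"
    using k assms(2) by (simp add: if_distrib[of "\<lambda>a. a * _"] cong: if_cong)
  then show ?case by (intro exI)
next
  case (affine_span_add f g)
  then obtain a c a' c' where
    "\<forall>x. f x = (\<Sum>i\<in>I. a i * e i x) + c" "\<forall>x. g x = (\<Sum>i\<in>I. a' i * e i x) + c'" by blast
  then have "\<forall>x. f x + g x = (\<Sum>i\<in>I. (a i + a' i) * e i x) + (c + c')"
    by (simp add: distrib_right sum.distrib)
  then show ?case by (intro exI)
next
  case (affine_span_scale f b)
  then obtain a c where "\<forall>x. f x = (\<Sum>i\<in>I. a i * e i x) + c" by blast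
  then have "\<forall>x. b * f x = (\<Sum>i\<in>I. (b * a i) * e i x) + b * c"
    by (simp add: distrib_left sum_distrib_left mult.assoc)
  then show ?case by (intro exI)
qed

definition relu_units :: "('a \<Rightarrow> real) set \<Rightarrow> ('a \<Rightarrow> real) set" where
  "relu_units G = (\<lambda>h x. relu (h x)) ` affine_span G"

lemma relu_units_mono: "affine_span G \<subseteq> affine_span H \<Longrightarrow> relu_units G \<subseteq> relu_units H"
  unfolding relu_units_def by blast

lemma relu_unitsI: "h \<in> affine_span G \<Longrightarrow> (\<lambda>x. relu (h x)) \<in> relu_units G"
  unfolding relu_units_def by blast

lemma nonneg_in_relu_units:
  assumes "h \<in> affine_span G" "\<And>x. 0 \<le> h x"
  shows "h \<in> relu_units G"
  using relu_unitsI[OF assms(1)] assms(2) by (simp add: relu_def max_absorb2)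

text \<open>
  Networks are described by the functions they compute instead of by weights: \<open>K\<close> bounds the number of
  units in each of the \<open>n\<close> layers, and \<open>G'\<close> collects functions that a further layer could read off. In this
  form, sequential and parallel composition do not involve any bookkeeping of indices.
\<close>

inductive relu_net ::
  "nat \<Rightarrow> nat \<Rightarrow> ('a \<Rightarrow> real) set \<Rightarrow> ('a \<Rightarrow> real) set \<Rightarrow> bool" for K where
  relu_net_0: "G' \<subseteq> affine_span G \<Longrightarrow> relu_net K 0 G G'"
| relu_net_Suc: "\<lbrakk>relu_net K n G H; finite T; card T \<le> K; T \<subseteq> relu_units H; G' \<subseteq> affine_span T\<rbrakk>
     \<Longrightarrow> relu_net K (Suc n) G G'"

lemma relu_net_weaken:
  assumes "relu_net K n G H" "H' \<subseteq> affine_span H"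
  shows "relu_net K n G H'"
  using assms
proof cases
  case relu_net_0
  then show ?thesis
    using assms(2) affine_span_subset by (metis relu_net.relu_net_0 subset_trans)
next
  case (relu_net_Suc n H1 T)
  then show ?thesis
    using assms(2) affine_span_subset by (metis relu_net.relu_net_Suc subset_trans)
qed

lemma relu_net_trans:
  assumes "relu_net K m H J" "relu_net K n G H"
  shows "relu_net K (n + m) G J"
  using assms
proof (induction)
  case (relu_net_0 G' G)
  then show ?case using relu_net_weaken by simp
next
  case (relu_net_Suc m G H T G')
  then show ?case using relu_net.relu_net_Suc[of K "n + m"] by simp
qed

lemma relu_net_step:
  assumes "finite T" "card T \<le> K" "T \<subseteq> relu_units G" "G' \<subseteq> affine_span T"
  shows "relu_net K 1 G G'"
  using relu_net_Suc[OF relu_net_0[of G G]] assms affine_span_base by (metis One_nat_def subsetI)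

text \<open>
  Networks of the same depth run side by side, layer by layer; the widths add up.
\<close>

lemma relu_net_parallel:
  assumes "finite B" "\<And>b. b \<in> B \<Longrightarrow> relu_net K n (G b) (G' b)"
  shows "relu_net (card B * K) n (\<Union>b\<in>B. G b) (\<Union>b\<in>B. G' b)"
  using assms(2)
proof (induction n arbitrary: G')
  case 0
  then have "\<And>b. b \<in> B \<Longrightarrow> G' b \<subseteq> affine_span (G b)"
    by (metis (no_types, lifting) nat.distinct(1) relu_net.cases)
  then have "(\<Union>b\<in>B. G' b) \<subseteq> affine_span (\<Union>b\<in>B. G b)"
    using affine_span_mono[of "G _" "\<Union>b\<in>B. G b"] by blast
  then show ?case by (rule relu_net_0)
next
  case (Suc n)
  have "\<exists>H T. relu_net K n (G b) H \<and> finite T \<and> card T \<le> K \<and> T \<subseteq> relu_units H \<and> G' b \<subseteq> affine_span T"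
    if "b \<in> B" for b
    using Suc.prems[OF that] by cases auto
  then obtain H T where HT: "\<And>b. b \<in> B \<Longrightarrow> relu_net K n (G b) (H b)"
    "\<And>b. b \<in> B \<Longrightarrow> finite (T b)" "\<And>b. b \<in> B \<Longrightarrow> card (T b) \<le> K"
    "\<And>b. b \<in> B \<Longrightarrow> T b \<subseteq> relu_units (H b)" "\<And>b. b \<in> B \<Longrightarrow> G' b \<subseteq> affine_span (T b)"
    by metis
  show ?case
  proof (rule relu_net_Suc[OF Suc.IH[OF HT(1)]])
    show "finite (\<Union>b\<in>B. T b)" using assms(1) HT(2) by blast
    have "card (\<Union>b\<in>B. T b) \<le> (\<Sum>b\<in>B. card (T b))" by (rule card_UN_le[OF assms(1)])
    also have "\<dots> \<le> card B * K" using sum_bounded_above[of B "\<lambda>b. card (T b)" K] HT(3) by simp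
    finally show "card (\<Union>b\<in>B. T b) \<le> card B * K" .
    have "relu_units (H b) \<subseteq> relu_units (\<Union>b\<in>B. H b)" if "b \<in> B" for b
      using that by (intro relu_units_mono affine_span_mono) blast
    then show "(\<Union>b\<in>B. T b) \<subseteq> relu_units (\<Union>b\<in>B. H b)" using HT(4) by blast
    have "affine_span (T b) \<subseteq> affine_span (\<Union>b\<in>B. T b)" if "b \<in> B" for b
      using that by (intro affine_span_mono) blast
    then show "(\<Union>b\<in>B. G' b) \<subseteq> affine_span (\<Union>b\<in>B. T b)" using HT(5) by blast
  qed
qed

section \<open>Networks with full connections\<close>

text \<open>
  Only units are counted, so superfluous connections cost nothing: they get the weight zero.
\<close>

definition dense_architecture :: "nat \<Rightarrow> nat \<Rightarrow> 'd architecture" where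
  "dense_architecture D K = \<lparr>depth = D, width = (\<lambda>_. K), in_conn = (\<lambda>_. UNIV), conn = (\<lambda>_ _. {..<K})\<rparr>"

text \<open>
  The value \<open>z\<close> pads a layer with too few units.
\<close>

lemma finite_set_enumeration:
  assumes "finite T" "card T \<le> K"
  shows "\<exists>e. T \<subseteq> e ` {..<K} \<and> e ` {..<K} \<subseteq> insert z T"
proof -
  obtain h where h: "bij_betw h {0..<card T} T"
    using ex_bij_betw_nat_finite[OF assms(1)] by blast
  define e where "e i = (if i < card T then h i else z)" for i
  have "T \<subseteq> e ` {..<K}"
  proof
    fix t assume "t \<in> T"
    then obtain i where "i < card T" "t = h i"
      using h by (metis atLeastLessThan_iff bij_betw_imp_surj_on imageE)
    then show "t \<in> e ` {..<K}" using assms(2) by (auto simp: e_def intro!: image_eqI[of _ _ i])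
  qed
  moreover have "e ` {..<K} \<subseteq> insert z T"
    using h by (auto simp: e_def bij_betw_def)
  ultimately show ?thesis by blast
qed

definition layer_inputs ::
  "nat \<Rightarrow> ('a \<Rightarrow> real) set \<Rightarrow> (nat \<Rightarrow> nat \<Rightarrow> 'a \<Rightarrow> real) \<Rightarrow> nat \<Rightarrow> ('a \<Rightarrow> real) set" where
  "layer_inputs K G e l = (case l of 0 \<Rightarrow> G | Suc k \<Rightarrow> e k ` {..<K})"

lemma relu_net_unit_sequence:
  assumes "relu_net K n G G'"
  shows "\<exists>e. (\<forall>l<n. \<forall>j<K. e l j \<in> relu_units (layer_inputs K G e l)) \<and>
             G' \<subseteq> affine_span (layer_inputs K G e n)"
  using assms
proof induction
  case (relu_net_0 G' G)
  then show ?case by (simp add: layer_inputs_def)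
next
  case (relu_net_Suc n G H T G')
  then obtain e where e: "\<And>l j. l < n \<Longrightarrow> j < K \<Longrightarrow> e l j \<in> relu_units (layer_inputs K G e l)"
    "H \<subseteq> affine_span (layer_inputs K G e n)" by blast
  obtain e' where e': "T \<subseteq> e' ` {..<K}" "e' ` {..<K} \<subseteq> insert (\<lambda>_. relu 0) T"
    using finite_set_enumeration[OF relu_net_Suc.hyps(2,3)] by blast
  have same: "layer_inputs K G (e(n := e')) l = layer_inputs K G e l" if "l \<le> n" for l
    using that by (cases l) (auto simp: layer_inputs_def)
  have "T \<subseteq> relu_units (layer_inputs K G e n)"
    using relu_net_Suc.hyps(4) relu_units_mono[OF affine_span_subset[OF e(2)]] by blast
  moreover have "(\<lambda>_. relu 0) \<in> relu_units (layer_inputs K G e n)"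
    using relu_unitsI[OF affine_span_const[of 0]] .
  ultimately have "e' j \<in> relu_units (layer_inputs K G e n)" if "j < K" for j
    using subsetD[OF e'(2) imageI] that by (metis insertE lessThan_iff subsetD)
  then have "\<forall>l<Suc n. \<forall>j<K. (e(n := e')) l j \<in> relu_units (layer_inputs K G (e(n := e')) l)"
    using e(1) same by (auto simp: less_Suc_eq)
  moreover have "layer_inputs K G (e(n := e')) (Suc n) = e' ` {..<K}"
    by (simp add: layer_inputs_def)
  then have "G' \<subseteq> affine_span (layer_inputs K G (e(n := e')) (Suc n))"
    using relu_net_Suc.hyps(5) affine_span_mono[OF e'(1)] by auto
  ultimately show ?case by blast
qed

text \<open>
  The output of a network is a linear, not an affine, combination of its last layer. As the functions
  \<open>P b\<close> are non-negative, one additional layer passes them through its units unchanged, and then no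
  constant is needed.
\<close>

lemma relu_net_realization:
  fixes P :: "'b \<Rightarrow> real^'d::finite \<Rightarrow> real"
  assumes net: "relu_net K n (range (\<lambda>i x. x $ i)) (P ` B)"
    and B: "finite B" "card B \<le> K" and nonneg: "\<And>b x. b \<in> B \<Longrightarrow> 0 \<le> P b x"
  shows "\<exists>W. \<forall>x. network_output (dense_architecture (Suc n) K) W x = (\<Sum>b\<in>B. v b * P b x)"
proof -
  let ?G = "range (\<lambda>i (x::real^'d). x $ i)"
  have "P ` B \<subseteq> relu_units (P ` B)"
    using nonneg by (auto intro!: nonneg_in_relu_units affine_span_base)
  moreover have "card (P ` B) \<le> K" using B card_image_le le_trans by blast
  ultimately obtain e' where e': "P ` B \<subseteq> e' ` {..<K}" "e' ` {..<K} \<subseteq> insert (\<lambda>_. relu 0) (P ` B)"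
    using finite_set_enumeration[OF finite_imageI[OF B(1)]] by metis
  have "relu_net K (Suc n) ?G (P ` B)"
    using B by (intro relu_net_Suc[OF net _ \<open>card (P ` B) \<le> K\<close> \<open>P ` B \<subseteq> relu_units (P ` B)\<close>])
       (auto intro: affine_span_base)
  obtain e0 where e0: "\<And>l j. l < n \<Longrightarrow> j < K \<Longrightarrow> e0 l j \<in> relu_units (layer_inputs K ?G e0 l)"
    "P ` B \<subseteq> affine_span (layer_inputs K ?G e0 n)"
    using relu_net_unit_sequence[OF net] by blast
  define e where "e = e0(n := e')"
  have same: "layer_inputs K ?G e l = layer_inputs K ?G e0 l" if "l \<le> n" for l
    using that by (cases l) (auto simp: layer_inputs_def e_def)
  have "P ` B \<subseteq> relu_units (layer_inputs K ?G e0 n)"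
    using e0(2) nonneg by (auto intro!: nonneg_in_relu_units)
  moreover have "(\<lambda>_. relu 0) \<in> relu_units (layer_inputs K ?G e0 n)"
    using relu_unitsI[OF affine_span_const[of 0]] .
  ultimately have e'_units: "e' j \<in> relu_units (layer_inputs K ?G e0 n)" if "j < K" for j
    using subsetD[OF e'(2) imageI] that by (metis insertE lessThan_iff subsetD)
  have e: "e l j \<in> relu_units (layer_inputs K ?G e l)" if "l \<le> n" "j < K" for l j
    using that e0(1) e'_units same[of l] by (cases "l = n") (auto simp: e_def)
  have "\<exists>a c. \<forall>x. e 0 j x = relu ((\<Sum>i\<in>UNIV. a i * x $ i) + c)" if j: "j < K" for j
  proof -
    obtain h where h: "h \<in> affine_span ?G" "e 0 j = (\<lambda>x. relu (h x))"
      using e[of 0 j, OF le0 j] unfolding relu_units_def layer_inputs_def nat.case by blast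
    then show ?thesis using affine_span_image_expand[of h "\<lambda>i x. x $ i" UNIV] by fastforce
  qed
  then obtain a0 c0 where first_layer: "\<And>j x. j < K \<Longrightarrow> e 0 j x = relu ((\<Sum>i\<in>UNIV. a0 j i * x $ i) + c0 j)"
    by metis
  have "\<exists>a c. \<forall>x. e (Suc l) j x = relu ((\<Sum>i<K. a i * e l i x) + c)" if lj: "Suc l \<le> n" "j < K" for l j
  proof -
    obtain h where h: "h \<in> affine_span (e l ` {..<K})" "e (Suc l) j = (\<lambda>x. relu (h x))"
      using e[OF lj] unfolding relu_units_def layer_inputs_def nat.case by blast
    then show ?thesis using affine_span_image_expand[of h "e l" "{..<K}"] by fastforce
  qed
  then obtain a c where later_layers: "\<And>l j x. Suc l \<le> n \<Longrightarrow> j < K \<Longrightarrow>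
      e (Suc l) j x = relu ((\<Sum>i<K. a l j i * e l i x) + c l j)"
    by metis
  have "\<forall>b\<in>B. \<exists>i<K. P b = e' i" using e'(1) by blast
  then obtain idx where idx: "\<And>b. b \<in> B \<Longrightarrow> idx b < K" "\<And>b. b \<in> B \<Longrightarrow> P b = e' (idx b)"
    by metis
  define W :: "'d weights" where "W = \<lparr>in_weight = a0, weight = a,
    bias = (\<lambda>l. case l of 0 \<Rightarrow> c0 | Suc k \<Rightarrow> c k), out_weight = (\<lambda>j. \<Sum>b\<in>{b\<in>B. idx b = j}. v b)\<rparr>"
  let ?A = "dense_architecture (Suc n) K :: 'd architecture"
  have units: "j < K \<Longrightarrow> l \<le> n \<Longrightarrow> unit_output ?A W x l j = e l j x" for l j x
  proof (induction l arbitrary: j)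
    case 0
    then show ?case using first_layer by (simp add: W_def dense_architecture_def)
  next
    case (Suc l)
    then have "unit_output ?A W x (Suc l) j = relu ((\<Sum>i<K. a l j i * e l i x) + c l j)"
      by (simp add: W_def dense_architecture_def)
    then show ?case using later_layers Suc.prems by simp
  qed
  have "network_output ?A W x = (\<Sum>b\<in>B. v b * P b x)" for x
  proof -
    have "network_output ?A W x = (\<Sum>j<K. (\<Sum>b\<in>{b\<in>B. idx b = j}. v b) * e' j x)"
      using units[of _ n] by (simp add: network_output_def) (simp add: W_def dense_architecture_def e_def)
    also have "\<dots> = (\<Sum>j<K. \<Sum>b\<in>{b\<in>B. idx b = j}. v b * P b x)"
      unfolding sum_distrib_right using idx by (intro sum.cong) auto
    also have "\<dots> = (\<Sum>b\<in>B. v b * P b x)"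
      using B(1) idx(1) by (intro sum.group) auto
    finally show ?thesis .
  qed
  then show ?thesis by blast
qed

section \<open>Approximate multiplication\<close>

text \<open>
  On the unit interval this is \<open>1 - |2 t - 1|\<close>, written as a combination of two units.
\<close>

definition tent :: "real \<Rightarrow> real" where
  "tent t = 2 * relu t - 4 * relu (t - 1/2)"

text \<open>
  A partial sum of the series \<open>t (1 - t) = \<Sum>\<^sub>s tent\<^sup>s(t) / 4\<^sup>s\<close>, where \<open>tent\<^sup>s\<close> is the iterate.
\<close>

definition tent_series :: "nat \<Rightarrow> real \<Rightarrow> real" where
  "tent_series s t = (\<Sum>r<s. (tent ^^ Suc r) t / 4 ^ Suc r)"

lemma tent_unit_interval: "t \<in> {0..1} \<Longrightarrow> tent t \<in> {0..1}"
  by (auto simp: tent_def relu_def max_def)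

lemma tent_funpow_unit_interval: "t \<in> {0..1} \<Longrightarrow> (tent ^^ s) t \<in> {0..1}"
  by (induction s) (use tent_unit_interval in auto)

text \<open>
  Iterating this identity yields the series for \<open>t (1 - t)\<close> together with its exact remainder.
\<close>

lemma tent_self_similarity: "t \<in> {0..1} \<Longrightarrow> t * (1 - t) = tent t / 4 + tent t * (1 - tent t) / 4"
  by (cases "t \<le> 1/2") (auto simp: tent_def relu_def max_def field_simps)

lemma tent_series_remainder:
  assumes "t \<in> {0..1}"
  shows "t * (1 - t) - tent_series s t = (tent ^^ s) t * (1 - (tent ^^ s) t) / 4 ^ s"
proof (induction s)
  case 0
  then show ?case by (simp add: tent_series_def)
next
  case (Suc s)
  let ?y = "(tent ^^ s) t"
  have "t * (1 - t) - tent_series (Suc s) t = ?y * (1 - ?y) / 4 ^ s - tent ?y / 4 ^ Suc s"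
    using Suc by (simp add: tent_series_def)
  also have "\<dots> = (tent ?y / 4 + tent ?y * (1 - tent ?y) / 4) / 4 ^ s - tent ?y / 4 ^ Suc s"
    using tent_self_similarity[OF tent_funpow_unit_interval[OF assms, of s]] by simp
  finally show ?case by (simp add: add_divide_distrib)
qed

lemma tent_series_bounds:
  assumes "t \<in> {0..1}"
  shows "0 \<le> t * (1 - t) - tent_series s t" "t * (1 - t) - tent_series s t \<le> 1 / 4 ^ Suc s"
proof -
  let ?y = "(tent ^^ s) t"
  have y: "?y \<in> {0..1}" by (rule tent_funpow_unit_interval[OF assms])
  then have "0 \<le> ?y * (1 - ?y)" by simp
  then show "0 \<le> t * (1 - t) - tent_series s t"
    unfolding tent_series_remainder[OF assms] by simp
  have "0 \<le> (?y - 1/2)\<^sup>2" by simp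
  then have "?y * (1 - ?y) \<le> 1/4" by (simp add: power2_eq_square algebra_simps)
  then have "?y * (1 - ?y) / 4 ^ s \<le> 1/4 / 4 ^ s" by (intro divide_right_mono) auto
  then show "t * (1 - t) - tent_series s t \<le> 1 / 4 ^ Suc s"
    unfolding tent_series_remainder[OF assms] by simp
qed

text \<open>
  With \<open>u = (p + q) / 2\<close> one has \<open>p q = u - 2 u (1 - u) + p (1 - p) / 2 + q (1 - q) / 2\<close>; the three
  quadratic terms are replaced by their tent series.
\<close>

definition approx_mult :: "nat \<Rightarrow> real \<Rightarrow> real \<Rightarrow> real" where
  "approx_mult s p q =
     (p + q) / 2 - 2 * tent_series s ((p + q) / 2) + tent_series s p / 2 + tent_series s q / 2"

lemma approx_mult_error:
  assumes "p \<in> {0..1}" "q \<in> {0..1}"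
  shows "\<bar>approx_mult s p q - p * q\<bar> \<le> 1 / 4 ^ s"
proof -
  let ?u = "(p + q) / 2"
  define eu ep eq where "eu = ?u * (1 - ?u) - tent_series s ?u"
    and "ep = p * (1 - p) - tent_series s p" and "eq = q * (1 - q) - tent_series s q"
  have u: "?u \<in> {0..1}" using assms by auto
  have "approx_mult s p q - p * q = 2 * eu - ep / 2 - eq / 2"
    by (simp add: approx_mult_def eu_def ep_def eq_def field_simps)
  moreover have "0 \<le> eu" "eu \<le> 1 / 4 ^ Suc s" "0 \<le> ep" "ep \<le> 1 / 4 ^ Suc s" "0 \<le> eq" "eq \<le> 1 / 4 ^ Suc s"
    unfolding eu_def ep_def eq_def
    using tent_series_bounds[OF u] tent_series_bounds[OF assms(1)] tent_series_bounds[OF assms(2)] by blast+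
  ultimately show ?thesis by (simp add: abs_le_iff)
qed

text \<open>
  Brings an approximate product back to the unit interval, on which the next multiplication relies.
\<close>

definition clamp01 :: "real \<Rightarrow> real" where
  "clamp01 t = relu t - relu (t - 1)"

lemma clamp01_bounds: "clamp01 t \<in> {0..1}"
  by (auto simp: clamp01_def relu_def max_def)

lemma clamp01_error: "c \<in> {0..1} \<Longrightarrow> \<bar>clamp01 t - c\<bar> \<le> \<bar>t - c\<bar>"
  by (auto simp: clamp01_def relu_def max_def)

text \<open>
  One layer per term of the tent series. The \<open>card A + 7\<close> units carry the functions in \<open>A\<close> unchanged,
  spend two units on the tent map of each of \<open>(p + q) / 2\<close>, \<open>p\<close> and \<open>q\<close>, and keep the partial sum in one.
\<close>

lemma relu_net_tent_iterates:
  fixes p q :: "'a \<Rightarrow> real"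
  assumes A: "finite A" "card A + 7 \<le> K" "\<And>a x. a \<in> A \<Longrightarrow> 0 \<le> a x"
    and p: "\<And>x. p x \<in> {0..1}" and q: "q \<in> A" "\<And>x. q x \<in> {0..1}"
  shows "relu_net K s (insert p A)
    (A \<union> {\<lambda>x. (tent ^^ s) ((p x + q x) / 2), \<lambda>x. (tent ^^ s) (p x), \<lambda>x. (tent ^^ s) (q x),
          \<lambda>x. approx_mult s (p x) (q x)})"
proof (induction s)
  case 0
  have half: "(\<lambda>x. (p x + q x) / 2) \<in> affine_span (insert p A)"
    using affine_span_scale[OF affine_span_add[OF affine_span_base[of p] affine_span_base[of q]], of "insert p A" "1/2"]
      q(1) by simp
  then show ?case
    using q(1) by (intro relu_net_0) (auto simp: approx_mult_def tent_series_def intro: affine_span_base)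
next
  case (Suc s)
  define u where "u x = (p x + q x) / 2" for x
  define V where "V = {u, p, q}"
  define acc where "acc s x = approx_mult s (p x) (q x)" for s x
  define G where "G s = A \<union> (\<lambda>z x. (tent ^^ s) (z x)) ` V \<union> {acc s}" for s
  define T where "T = A \<union> (\<lambda>z x. relu ((tent ^^ s) (z x))) ` V
    \<union> (\<lambda>z x. relu ((tent ^^ s) (z x) - 1/2)) ` V \<union> {\<lambda>x. relu (acc s x + 1)}"
  have G: "G s = A \<union> {\<lambda>x. (tent ^^ s) ((p x + q x) / 2), \<lambda>x. (tent ^^ s) (p x), \<lambda>x. (tent ^^ s) (q x),
          \<lambda>x. approx_mult s (p x) (q x)}" for s
    by (auto simp: G_def V_def u_def acc_def)
  \<comment> \<open>A partial sum may be slightly negative, but it is at least \<open>-1\<close>; shifted by one, it passes the ReLU.\<close>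
  have acc_ge: "0 \<le> acc s x + 1" for s x
  proof -
    have "\<bar>acc s x - p x * q x\<bar> \<le> 1 / 4 ^ s" unfolding acc_def using p q by (intro approx_mult_error)
    moreover have "1 / 4 ^ s \<le> (1::real)" by simp
    moreover have "0 \<le> p x * q x" using p[of x] q(2)[of x] by simp
    ultimately show ?thesis by linarith
  qed
  have card3: "card (F ` V) \<le> 3" for F :: "('a \<Rightarrow> real) \<Rightarrow> 'a \<Rightarrow> real"
  proof -
    have "card V \<le> 3" unfolding V_def by (metis card_length eval_nat_numeral(3) length_Cons list.set(1) list.set(2) list.size(3) numeral_2_eq_2)
    then show ?thesis using card_image_le[of V F] by (simp add: V_def)
  qed
  show ?case
    unfolding G[symmetric]
  proof (rule relu_net_Suc[OF Suc.IH[folded G]])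
    show "finite T" unfolding T_def V_def using A(1) by simp
    have "card T \<le> card A + 3 + 3 + 1"
      unfolding T_def
      by (intro order_trans[OF card_Un_le] add_mono card3 order_refl) simp
    then show "card T \<le> K" using A(2) by simp
    have "(\<lambda>x. (tent ^^ s) (z x)) \<in> affine_span (G s)" if "z \<in> V" for z
      using that by (intro affine_span_base) (auto simp: G_def)
    moreover have "acc s \<in> affine_span (G s)" "A \<subseteq> affine_span (G s)"
      by (auto intro: affine_span_base simp: G_def)
    ultimately have "(\<lambda>x. relu ((tent ^^ s) (z x))) \<in> relu_units (G s)"
      "(\<lambda>x. relu ((tent ^^ s) (z x) - 1/2)) \<in> relu_units (G s)"
      "(\<lambda>x. relu (acc s x + 1)) \<in> relu_units (G s)" "A \<subseteq> relu_units (G s)" if "z \<in> V" for z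
      using that A(3) by (auto intro: relu_unitsI[OF affine_span_diff[OF _ affine_span_const]]
        relu_unitsI[OF affine_span_add[OF _ affine_span_const]] relu_unitsI nonneg_in_relu_units)
    then show "T \<subseteq> relu_units (G s)"
      unfolding T_def V_def by blast
    have tents: "(\<lambda>x. (tent ^^ Suc s) (z x)) \<in> affine_span T" if "z \<in> V" for z
    proof -
      have "(\<lambda>x. relu ((tent ^^ s) (z x))) \<in> affine_span T"
        "(\<lambda>x. relu ((tent ^^ s) (z x) - 1/2)) \<in> affine_span T"
        using that by (auto intro!: affine_span_base simp: T_def)
      from affine_span_diff[OF affine_span_scale[OF this(1), of 2] affine_span_scale[OF this(2), of 4]]
      show ?thesis by (simp add: tent_def)
    qed
    have "(\<lambda>x. relu (acc s x + 1)) \<in> affine_span T" by (auto intro!: affine_span_base simp: T_def)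
    from affine_span_add[OF affine_span_add[OF affine_span_diff[OF affine_span_diff[OF this affine_span_const[of 1]]
        affine_span_scale[OF tents[of u], of "2 / 4 ^ Suc s"]]
        affine_span_scale[OF tents[of p], of "1 / 2 / 4 ^ Suc s"]]
        affine_span_scale[OF tents[of q], of "1 / 2 / 4 ^ Suc s"]]
    have "(\<lambda>x. relu (acc s x + 1) - 1 - 2 / 4 ^ Suc s * (tent ^^ Suc s) (u x) +
      1 / 2 / 4 ^ Suc s * (tent ^^ Suc s) (p x) + 1 / 2 / 4 ^ Suc s * (tent ^^ Suc s) (q x)) \<in> affine_span T"
      by (simp add: V_def)
    also have "(\<lambda>x. relu (acc s x + 1) - 1 - 2 / 4 ^ Suc s * (tent ^^ Suc s) (u x) +
      1 / 2 / 4 ^ Suc s * (tent ^^ Suc s) (p x) + 1 / 2 / 4 ^ Suc s * (tent ^^ Suc s) (q x)) = acc (Suc s)"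
    proof
      fix x
      have "relu (acc s x + 1) = acc s x + 1" using acc_ge by (simp add: relu_def)
      then show "relu (acc s x + 1) - 1 - 2 / 4 ^ Suc s * (tent ^^ Suc s) (u x) +
        1 / 2 / 4 ^ Suc s * (tent ^^ Suc s) (p x) + 1 / 2 / 4 ^ Suc s * (tent ^^ Suc s) (q x) = acc (Suc s) x"
        by (simp add: acc_def approx_mult_def tent_series_def u_def algebra_simps add_divide_distrib)
    qed
    finally show "G (Suc s) \<subseteq> affine_span T"
      using tents by (auto simp: G_def intro: affine_span_base simp: T_def)
  qed
qed

lemma relu_net_mult:
  fixes p q :: "'a \<Rightarrow> real"
  assumes A: "finite A" "card A + 7 \<le> K" "\<And>a x. a \<in> A \<Longrightarrow> 0 \<le> a x"
    and p: "\<And>x. p x \<in> {0..1}" and q: "q \<in> A" "\<And>x. q x \<in> {0..1}"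
  shows "relu_net K (Suc m) (insert p A) (insert (\<lambda>x. clamp01 (approx_mult m (p x) (q x))) A)"
proof (rule relu_net_Suc)
  let ?r = "\<lambda>x. approx_mult m (p x) (q x)"
  let ?T = "A \<union> {\<lambda>x. relu (?r x), \<lambda>x. relu (?r x - 1)}"
  show "finite ?T" using A(1) by simp
  have "card ?T \<le> card A + 2"
    by (intro order_trans[OF card_Un_le] add_mono) (simp_all add: card_insert_if)
  then show "card ?T \<le> K" using A(2) by simp
  let ?H = "A \<union> {\<lambda>x. (tent ^^ m) ((p x + q x) / 2), \<lambda>x. (tent ^^ m) (p x), \<lambda>x. (tent ^^ m) (q x), ?r}"
  have "?r \<in> affine_span ?H" "A \<subseteq> affine_span ?H" by (auto intro: affine_span_base)
  then have "(\<lambda>x. relu (?r x)) \<in> relu_units ?H" "(\<lambda>x. relu (?r x - 1)) \<in> relu_units ?H"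
    "A \<subseteq> relu_units ?H"
    using A(3) relu_unitsI[OF affine_span_diff[OF _ affine_span_const]] relu_unitsI nonneg_in_relu_units
    by (blast, blast, blast)
  then show "?T \<subseteq> relu_units ?H" by blast
  show "relu_net K m (insert p A) ?H" using assms by (intro relu_net_tent_iterates) auto
  have "(\<lambda>x. clamp01 (?r x)) \<in> affine_span ?T"
    unfolding clamp01_def by (intro affine_span_diff affine_span_base) auto
  then show "insert (\<lambda>x. clamp01 (?r x)) A \<subseteq> affine_span ?T"
    by (auto intro: affine_span_base)
qed

text \<open>
  The factors are multiplied one after the other. As all of them are at most one, the errors of the
  single multiplications only add up.
\<close>

lemma relu_net_product:
  fixes a :: "'i \<Rightarrow> 'a \<Rightarrow> real"
  assumes I: "finite I" "card I + 7 \<le> K" and a: "\<And>i x. i \<in> I \<Longrightarrow> a i x \<in> {0..1}"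
  shows "\<exists>p. relu_net K (card I * Suc m) (a ` I) {p} \<and>
    (\<forall>x. p x \<in> {0..1} \<and> \<bar>p x - (\<Prod>i\<in>I. a i x)\<bar> \<le> card I * (1 / 4 ^ m))"
proof -
  have "\<exists>p. relu_net K (card J * Suc m) (a ` I) (insert p (a ` I)) \<and>
    (\<forall>x. p x \<in> {0..1} \<and> \<bar>p x - (\<Prod>i\<in>J. a i x)\<bar> \<le> card J * (1 / 4 ^ m))" if "J \<subseteq> I" for J
    using finite_subset[OF that I(1)] that
  proof (induction J rule: finite_induct)
    case empty
    show ?case
      by (rule exI[of _ "\<lambda>_. 1"]) (auto intro!: relu_net_0 affine_span_const intro: affine_span_base)
  next
    case (insert j J)
    then obtain p where p: "relu_net K (card J * Suc m) (a ` I) (Set.insert p (a ` I))"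
      "\<And>x. p x \<in> {0..1}" "\<And>x. \<bar>p x - (\<Prod>i\<in>J. a i x)\<bar> \<le> card J * (1 / 4 ^ m)" by auto
    define r where "r x = clamp01 (approx_mult m (p x) (a j x))" for x
    have aj: "a j x \<in> {0..1}" for x using a insert.prems by blast
    have "card (a ` I) + 7 \<le> K" using I card_image_le[of I a] by linarith
    then have "relu_net K (Suc m) (Set.insert p (a ` I)) (Set.insert r (a ` I))"
      unfolding r_def using I a p(2) insert.prems by (intro relu_net_mult) fastforce+
    from relu_net_trans[OF this p(1)]
    have "relu_net K (card (Set.insert j J) * Suc m) (a ` I) (Set.insert r (a ` I))"
      using insert.hyps by (simp add: add_ac)
    moreover have "r x \<in> {0..1}" for x unfolding r_def by (rule clamp01_bounds)
    moreover have "\<bar>r x - (\<Prod>i\<in>Set.insert j J. a i x)\<bar> \<le> card (Set.insert j J) * (1 / 4 ^ m)" for x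
    proof -
      have "p x * a j x \<in> {0..1}" using p(2)[of x] aj[of x] by (auto intro: mult_le_one)
      then have "\<bar>r x - p x * a j x\<bar> \<le> 1 / 4 ^ m"
        unfolding r_def using clamp01_error approx_mult_error[OF p(2) aj] order_trans by blast
      moreover have "\<bar>p x * a j x - (\<Prod>i\<in>Set.insert j J. a i x)\<bar> = a j x * \<bar>p x - (\<Prod>i\<in>J. a i x)\<bar>"
      proof -
        have "p x * a j x - (\<Prod>i\<in>Set.insert j J. a i x) = a j x * (p x - (\<Prod>i\<in>J. a i x))"
          using insert.hyps by (simp add: algebra_simps)
        then show ?thesis using aj[of x] by (simp add: abs_mult)
      qed
      moreover have "a j x * \<bar>p x - (\<Prod>i\<in>J. a i x)\<bar> \<le> 1 * (card J * (1 / 4 ^ m))"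
        using aj[of x] p(3)[of x] by (intro mult_mono) auto
      moreover have "card (Set.insert j J) * (1 / 4 ^ m) = 1 / 4 ^ m + card J * (1 / 4 ^ m :: real)"
        using insert.hyps by (simp add: field_simps)
      ultimately show ?thesis by linarith
    qed
    ultimately show ?case by blast
  qed
  from this[OF subset_refl] show ?thesis
    using relu_net_weaken[of K _ "a ` I" "insert _ (a ` I)" "{_}"] affine_span_base
    by (metis empty_subsetI insertI1 insert_subset)
qed

section \<open>Products of hat functions\<close>

lemma hat_relu: "hat s = relu (1 - relu s - relu (- s))"
  by (auto simp: hat_def relu_def)

text \<open>
  Two layers produce the hats, the remaining ones their product.
\<close>

lemma relu_net_hat_product:
  fixes c b :: "'d::finite \<Rightarrow> real"
  assumes K: "2 * CARD('d) + 7 \<le> K"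
  shows "\<exists>p. relu_net K (2 + CARD('d) * Suc m) (range (\<lambda>i (x::real^'d). x $ i)) {p} \<and>
    (\<forall>x. p x \<in> {0..1} \<and>
      \<bar>p x - (\<Prod>i\<in>UNIV. hat (c i * x $ i - b i))\<bar> \<le> CARD('d) * (1 / 4 ^ m))"
proof -
  let ?G = "range (\<lambda>i (x::real^'d). x $ i)"
  define u where "u i x = c i * x $ i - b i" for i and x :: "real^'d"
  define T where "T = range (\<lambda>i x. relu (u i x)) \<union> range (\<lambda>i x. relu (- u i x))"
  have u: "u i \<in> affine_span ?G" for i
    using affine_span_diff[OF affine_span_scale[OF affine_span_base[of "\<lambda>x. x $ i"]] affine_span_const[of "b i"], of ?G "c i"]
    unfolding u_def[abs_def] by blast
  have u': "(\<lambda>x. - u i x) \<in> affine_span ?G" for i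
    using affine_span_scale[OF u[of i], of "-1"] by simp
  have "relu_net K 1 ?G T"
  proof (rule relu_net_step)
    show "finite T" unfolding T_def by simp
    have "card T \<le> CARD('d) + CARD('d)"
      unfolding T_def by (intro order_trans[OF card_Un_le] add_mono card_image_le) simp_all
    then show "card T \<le> K" using K by simp
    show "T \<subseteq> relu_units ?G" using u u' unfolding T_def by (auto intro: relu_unitsI)
  qed (auto intro: affine_span_base)
  moreover have "relu_net K 1 T (range (\<lambda>i x. hat (u i x)))"
  proof (rule relu_net_step)
    show "card (range (\<lambda>i x. hat (u i x))) \<le> K"
      using card_image_le[of UNIV "\<lambda>i x. hat (u i x)"] K by simp
    have "(\<lambda>x. 1 - relu (u i x) - relu (- u i x)) \<in> affine_span T" for i
      by (intro affine_span_diff affine_span_const affine_span_base) (auto simp: T_def)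
    then show "range (\<lambda>i x. hat (u i x)) \<subseteq> relu_units T"
      unfolding hat_relu by (auto intro: relu_unitsI)
  qed (auto intro: affine_span_base)
  ultimately have "relu_net K (1 + 1) ?G (range (\<lambda>i x. hat (u i x)))"
    using relu_net_trans by blast
  moreover obtain p where p: "relu_net K (CARD('d) * Suc m) (range (\<lambda>i x. hat (u i x))) {p}"
    "\<forall>x. p x \<in> {0..1} \<and> \<bar>p x - (\<Prod>i\<in>UNIV. hat (u i x))\<bar> \<le> CARD('d) * (1 / 4 ^ m)"
    using relu_net_product[of UNIV K "\<lambda>i x. hat (u i x)" m] K hat_bounds by auto
  ultimately have "relu_net K ((1 + 1) + CARD('d) * Suc m) ?G {p}"
    using relu_net_trans by blast
  then show ?thesis using p(2) unfolding u_def by (intro exI[of _ p]) simp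
qed

section \<open>Approximation of Korobov functions\<close>

lemma network_output_borel_measurable: "network_output A W \<in> borel_measurable borel"
proof -
  have relu: "(\<lambda>x. relu (h x)) \<in> borel_measurable borel" if "h \<in> borel_measurable borel"
    for h :: "real^'a \<Rightarrow> real"
    unfolding relu_def using that by (intro borel_measurable_max borel_measurable_const)
  have coord: "(\<lambda>x :: real^'a. x $ i) \<in> borel_measurable borel" for i
    by (intro borel_measurable_continuous_onI continuous_intros)
  have "(\<lambda>x. unit_output A W x l j) \<in> borel_measurable borel" for l j
  proof (induction l arbitrary: j)
    case 0
    show ?case unfolding unit_output.simps
      by (intro relu borel_measurable_add borel_measurable_sum borel_measurable_times borel_measurable_const coord)
  next
    case (Suc l)
    show ?case unfolding unit_output.simps
      by (intro relu borel_measurable_add borel_measurable_sum borel_measurable_times borel_measurable_const Suc)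
  qed
  then show ?thesis
    unfolding network_output_def[abs_def]
    by (intro borel_measurable_sum borel_measurable_times borel_measurable_const)
qed

lemma AE_lebesgue_on_cube:
  "(AE x in lebesgue_on unit_cube. P x) \<longleftrightarrow> (AE x in lebesgue. x \<in> unit_cube \<longrightarrow> P x)"
  by (subst AE_restrict_space_iff) simp_all

text \<open>
  The weak derivative selected in the definition of the seminorm is bounded by one almost everywhere, so
  the bound on surpluses applies to the continuous representative. For a node of level \<open>l\<close> with mesh
  \<open>h\<^sub>j = 2\<^bsup>-(l\<^sub>j + 1)\<^esup>\<close> the product of the \<open>h\<^sub>j\<^sup>2 / 2\<close> is \<open>8\<^bsup>-d\<^esup> 4\<^bsup>-|l|\<^esup>\<close>.
\<close>

lemma korobov_representative:
  fixes f :: "real^'d::finite \<Rightarrow> real"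
  assumes f: "f \<in> korobov_space p" and seminorm: "korobov_seminorm f \<le> 1"
  shows "\<exists>g. continuous_on unit_cube g \<and> (AE x in lebesgue_on unit_cube. f x = g x) \<and>
    (\<forall>x\<in>unit_cube. (\<exists>j. x $ j \<in> {0, 1}) \<longrightarrow> g x = 0) \<and>
    (\<forall>l. \<forall>k\<in>level_nodes l. \<bar>grid_surplus g l k\<bar> \<le> (1/4) ^ sum l UNIV)"
proof -
  let ?w = "weak_deriv (interior unit_cube) (\<lambda>_. 2) f"
  have f_meas: "f \<in> borel_measurable (lebesgue_on unit_cube)"
    using f by (simp add: korobov_space_def Lp_space_def)
  have "\<exists>w. has_weak_deriv (interior unit_cube) (\<lambda>_. 2) f w"
    using f unfolding korobov_space_def by force
  then have "has_weak_deriv (interior unit_cube) (\<lambda>_. 2) f ?w"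
    unfolding weak_deriv_def by (rule someI_ex)
  then have weak: "has_weak_deriv (box 0 1) (\<lambda>_. 2) f ?w" by simp
  have "AE x in lebesgue_on unit_cube. ereal \<bar>?w x\<bar> \<le> Linf_norm unit_cube ?w"
    unfolding Linf_norm_def by (rule esssup_AE)
  then have "AE x in lebesgue_on unit_cube. \<bar>?w x\<bar> \<le> 1"
  proof (rule eventually_mono)
    fix x assume "ereal \<bar>?w x\<bar> \<le> Linf_norm unit_cube ?w"
    also have "\<dots> \<le> 1" using seminorm by (simp add: korobov_seminorm_def)
    finally show "\<bar>?w x\<bar> \<le> 1" by simp
  qed
  then have w: "AE x in lebesgue. x \<in> unit_cube \<longrightarrow> \<bar>?w x\<bar> \<le> 1"
    by (simp only: AE_lebesgue_on_cube)
  obtain g where g: "continuous_on unit_cube g" "AE x in lebesgue_on unit_cube. f x = g x"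
    "\<And>x. x \<in> frontier unit_cube \<Longrightarrow> g x = 0"
    using f unfolding korobov_space_def zero_on_boundary_def by blast
  have fg: "AE x in lebesgue. x \<in> unit_cube \<longrightarrow> f x = g x"
    using g(2) by (simp only: AE_lebesgue_on_cube)
  have boundary: "g x = 0" if "\<exists>j. x $ j \<in> {0, 1}" "x \<in> unit_cube" for x
  proof (rule g(3))
    have "x \<notin> box 0 1"
    proof
      assume "x \<in> box 0 1"
      then have "0 < x $ j \<and> x $ j < 1" for j by (simp add: mem_box_cart)
      then show False using that(1) by (metis insertE less_irrefl singletonD)
    qed
    then show "x \<in> frontier unit_cube" using that(2) by (simp add: frontier_def)
  qed
  have bound: "\<bar>grid_surplus g l k\<bar> \<le> (1/4) ^ sum l UNIV" if k: "k \<in> level_nodes l" for l k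
  proof -
    have "\<bar>grid_surplus g l k\<bar> \<le> (\<Prod>j\<in>UNIV. (1 / 2 ^ Suc (l j))\<^sup>2 / 2)"
      unfolding grid_surplus_def
    proof (rule surplus_bound[OF weak w fg f_meas g(1)])
      fix j
      have "k j < 2 ^ l j" using k by (auto simp: level_nodes_def)
      then have "real (k j + 1) \<le> real (2 ^ l j)" unfolding of_nat_le_iff by simp
      then show "(2 * real (k j) + 1) / 2 ^ Suc (l j) + 1 / 2 ^ Suc (l j) \<le> 1"
        by (simp add: field_simps)
      show "0 \<le> (2 * real (k j) + 1) / 2 ^ Suc (l j) - 1 / 2 ^ Suc (l j)"
        by (simp add: diff_divide_distrib[symmetric])
    qed simp
    also have "\<dots> \<le> (\<Prod>j\<in>UNIV. (1/4) ^ l j)"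
    proof (intro prod_mono conjI)
      fix j
      have "(1 / 2 ^ Suc (l j))\<^sup>2 / 2 = (1/4::real) ^ l j / 8"
        by (simp add: power_divide power2_eq_square power_mult_distrib[symmetric])
      moreover have "0 \<le> (1/4::real) ^ l j" by simp
      ultimately show "(1 / 2 ^ Suc (l j))\<^sup>2 / 2 \<le> (1/4::real) ^ l j" by linarith
    qed simp
    finally show ?thesis by (simp add: power_sum)
  qed
  show ?thesis using g(1,2) boundary bound by blast
qed

text \<open>
  One block of \<open>2 d + 7\<close> units per layer for each basis function; \<open>r\<close> is the number of tent iterations in
  each multiplication.
\<close>

definition sparse_relu_architecture :: "nat \<Rightarrow> nat \<Rightarrow> 'd::finite architecture" where
  "sparse_relu_architecture m r = dense_architecture (Suc (2 + CARD('d) * Suc r))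
     (card (grid_indices m :: (('d \<Rightarrow> nat) \<times> _) set) * (2 * CARD('d) + 7))"

lemma grid_indices_nonempty: "((\<lambda>_. 0), (\<lambda>_. 0)) \<in> grid_indices m"
  by (auto simp: grid_indices_def sparse_levels_def level_nodes_def)

lemma card_grid_indices_pos: "0 < card (grid_indices m)"
  using grid_indices_nonempty finite_grid_indices card_gt_0_iff by blast

lemma valid_sparse_relu_architecture: "valid_architecture (sparse_relu_architecture m r :: 'd::finite architecture)"
  using card_grid_indices_pos[where 'a = 'd, of m]
  by (simp add: valid_architecture_def sparse_relu_architecture_def dense_architecture_def Suc_le_eq)

text \<open>
  The hidden weights depend on \<open>m\<close> and \<open>r\<close> only; the coefficients \<open>v\<close> enter as output weights.
\<close>

lemma sparse_relu_approximation:
  fixes v :: "('d::finite \<Rightarrow> nat) \<times> ('d \<Rightarrow> nat) \<Rightarrow> real"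
  shows "\<exists>W. \<forall>x. \<bar>(\<Sum>(l, k)\<in>grid_indices m. v (l, k) * grid_basis l k x)
      - network_output (sparse_relu_architecture m r) W x\<bar>
    \<le> (\<Sum>b\<in>grid_indices m. \<bar>v b\<bar>) * (CARD('d) * (1 / 4 ^ r))"
proof -
  let ?B = "grid_indices m :: (('d \<Rightarrow> nat) \<times> ('d \<Rightarrow> nat)) set"
  let ?G = "range (\<lambda>i (x::real^'d). x $ i)"
  let ?K = "2 * CARD('d) + 7" and ?n = "2 + CARD('d) * Suc r"
  have "\<exists>p. relu_net ?K ?n ?G {p} \<and> (\<forall>x. p x \<in> {0..1} \<and>
      \<bar>p x - grid_basis (fst b) (snd b) x\<bar> \<le> CARD('d) * (1 / 4 ^ r))" for b :: "('d \<Rightarrow> nat) \<times> ('d \<Rightarrow> nat)"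
    unfolding grid_basis_def by (rule relu_net_hat_product) simp
  then obtain P where P: "\<And>b. relu_net ?K ?n ?G {P b}" "\<And>b x. P b x \<in> {0..1}"
    "\<And>b x. \<bar>P b x - grid_basis (fst b) (snd b) x\<bar> \<le> CARD('d) * (1 / 4 ^ r)" by metis
  have "relu_net (card ?B * ?K) ?n (\<Union>b\<in>?B. ?G) (\<Union>b\<in>?B. {P b})"
    by (rule relu_net_parallel[OF finite_grid_indices]) (rule P(1))
  moreover have "(\<Union>b\<in>?B. ?G) = ?G" using grid_indices_nonempty by blast
  moreover have "(\<Union>b\<in>?B. {P b}) = P ` ?B" by blast
  ultimately have "relu_net (card ?B * ?K) ?n ?G (P ` ?B)" by simp
  from relu_net_realization[OF this finite_grid_indices, of v] P(2)
  obtain W where W: "\<And>x. network_output (sparse_relu_architecture m r) W x = (\<Sum>b\<in>?B. v b * P b x)"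
    unfolding sparse_relu_architecture_def by auto
  have "\<bar>(\<Sum>(l, k)\<in>?B. v (l, k) * grid_basis l k x) - network_output (sparse_relu_architecture m r) W x\<bar>
    \<le> (\<Sum>b\<in>?B. \<bar>v b\<bar>) * (CARD('d) * (1 / 4 ^ r))" for x
  proof -
    have "(\<Sum>(l, k)\<in>?B. v (l, k) * grid_basis l k x) - network_output (sparse_relu_architecture m r) W x =
      (\<Sum>b\<in>?B. v b * (grid_basis (fst b) (snd b) x - P b x))"
      unfolding W by (simp add: case_prod_unfold sum_subtractf right_diff_distrib)
    also have "\<bar>\<dots>\<bar> \<le> (\<Sum>b\<in>?B. \<bar>v b\<bar> * (CARD('d) * (1 / 4 ^ r)))"
    proof (intro order_trans[OF sum_abs] sum_mono)
      fix b
      show "\<bar>v b * (grid_basis (fst b) (snd b) x - P b x)\<bar> \<le> \<bar>v b\<bar> * (CARD('d) * (1 / 4 ^ r))"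
        using P(3)[of b x] unfolding abs_mult by (intro mult_left_mono) (simp_all add: abs_minus_commute)
    qed
    also have "\<dots> = (\<Sum>b\<in>?B. \<bar>v b\<bar>) * (CARD('d) * (1 / 4 ^ r))" by (rule sum_distrib_right[symmetric])
    finally show ?thesis .
  qed
  then show ?thesis by blast
qed

lemma sparse_relu_architecture_expresses:
  fixes f :: "real^'d::finite \<Rightarrow> real"
  assumes f: "f \<in> korobov_space p" "korobov_seminorm f \<le> 1"
    and m: "sparse_constant (CARD('d) - 1) * (real (m + 1) ^ (CARD('d) - 1) * (1/4) ^ m) \<le> \<epsilon> / 2"
    and r: "2 ^ CARD('d) * (CARD('d) * (1 / 4 ^ r)) \<le> \<epsilon> / 2"
  shows "expresses (sparse_relu_architecture m r) f \<epsilon>"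
proof -
  let ?B = "grid_indices m :: (('d \<Rightarrow> nat) \<times> ('d \<Rightarrow> nat)) set"
  obtain g where g: "continuous_on unit_cube g" "AE x in lebesgue_on unit_cube. f x = g x"
    "\<And>x. \<exists>j. x $ j \<in> {0, 1} \<Longrightarrow> x \<in> unit_cube \<Longrightarrow> g x = 0"
    "\<And>l k. k \<in> level_nodes l \<Longrightarrow> \<bar>grid_surplus g l k\<bar> \<le> (1/4) ^ sum l UNIV"
    using korobov_representative[OF f] by blast
  let ?v = "\<lambda>b. grid_surplus g (fst b) (snd b)"
  from sparse_relu_approximation[where m = m and v = ?v and r = r]
  obtain W where W: "\<forall>x. \<bar>(\<Sum>(l, k)\<in>?B. ?v (l, k) * grid_basis l k x)
      - network_output (sparse_relu_architecture m r) W x\<bar>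
    \<le> (\<Sum>b\<in>?B. \<bar>?v b\<bar>) * (CARD('d) * (1 / 4 ^ r))" ..
  let ?N = "network_output (sparse_relu_architecture m r) W"
  have "(\<Sum>b\<in>?B. \<bar>?v b\<bar>) \<le> (\<Sum>(l, k)\<in>?B. (1/4) ^ sum l UNIV)"
    using g(4) by (intro sum_mono) (auto simp: grid_indices_def)
  also have "\<dots> \<le> 2 ^ CARD('d)" by (rule sum_surplus_bound_le)
  finally have "(\<Sum>b\<in>?B. \<bar>?v b\<bar>) * (CARD('d) * (1 / 4 ^ r)) \<le> 2 ^ CARD('d) * (CARD('d) * (1 / 4 ^ r))"
    by (rule mult_right_mono) simp
  then have net: "\<bar>(\<Sum>(l, k)\<in>?B. grid_surplus g l k * grid_basis l k x) - ?N x\<bar> \<le> \<epsilon> / 2" for x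
    using W[rule_format, of x, unfolded fst_conv snd_conv] r by linarith
  have error: "\<bar>g x - ?N x\<bar> \<le> \<epsilon>" if "x \<in> unit_cube" for x
  proof -
    have "\<bar>g x - (\<Sum>(l, k)\<in>?B. grid_surplus g l k * grid_basis l k x)\<bar>
      \<le> sparse_constant (CARD('d) - 1) * (real (m + 1) ^ (CARD('d) - 1) * (1/4) ^ m)"
      by (rule sparse_grid_error[OF g(1) that]) (use g(3,4) in blast)+
    then show ?thesis using m net[of x] by linarith
  qed
  have "Linf_norm unit_cube (\<lambda>x. f x - ?N x) \<le> ereal \<epsilon>"
    unfolding Linf_norm_def
  proof (rule esssup_I)
    have "?N \<in> borel_measurable lborel"
      unfolding measurable_lborel2 by (rule network_output_borel_measurable)
    then have "?N \<in> borel_measurable lebesgue" by (rule measurable_completion)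
    then have "?N \<in> borel_measurable (lebesgue_on unit_cube)" by (rule measurable_restrict_space1)
    moreover have "f \<in> borel_measurable (lebesgue_on unit_cube)"
      using f(1) by (simp add: korobov_space_def Lp_space_def)
    ultimately have "(\<lambda>x. \<bar>f x - ?N x\<bar>) \<in> borel_measurable (lebesgue_on unit_cube)"
      by (intro borel_measurable_abs borel_measurable_diff)
    then show "(\<lambda>x. ereal \<bar>f x - ?N x\<bar>) \<in> borel_measurable (lebesgue_on unit_cube)"
      by (rule borel_measurable_ereal)
    have "AE x in lebesgue_on unit_cube. x \<in> unit_cube" by (simp add: AE_lebesgue_on_cube)
    then show "AE x in lebesgue_on unit_cube. ereal \<bar>f x - ?N x\<bar> \<le> ereal \<epsilon>"
      using g(2) by eventually_elim (use error in simp)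
  qed
  then show ?thesis unfolding expresses_def by blast
qed

section \<open>Choice of the level and of the number of tent iterations\<close>

lemma sparse_constant_ge: "real (m + 1) ^ D * (1/4) ^ m \<le> sparse_constant D"
proof -
  have "(\<Sum>r\<in>{m}. real (r + 1) ^ D * (1/4) ^ r) \<le> sparse_constant D"
    unfolding sparse_constant_def by (intro sum_le_suminf summable_sparse_constant) auto
  then show ?thesis by simp
qed

lemma sparse_constant_ge_1: "1 \<le> sparse_constant D"
  using sparse_constant_ge[of 0 D] by simp

text \<open>
  The bound on a single summand with exponent \<open>2 D\<close> is the square of this inequality.
\<close>

lemma power_le_exponential: "real (m + 1) ^ D \<le> sqrt (sparse_constant (2 * D)) * 2 ^ m"
proof (rule power2_le_imp_le)
  have "real (m + 1) ^ (2 * D) = (real (m + 1) ^ (2 * D) * (1/4) ^ m) * 4 ^ m"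
    by (simp add: power_divide)
  also have "\<dots> \<le> sparse_constant (2 * D) * 4 ^ m"
    by (intro mult_right_mono sparse_constant_ge) simp
  finally show "(real (m + 1) ^ D)\<^sup>2 \<le> (sqrt (sparse_constant (2 * D)) * 2 ^ m)\<^sup>2"
    using sparse_constant_ge_1[of "2 * D"]
    by (simp add: power_mult_distrib power_mult[symmetric] mult.commute[of _ 2] power_mult[of 2 2, simplified])
  show "0 \<le> sqrt (sparse_constant (2 * D)) * 2 ^ m"
    using sparse_constant_ge_1[of "2 * D"] by simp
qed

text \<open>
  Both parameters are chosen minimal, so that failure at the predecessor bounds them from above.
\<close>

definition tent_count :: "real \<Rightarrow> real \<Rightarrow> nat" where
  "tent_count A \<epsilon> = (LEAST r. A * (1 / 4 ^ r) \<le> \<epsilon> / 2)"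

definition sparse_level :: "nat \<Rightarrow> real \<Rightarrow> nat" where
  "sparse_level D \<epsilon> = (LEAST m. sparse_constant D * (real (m + 1) ^ D * (1/4) ^ m) \<le> \<epsilon> / 2)"

lemma tent_count:
  assumes "0 < \<epsilon>"
  shows "A * (1 / 4 ^ tent_count A \<epsilon>) \<le> \<epsilon> / 2"
proof -
  have "(\<lambda>r. A * (1 / 4 ^ r)) \<longlonglongrightarrow> 0" by real_asymp
  then have "\<forall>\<^sub>F r in sequentially. A * (1 / 4 ^ r) < \<epsilon> / 2"
    by (rule order_tendstoD) (use assms in simp)
  then have "\<exists>r. A * (1 / 4 ^ r) \<le> \<epsilon> / 2" unfolding eventually_sequentially by (meson less_imp_le order_refl)
  then show ?thesis unfolding tent_count_def by (rule LeastI_ex)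
qed

lemma sparse_level:
  assumes "0 < \<epsilon>"
  shows "sparse_constant D * (real (sparse_level D \<epsilon> + 1) ^ D * (1/4) ^ sparse_level D \<epsilon>) \<le> \<epsilon> / 2"
proof -
  have "(\<lambda>m. sparse_constant D * (real (m + 1) ^ D * (1/4) ^ m)) \<longlonglongrightarrow> sparse_constant D * 0"
    by (intro tendsto_mult tendsto_const summable_LIMSEQ_zero summable_sparse_constant)
  then have "\<forall>\<^sub>F m in sequentially. sparse_constant D * (real (m + 1) ^ D * (1/4) ^ m) < \<epsilon> / 2"
    by (rule order_tendstoD) (use assms in simp)
  then have "\<exists>m. sparse_constant D * (real (m + 1) ^ D * (1/4) ^ m) \<le> \<epsilon> / 2"
    unfolding eventually_sequentially by (meson less_imp_le order_refl)
  then show ?thesis unfolding sparse_level_def by (rule LeastI_ex)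
qed

lemma log_bound_from_power:
  assumes "2 ^ m \<le> a / \<epsilon>" "0 < \<epsilon>" "\<epsilon> \<le> 1/2" "1 \<le> a"
  shows "real m + 1 \<le> (log 2 a + 2) * \<bar>log 2 \<epsilon>\<bar>"
proof -
  have L: "\<bar>log 2 \<epsilon>\<bar> = - log 2 \<epsilon>" "1 \<le> \<bar>log 2 \<epsilon>\<bar>"
  proof -
    have "log 2 \<epsilon> \<le> log 2 (1/2)" using assms by (subst log_le_cancel_iff) auto
    also have "\<dots> = -1" by (simp add: log_divide)
    finally show "\<bar>log 2 \<epsilon>\<bar> = - log 2 \<epsilon>" "1 \<le> \<bar>log 2 \<epsilon>\<bar>" by simp_all
  qed
  have "real m = log 2 (2 ^ m)" by (simp add: log_nat_power)
  also have "\<dots> \<le> log 2 (a / \<epsilon>)" using assms by (subst log_le_cancel_iff) auto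
  also have "\<dots> = log 2 a + \<bar>log 2 \<epsilon>\<bar>" using assms L by (simp add: log_divide)
  finally have "real m + 1 \<le> (log 2 a + 1) * 1 + 1 * \<bar>log 2 \<epsilon>\<bar>" by simp
  also have "\<dots> \<le> (log 2 a + 1) * \<bar>log 2 \<epsilon>\<bar> + 1 * \<bar>log 2 \<epsilon>\<bar>"
    using L assms(4) by (intro add_mono mult_left_mono) auto
  finally show ?thesis by (simp add: algebra_simps)
qed

lemma tent_count_le:
  assumes "0 < \<epsilon>" "\<epsilon> \<le> 1/2" "1 \<le> A"
  shows "real (tent_count A \<epsilon>) + 1 \<le> (log 2 (8 * A) + 2) * \<bar>log 2 \<epsilon>\<bar>"
proof (rule log_bound_from_power)
  show "2 ^ tent_count A \<epsilon> \<le> 8 * A / \<epsilon>"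
  proof (cases "tent_count A \<epsilon>")
    case 0
    then show ?thesis using assms by (simp add: field_simps)
  next
    case (Suc r)
    then have "\<not> A * (1 / 4 ^ r) \<le> \<epsilon> / 2"
      using not_less_Least[of r "\<lambda>r. A * (1 / 4 ^ r) \<le> \<epsilon> / 2"] unfolding tent_count_def by simp
    then have "4 ^ Suc r \<le> 8 * A / \<epsilon>" using assms by (simp add: field_simps)
    moreover have "(2::real) ^ Suc r \<le> 4 ^ Suc r" by (rule power_mono) auto
    ultimately show ?thesis unfolding Suc by linarith
  qed
qed (use assms in auto)

lemma sparse_level_power_le:
  fixes D :: nat and \<epsilon> :: real
  assumes "0 < \<epsilon>" "\<epsilon> \<le> 1/2"
  defines "m \<equiv> sparse_level D \<epsilon>"
  shows "4 ^ m \<le> 8 * sparse_constant D * real (m + 1) ^ D / \<epsilon>"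
proof (cases m)
  case 0
  have "\<epsilon> \<le> 8 * sparse_constant D" using sparse_constant_ge_1[of D] assms by linarith
  then show ?thesis using 0 assms by (simp add: field_simps)
next
  case (Suc r)
  then have "\<not> sparse_constant D * (real (r + 1) ^ D * (1/4) ^ r) \<le> \<epsilon> / 2"
    using not_less_Least[of r "\<lambda>m. sparse_constant D * (real (m + 1) ^ D * (1/4) ^ m) \<le> \<epsilon> / 2"]
    unfolding m_def sparse_level_def by simp
  then have "\<epsilon> * 4 ^ m \<le> 8 * (sparse_constant D * real (r + 1) ^ D)"
    unfolding Suc by (simp add: power_divide field_simps)
  also have "\<dots> \<le> 8 * (sparse_constant D * real (m + 1) ^ D)"
    using Suc sparse_constant_ge_1[of D] by (intro mult_left_mono power_mono) auto
  finally show ?thesis using assms by (simp add: field_simps)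
qed

text \<open>
  By minimality \<open>4\<^sup>m\<close> is at most of the order of \<open>m\<^sup>D / \<epsilon>\<close>. Since \<open>m\<^sup>D\<close> is absorbed by \<open>2\<^sup>m\<close>, this leaves
  \<open>2\<^sup>m \<le> const / \<epsilon>\<close>: crude, but enough to see that \<open>m\<close> is logarithmic.
\<close>

lemma sparse_level_le:
  assumes "0 < \<epsilon>" "\<epsilon> \<le> 1/2"
  shows "real (sparse_level D \<epsilon>) + 1 \<le>
    (log 2 (8 * sparse_constant D * sqrt (sparse_constant (2 * D))) + 2) * \<bar>log 2 \<epsilon>\<bar>"
proof (rule log_bound_from_power[OF _ assms])
  let ?m = "sparse_level D \<epsilon>" and ?C = "sparse_constant D" and ?S = "sqrt (sparse_constant (2 * D))"
  have "2 ^ ?m * 2 ^ ?m = (4::real) ^ ?m" by (simp add: power_mult_distrib[symmetric])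
  also have "\<dots> \<le> 8 * ?C * real (?m + 1) ^ D / \<epsilon>" by (rule sparse_level_power_le[OF assms])
  also have "\<dots> \<le> 8 * ?C * (?S * 2 ^ ?m) / \<epsilon>"
    using sparse_constant_ge_1[of D] assms
    by (intro divide_right_mono mult_left_mono power_le_exponential) auto
  also have "\<dots> = (8 * ?C * ?S / \<epsilon>) * 2 ^ ?m" by simp
  finally show "2 ^ ?m \<le> 8 * ?C * ?S / \<epsilon>" by (rule mult_right_le_imp_le) simp
  have "1 * 1 \<le> ?C * ?S"
    using sparse_constant_ge_1[of D] sparse_constant_ge_1[of "2 * D"] by (intro mult_mono) auto
  then show "1 \<le> 8 * ?C * ?S" by simp
qed

text \<open>
  The grid has of the order of \<open>m\<^sup>q 2\<^sup>m\<close> nodes with \<open>q = d - 1\<close>. The square root of the bound on \<open>4\<^sup>m\<close> is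
  \<open>m\<^bsup>q/2\<^esup> \<epsilon>\<^bsup>-1/2\<^esup>\<close>, and \<open>m\<close> is logarithmic in \<open>\<epsilon>\<close>; this is where the exponent \<open>3/2 q\<close> comes from.
\<close>

lemma grid_size_le:
  fixes \<epsilon> :: real
  defines "q \<equiv> CARD('d::finite) - 1"
  defines "c \<equiv> log 2 (8 * sparse_constant q * sqrt (sparse_constant (2 * q))) + 2"
  assumes "0 < \<epsilon>" "\<epsilon> \<le> 1/2"
  shows "real (card (grid_indices (sparse_level q \<epsilon>) :: (('d \<Rightarrow> nat) \<times> _) set)) \<le>
    2 * (8 * sparse_constant q) powr (1/2) * c powr (3/2 * q) * (\<epsilon> powr (-1/2) * \<bar>log 2 \<epsilon>\<bar> powr (3/2 * q))"
proof -
  define m where "m = sparse_level q \<epsilon>"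
  define L where "L = \<bar>log 2 \<epsilon>\<bar>"
  have C: "1 \<le> sparse_constant q" by (rule sparse_constant_ge_1)
  have m: "real (m + 1) \<le> c * L"
    using sparse_level_le[OF assms(3,4), of q] unfolding m_def c_def L_def by simp
  then have cL: "0 < c * L" by (rule less_le_trans[rotated]) simp
  have "0 < L" using assms(3,4) by (simp add: L_def)
  then have "0 < c" using cL zero_less_mult_pos2 by blast
  have "2 ^ m = (4 ^ m :: real) powr (1/2)"
  proof -
    have "(4::real) ^ m = (2 ^ m)\<^sup>2" by (simp add: power2_eq_square power_mult_distrib[symmetric])
    then show ?thesis by (simp add: powr_half_sqrt)
  qed
  also have "\<dots> \<le> (8 * sparse_constant q * real (m + 1) ^ q / \<epsilon>) powr (1/2)"
    using sparse_level_power_le[OF assms(3,4), of q] unfolding m_def by (intro powr_mono2) auto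
  also have "\<dots> \<le> (8 * sparse_constant q * (c * L) ^ q / \<epsilon>) powr (1/2)"
    using C m assms(3) by (intro powr_mono2 divide_right_mono mult_left_mono power_mono) auto
  also have "\<dots> = (8 * sparse_constant q) powr (1/2) * (c * L) powr (q / 2) * \<epsilon> powr (-1/2)"
    using C cL assms(3) by (simp add: powr_mult powr_divide powr_realpow[symmetric] powr_powr powr_minus_divide)
  finally have two: "2 ^ m \<le> (8 * sparse_constant q) powr (1/2) * (c * L) powr (q / 2) * \<epsilon> powr (-1/2)" .
  have "real (card (grid_indices m :: (('d \<Rightarrow> nat) \<times> _) set)) \<le> real (m + 1) ^ q * 2 ^ Suc m"
    unfolding q_def by (rule card_grid_indices_le)
  also have "\<dots> \<le> (c * L) ^ q * (2 * ((8 * sparse_constant q) powr (1/2) * (c * L) powr (q / 2) * \<epsilon> powr (-1/2)))"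
    using m cL two by (intro mult_mono power_mono) auto
  also have "\<dots> = 2 * (8 * sparse_constant q) powr (1/2) * ((c * L) powr q * (c * L) powr (q / 2)) * \<epsilon> powr (-1/2)"
    using cL by (simp add: powr_realpow)
  also have "(c * L) powr q * (c * L) powr (q / 2) = c powr (3/2 * q) * L powr (3/2 * q)"
    using \<open>0 < c\<close> \<open>0 < L\<close> by (simp add: powr_add[symmetric] powr_mult field_simps)
  finally show ?thesis unfolding m_def L_def by (simp add: mult_ac)
qed

theorem theorem1:
  "\<exists>N :: real \<Rightarrow> 'd::finite architecture.
     (\<forall>\<epsilon>. 0 < \<epsilon> \<and> \<epsilon> < 1 \<longrightarrow>
        valid_architecture (N \<epsilon>) \<and>
        (\<forall>p. 2 \<le> p \<longrightarrow>
           (\<forall>f \<in> korobov_space p. korobov_seminorm f \<le> 1 \<longrightarrow> expresses (N \<epsilon>) f \<epsilon>))) \<and>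
     (\<lambda>\<epsilon>. real (depth (N \<epsilon>))) \<in> O[at_right 0](\<lambda>\<epsilon>. \<bar>log 2 \<epsilon>\<bar> * max 1 (log 2 (real CARD('d)))) \<and>
     (\<lambda>\<epsilon>. real (network_size (N \<epsilon>))) \<in> O[at_right 0](\<lambda>\<epsilon>.
        \<epsilon> powr (-1/2) * \<bar>log 2 \<epsilon>\<bar> powr (3/2 * (real CARD('d) - 1) + 1)
          * max 1 (log 2 (real CARD('d))))"
proof -
  define D where "D = CARD('d)"
  define q where "q = D - 1"
  have D: "1 \<le> D" and q: "real q = real D - 1" by (simp_all add: D_def q_def Suc_le_eq)
  define A where "A = 2 ^ D * real D"
  have A: "1 \<le> A"
  proof -
    have "1 * 1 \<le> 2 ^ D * real D" using D by (intro mult_mono) auto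
    then show ?thesis by (simp add: A_def)
  qed
  define M where "M = max 1 (log 2 (real D))"
  have "1 \<le> M" by (simp add: M_def)
  define N :: "real \<Rightarrow> 'd architecture"
    where "N \<epsilon> = sparse_relu_architecture (sparse_level q \<epsilon>) (tent_count A \<epsilon>)" for \<epsilon>
  have expresses: "expresses (N \<epsilon>) f \<epsilon>"
    if "0 < \<epsilon>" "f \<in> korobov_space p" "korobov_seminorm f \<le> 1" for \<epsilon> p f
    unfolding N_def
  proof (rule sparse_relu_architecture_expresses[OF that(2,3)])
    show "sparse_constant (CARD('d) - 1) * (real (sparse_level q \<epsilon> + 1) ^ (CARD('d) - 1) * (1/4) ^ sparse_level q \<epsilon>) \<le> \<epsilon> / 2"
      using sparse_level[OF that(1), of q] by (simp only: q_def D_def)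
    show "2 ^ CARD('d) * (CARD('d) * (1 / 4 ^ tent_count A \<epsilon>)) \<le> \<epsilon> / 2"
      using tent_count[OF that(1), of A] by (simp add: A_def D_def mult.assoc)
  qed
  have small: "\<forall>\<^sub>F \<epsilon> in at_right 0. 0 < \<epsilon> \<and> \<epsilon> \<le> (1/2::real)"
    unfolding eventually_at_right_field by (intro exI[of _ "1/2"]) auto
  define a where "a = real (D + 3) * (log 2 (8 * A) + 2)"
  have "0 \<le> log 2 (8 * A)" using A by simp
  then have "0 \<le> a" unfolding a_def by (intro mult_nonneg_nonneg) auto
  have depth: "real (depth (N \<epsilon>)) \<le> a * \<bar>log 2 \<epsilon>\<bar>" if "0 < \<epsilon>" "\<epsilon> \<le> 1/2" for \<epsilon>
  proof -
    have "real (depth (N \<epsilon>)) = 3 + real D * (real (tent_count A \<epsilon>) + 1)"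
      by (simp add: N_def sparse_relu_architecture_def dense_architecture_def D_def algebra_simps)
    also have "\<dots> \<le> real (D + 3) * (real (tent_count A \<epsilon>) + 1)" by (simp add: algebra_simps)
    also have "\<dots> \<le> real (D + 3) * ((log 2 (8 * A) + 2) * \<bar>log 2 \<epsilon>\<bar>)"
      by (intro mult_left_mono tent_count_le that A) simp
    finally show ?thesis by (simp add: a_def)
  qed
  define b where "b = 2 * (8 * sparse_constant q) powr (1/2) *
    (log 2 (8 * sparse_constant q * sqrt (sparse_constant (2 * q))) + 2) powr (3/2 * q)"
  have "0 \<le> b" by (simp add: b_def)
  have size: "real (network_size (N \<epsilon>)) \<le>
    a * b * real (2 * D + 7) * (\<epsilon> powr (-1/2) * \<bar>log 2 \<epsilon>\<bar> powr (3/2 * (real D - 1) + 1))"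
    if \<epsilon>: "0 < \<epsilon>" "\<epsilon> \<le> 1/2" for \<epsilon>
  proof -
    let ?L = "\<bar>log 2 \<epsilon>\<bar>"
    let ?card = "card (grid_indices (sparse_level q \<epsilon>) :: (('d \<Rightarrow> nat) \<times> _) set)"
    have "real (network_size (N \<epsilon>)) = real (depth (N \<epsilon>)) * real ?card * real (2 * D + 7)"
      by (simp add: network_size_def N_def sparse_relu_architecture_def dense_architecture_def D_def algebra_simps)
    also have "\<dots> \<le> (a * ?L) * (b * (\<epsilon> powr (-1/2) * ?L powr (3/2 * q))) * real (2 * D + 7)"
    proof (intro mult_right_mono mult_mono depth \<epsilon>)
      show "real ?card \<le> b * (\<epsilon> powr (-1/2) * ?L powr (3/2 * q))"
        using grid_size_le[OF \<epsilon>, where 'd = 'd] unfolding b_def q_def D_def .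
    qed (use \<open>0 \<le> a\<close> in auto)
    also have "\<dots> = a * b * real (2 * D + 7) * (\<epsilon> powr (-1/2) * (?L powr (3/2 * q) * ?L powr 1))"
      by (simp add: mult_ac)
    also have "?L powr (3/2 * q) * ?L powr 1 = ?L powr (3/2 * (real D - 1) + 1)"
      unfolding powr_add q ..
    finally show ?thesis .
  qed
  have "(\<lambda>\<epsilon>. real (depth (N \<epsilon>))) \<in> O[at_right 0](\<lambda>\<epsilon>. \<bar>log 2 \<epsilon>\<bar> * M)"
  proof (rule bigoI[where c = a], rule eventually_mono[OF small])
    fix \<epsilon> :: real assume "0 < \<epsilon> \<and> \<epsilon> \<le> 1/2"
    then have "real (depth (N \<epsilon>)) \<le> a * \<bar>log 2 \<epsilon>\<bar> * 1" using depth by simp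
    also have "\<dots> \<le> a * \<bar>log 2 \<epsilon>\<bar> * M" using \<open>1 \<le> M\<close> \<open>0 \<le> a\<close> by (intro mult_left_mono) auto
    finally show "norm (real (depth (N \<epsilon>))) \<le> a * norm (\<bar>log 2 \<epsilon>\<bar> * M)"
      using \<open>1 \<le> M\<close> by (simp add: abs_mult mult.assoc)
  qed
  moreover have "(\<lambda>\<epsilon>. real (network_size (N \<epsilon>))) \<in> O[at_right 0](\<lambda>\<epsilon>.
      \<epsilon> powr (-1/2) * \<bar>log 2 \<epsilon>\<bar> powr (3/2 * (real D - 1) + 1) * M)"
  proof (rule bigoI[where c = "a * b * real (2 * D + 7)"], rule eventually_mono[OF small])
    fix \<epsilon> :: real assume \<epsilon>: "0 < \<epsilon> \<and> \<epsilon> \<le> 1/2"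
    let ?g = "\<epsilon> powr (-1/2) * \<bar>log 2 \<epsilon>\<bar> powr (3/2 * (real D - 1) + 1)"
    have "real (network_size (N \<epsilon>)) \<le> a * b * real (2 * D + 7) * ?g * 1" using size \<epsilon> by simp
    also have "\<dots> \<le> a * b * real (2 * D + 7) * ?g * M"
      using \<open>1 \<le> M\<close> \<open>0 \<le> a\<close> \<open>0 \<le> b\<close> by (intro mult_left_mono) auto
    finally show "norm (real (network_size (N \<epsilon>))) \<le> a * b * real (2 * D + 7) * norm (?g * M)"
      using \<open>1 \<le> M\<close> by (simp add: abs_mult mult.assoc)
  qed
  ultimately show ?thesis
    using expresses valid_sparse_relu_architecture unfolding M_def D_def
    by (intro exI[of _ N] conjI allI impI ballI) (auto simp: N_def)
qed

end
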